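(* Let $V$ be the $27$-dimensional irreducible representation of $e_6$, with invariant tensors $d_{abc}$, $d^{abc}$ normalized by $d^{acd}d_{bcd}=\delta^a_b$. Then the centralizer algebra $\mathrm{End}_{e_6}(V^{\otimes 3})$ has dimension $20$. It contains as a subalgebra $\mathrm{End}_{su(27)}(V^{\otimes 3})=\mathbb{C}S_3$ (the span of the six permutation operators of the tensor factors), and it is spanned by the following $25$ operators on $V^{\otimes 3}$: (order zero) the six operators permuting the three tensor factors; (order two) the nine operators $S_{ij}$, $i,j\in\{1,2,3\}$, together with the operator $T$; (order four) the nine operators $$S_{33}S_{11},\quad S_{33}S_{12},\quad S_{33}P_{23}S_{33},$$ $$S_{23}S_{11},\quad S_{23}P_{23}S_{32},\quad S_{21}S_{33},$$ $$S_{11}P_{12}S_{11},\quad S_{11}S_{32},\quad S_{11}S_{33}.$$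
   Context: Work over $\mathbb{C}$, with repeated indices summed. $V$ is the $27$-dimensional irreducible representation of the simple Lie algebra $e_6$. The spaces of $e_6$-invariants in $\mathrm{Sym}^3(V^* )$ and $\mathrm{Sym}^3(V)$ are one-dimensional; $d_{abc}$ and $d^{abc}$ denote the components, in a basis of $V$ and its dual basis, of spanning elements of these spaces, scaled so that $d^{acd}d_{bcd}=\delta^a_b$. (All operators below depend only on products of equally many $d_{\cdot\cdot\cdot}$ and $d^{\cdot\cdot\cdot}$, so they are well defined.) $\mathrm{End}_{e_6}(V^{\otimes 3})$ is the algebra of linear operators on $V^{\otimes 3}$ commuting with the action of $e_6$, and $\mathrm{End}_{su(27)}(V^{\otimes3})$ is the algebra of those commuting with $su(27)$ acting with $V=\mathbb{C}^{27}$ as its defining representation. An operator $X$ on $V^{\otimes 3}$ has components $X^{a_1a_2a_3}_{b_1b_2b_3}$ (upper indices for the output, lower for the input), and products are compositions. For $i,j\in\{1,2,3\}$, with $\{i,k,l\}=\{j,r,s\}=\{1,2,3\}$, define $$(S_{ij})^{a_1a_2a_3}_{b_1b_2b_3}=\delta^{a_i}_{b_j}\,d^{a_ka_le}\,d_{e\,b_rb_s},\qquad T^{a_1a_2a_3}_{b_1b_2b_3}=d^{a_1a_2a_3}d_{b_1b_2b_3}.$$ $P_{12}$ and $P_{23}$ are the operators transposing tensor factors $1,2$ and $2,3$ respectively. A diagrammatic order (zero, two, four) counts the number of tensors $d$ occurring. *)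

theory Defs
  imports "HOL-Analysis.Analysis"
begin

section \<open>The simple Lie algebra of type \<open>E\<^sub>6\<close>\<close>

locale complex_lie_algebra = vector_space scale
  for scale :: "complex \<Rightarrow> 'g::ab_group_add \<Rightarrow> 'g" +
  fixes bracket :: "'g \<Rightarrow> 'g \<Rightarrow> 'g"
  assumes bracket_add_left: "bracket (x + y) z = bracket x z + bracket y z"
    and bracket_add_right: "bracket x (y + z) = bracket x y + bracket x z"
    and bracket_scale_left: "bracket (scale c x) y = scale c (bracket x y)"
    and bracket_scale_right: "bracket x (scale c y) = scale c (bracket x y)"
    and bracket_self: "bracket x x = 0"
    and jacobi: "bracket x (bracket y z) + bracket y (bracket z x) + bracket z (bracket x y) = 0"
begin

definition lie_subalgebra :: "'g set \<Rightarrow> bool" where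
  "lie_subalgebra S \<longleftrightarrow> subspace S \<and> (\<forall>x\<in>S. \<forall>y\<in>S. bracket x y \<in> S)"

definition lie_ideal :: "'g set \<Rightarrow> bool" where
  "lie_ideal I \<longleftrightarrow> subspace I \<and> (\<forall>x. \<forall>y\<in>I. bracket x y \<in> I)"

definition lie_simple :: bool where
  "lie_simple \<longleftrightarrow> (\<exists>x y. bracket x y \<noteq> 0) \<and> (\<forall>I. lie_ideal I \<longrightarrow> I = {0} \<or> I = UNIV)"

definition lie_generated_by :: "'g set \<Rightarrow> bool" where
  "lie_generated_by X \<longleftrightarrow> (\<forall>S. lie_subalgebra S \<and> X \<subseteq> S \<longrightarrow> S = UNIV)"

text \<open>The Chevalley--Serre relations for a Cartan matrix \<open>A\<close> with index set \<open>I\<close>, where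
  \<open>A i j\<close> is the value of the \<open>j\<close>-th simple root on the \<open>i\<close>-th simple coroot.\<close>

definition chevalley_serre ::
    "nat set \<Rightarrow> (nat \<Rightarrow> nat \<Rightarrow> int) \<Rightarrow> (nat \<Rightarrow> 'g) \<Rightarrow> (nat \<Rightarrow> 'g) \<Rightarrow> (nat \<Rightarrow> 'g) \<Rightarrow> bool" where
  "chevalley_serre I A e f h \<longleftrightarrow>
     (\<forall>i\<in>I. \<forall>j\<in>I.
        bracket (h i) (h j) = 0 \<and>
        bracket (e i) (f j) = (if i = j then h i else 0) \<and>
        bracket (h i) (e j) = scale (of_int (A i j)) (e j) \<and>
        bracket (h i) (f j) = scale (- of_int (A i j)) (f j) \<and>
        (i \<noteq> j \<longrightarrow>
           (bracket (e i) ^^ nat (1 - A i j)) (e j) = 0 \<and>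
           (bracket (f i) ^^ nat (1 - A i j)) (f j) = 0))"

end

text \<open>Bourbaki numbering of the Dynkin diagram: a chain \<open>1 - 3 - 4 - 5 - 6\<close> with \<open>2\<close>
  attached to \<open>4\<close>.\<close>

definition e6_cartan :: "nat \<Rightarrow> nat \<Rightarrow> int" where
  "e6_cartan i j =
     (if i = j then 2
      else if {i, j} \<in> {{1, 3}, {3, 4}, {4, 5}, {5, 6}, {2, 4}} then -1
      else 0)"

text \<open>By Serre's theorem these conditions determine the Lie algebra up to isomorphism: the
  Lie algebra presented by the Chevalley--Serre relations of type \<open>E\<^sub>6\<close> is simple, so every
  nonzero quotient of it is the algebra itself.\<close>

locale e6_lie_algebra = complex_lie_algebra +
  assumes finite_dimensional: "\<exists>B. finite B \<and> span B = UNIV"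
    and simple: "lie_simple"
    and chevalley_generators:
      "\<exists>e f h. chevalley_serre {1..6} e6_cartan e f h \<and>
         lie_generated_by (e ` {1..6} \<union> f ` {1..6} \<union> h ` {1..6})"


section \<open>Matrix representations\<close>

definition cmat_scale :: "complex \<Rightarrow> complex^'n^'m \<Rightarrow> complex^'n^'m" where
  "cmat_scale c X = (\<chi> i j. c * X $ i $ j)"

global_interpretation cmat: vector_space "cmat_scale :: complex \<Rightarrow> complex^'n^'m \<Rightarrow> complex^'n^'m"
  by unfold_locales (simp_all add: cmat_scale_def vec_eq_iff algebra_simps)

text \<open>A representation on the column vectors \<open>complex^'n\<close>, that is, on a space of dimension
  \<open>CARD('n)\<close> in which a basis has been chosen.\<close>

locale lie_representation = complex_lie_algebra scale bracket
  for scale :: "complex \<Rightarrow> 'g::ab_group_add \<Rightarrow> 'g" and bracket :: "'g \<Rightarrow> 'g \<Rightarrow> 'g" +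
  fixes \<rho> :: "'g \<Rightarrow> complex^'n::finite^'n"
  assumes linear: "Vector_Spaces.linear scale cmat_scale \<rho>"
    and bracket: "\<rho> (bracket x y) = \<rho> x ** \<rho> y - \<rho> y ** \<rho> x"

locale irreducible_lie_representation = lie_representation +
  assumes irreducible:
    "vec.subspace W \<Longrightarrow> (\<And>x v. v \<in> W \<Longrightarrow> \<rho> x *v v \<in> W) \<Longrightarrow> W = {0} \<or> W = UNIV"

definition special_unitary_algebra :: "(complex^'n::finite^'n) set" where
  "special_unitary_algebra = {A. (\<forall>i j. A $ j $ i = - cnj (A $ i $ j)) \<and> trace A = 0}"


section \<open>Invariant cubic tensors\<close>

definition symmetric_tensor3 :: "('n \<Rightarrow> 'n \<Rightarrow> 'n \<Rightarrow> complex) \<Rightarrow> bool" where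
  "symmetric_tensor3 d \<longleftrightarrow> (\<forall>a b c. d a b c = d b a c \<and> d a b c = d a c b)"

text \<open>\<open>L\<close> is the set of matrices by which the Lie algebra acts on \<open>V\<close>. Tensors with lower indices
  live in \<open>Sym\<^sup>3(V\<^sup>*)\<close> (the overall sign of the dual action is irrelevant for invariance), those
  with upper indices in \<open>Sym\<^sup>3(V)\<close>.\<close>

definition lower_invariant :: "(complex^'n::finite^'n) set \<Rightarrow> ('n \<Rightarrow> 'n \<Rightarrow> 'n \<Rightarrow> complex) \<Rightarrow> bool" where
  "lower_invariant L d \<longleftrightarrow> symmetric_tensor3 d \<and>
     (\<forall>A\<in>L. \<forall>a b c.
        (\<Sum>e\<in>UNIV. A $ e $ a * d e b c + A $ e $ b * d a e c + A $ e $ c * d a b e) = 0)"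

definition upper_invariant :: "(complex^'n::finite^'n) set \<Rightarrow> ('n \<Rightarrow> 'n \<Rightarrow> 'n \<Rightarrow> complex) \<Rightarrow> bool" where
  "upper_invariant L d \<longleftrightarrow> symmetric_tensor3 d \<and>
     (\<forall>A\<in>L. \<forall>a b c.
        (\<Sum>e\<in>UNIV. A $ a $ e * d e b c + A $ b $ e * d a e c + A $ c $ e * d a b e) = 0)"


section \<open>Operators on the third tensor power\<close>

text \<open>Operators on \<open>V \<otimes> V \<otimes> V\<close> are matrices indexed by triples: \<open>X $ (a1, a2, a3) $ (b1, b2, b3)\<close>
  has output indices \<open>a\<close> and input indices \<open>b\<close>, and \<open>**\<close> is composition.\<close>

type_synonym 'n op3 = "complex ^ ('n \<times> 'n \<times> 'n) ^ ('n \<times> 'n \<times> 'n)"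

text \<open>\<open>A \<otimes> 1 \<otimes> 1 + 1 \<otimes> A \<otimes> 1 + 1 \<otimes> 1 \<otimes> A\<close>\<close>

definition act3 :: "complex^'n::finite^'n \<Rightarrow> 'n op3" where
  "act3 A = (\<chi> a b. case (a, b) of ((a1, a2, a3), (b1, b2, b3)) \<Rightarrow>
       (if a2 = b2 \<and> a3 = b3 then A $ a1 $ b1 else 0) +
       (if a1 = b1 \<and> a3 = b3 then A $ a2 $ b2 else 0) +
       (if a1 = b1 \<and> a2 = b2 then A $ a3 $ b3 else 0))"

definition End3 :: "(complex^'n::finite^'n) set \<Rightarrow> 'n op3 set" where
  "End3 L = {X. \<forall>A\<in>L. X ** act3 A = act3 A ** X}"

definition operator_algebra :: "(complex^'m::finite^'m) set \<Rightarrow> bool" where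
  "operator_algebra S \<longleftrightarrow> cmat.subspace S \<and> mat 1 \<in> S \<and> (\<forall>X\<in>S. \<forall>Y\<in>S. X ** Y \<in> S)"

text \<open>The tensor positions are numbered \<open>1, 2, 3\<close>; \<open>slot i\<close> selects the \<open>i\<close>-th index of a triple,
  and \<open>{i, other1 i, other2 i} = {1, 2, 3}\<close>.\<close>

definition slot :: "nat \<Rightarrow> 'n \<times> 'n \<times> 'n \<Rightarrow> 'n" where
  "slot i a = (case a of (a1, a2, a3) \<Rightarrow> if i = 1 then a1 else if i = 2 then a2 else a3)"

definition other1 :: "nat \<Rightarrow> nat" where
  "other1 i = (if i = 1 then 2 else 1)"

definition other2 :: "nat \<Rightarrow> nat" where
  "other2 i = (if i = 3 then 2 else 3)"

text \<open>\<open>perm_op \<sigma>\<close> moves the \<open>i\<close>-th tensor factor to position \<open>\<sigma> i\<close>.\<close>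

definition perm_op :: "(nat \<Rightarrow> nat) \<Rightarrow> 'n::finite op3" where
  "perm_op \<sigma> = (\<chi> a b. if \<forall>i\<in>{1, 2, 3}. slot (\<sigma> i) a = slot i b then 1 else 0)"

definition P12 :: "'n::finite op3" where
  "P12 = perm_op (Transposition.transpose 1 2)"

definition P23 :: "'n::finite op3" where
  "P23 = perm_op (Transposition.transpose 2 3)"

text \<open>In the following, \<open>u\<close> is the tensor with upper and \<open>d\<close> the tensor with lower indices.\<close>

definition S_op ::
    "('n \<Rightarrow> 'n \<Rightarrow> 'n \<Rightarrow> complex) \<Rightarrow> ('n \<Rightarrow> 'n \<Rightarrow> 'n \<Rightarrow> complex) \<Rightarrow> nat \<Rightarrow> nat \<Rightarrow> 'n::finite op3" where
  "S_op u d i j = (\<chi> a b.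
     (if slot i a = slot j b then 1 else 0) *
     (\<Sum>e\<in>UNIV. u (slot (other1 i) a) (slot (other2 i) a) e *
               d e (slot (other1 j) b) (slot (other2 j) b)))"

definition T_op ::
    "('n \<Rightarrow> 'n \<Rightarrow> 'n \<Rightarrow> complex) \<Rightarrow> ('n \<Rightarrow> 'n \<Rightarrow> 'n \<Rightarrow> complex) \<Rightarrow> 'n::finite op3" where
  "T_op u d = (\<chi> a b. u (slot 1 a) (slot 2 a) (slot 3 a) * d (slot 1 b) (slot 2 b) (slot 3 b))"

definition order_zero :: "'n::finite op3 set" where
  "order_zero = {perm_op \<sigma> |\<sigma>. \<sigma> permutes {1, 2, 3}}"

definition order_two ::
    "('n \<Rightarrow> 'n \<Rightarrow> 'n \<Rightarrow> complex) \<Rightarrow> ('n \<Rightarrow> 'n \<Rightarrow> 'n \<Rightarrow> complex) \<Rightarrow> 'n::finite op3 set" where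
  "order_two u d = {S_op u d i j |i j. i \<in> {1, 2, 3} \<and> j \<in> {1, 2, 3}} \<union> {T_op u d}"

definition order_four ::
    "('n \<Rightarrow> 'n \<Rightarrow> 'n \<Rightarrow> complex) \<Rightarrow> ('n \<Rightarrow> 'n \<Rightarrow> 'n \<Rightarrow> complex) \<Rightarrow> 'n::finite op3 set" where
  "order_four u d = (let S = S_op u d in
     {S 3 3 ** S 1 1, S 3 3 ** S 1 2, S 3 3 ** P23 ** S 3 3,
      S 2 3 ** S 1 1, S 2 3 ** P23 ** S 3 2, S 2 1 ** S 3 3,
      S 1 1 ** P12 ** S 1 1, S 1 1 ** S 3 2, S 1 1 ** S 3 3})"

end

theory Submission
  imports Defs "HOL-Computational_Algebra.Fundamental_Theorem_Algebra"
begin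

text \<open>
  Schur--Weyl duality for three tensor factors is elementary: an operator commuting with all matrix
  units preserves the number of occurrences of each basis vector, so it maps
  \<open>e\<^sub>1 \<otimes> e\<^sub>2 \<otimes> e\<^sub>3\<close> to a combination of its permutations, and this vector generates the whole space.

  For \<open>e\<^sub>6\<close>, a highest weight vector exists, weights can be lowered along each simple root with
  positive value, and every nonzero dominant weight except \<open>\<omega>\<^sub>1\<close> and \<open>\<omega>\<^sub>6\<close> leads in this way to more than
  27 weights. Up to the diagram automorphism the representation is therefore the minuscule one, and
  in a suitable basis of weight vectors the Chevalley generators are explicit 0--1 matrices with
  \<open>e\<^sub>i = f\<^sub>i\<^sup>T\<close>. Such a basis also determines the invariant cubic tensors up to scalars.

  An operator in the centralizer that kills all vectors annihilated by the \<open>e\<^sub>i\<close> vanishes, because the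
  range of its adjoint is a submodule. Such vectors are determined by ten of their components, which
  fall into weights with multiplicities 1, 2, 3, 1, 1, 2. Hence the dimension is at most
  \<open>1 + 4 + 9 + 1 + 1 + 4 = 20\<close>. Conversely the permutations, the \<open>S\<^sub>i\<^sub>j\<close>, \<open>T\<close> and four of the operators of
  order four are linearly independent, as one sees on the image of a single basis vector.
\<close>

section \<open>Kronecker products and index permutations\<close>

text \<open>The representation, both tensors and all operators are given in an arbitrary basis,
  while every computation takes place in a weight basis. Everything is therefore conjugated by the
  third tensor power of one matrix, with upper tensors pushed forward and lower ones pulled back.
  Neither complete reducibility nor a dimension formula is invoked. The standard Hermitian form
  replaces the former: in the weight basis E_i and F_i are adjoint to each other, so the adjoint of
  an operator commuting with all F_i commutes with all E_i. Counting distinct weights replaces the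
  latter, since vectors of distinct weights are independent. The ten components mirror the
  decomposition of the third tensor power: highest weights 3 omega_1, omega_4 and 0 with
  multiplicity one, omega_1 + omega_3 and omega_2 with multiplicity two, omega_1 + omega_6 with
  multiplicity three. The five linear relations among the 25 operators are never written down:
  twenty independent operators in a space spanned by at most 20 elements already span it, and the
  other five lie in their span.\<close>

lemma sum_UNIV_pair:
  "(\<Sum>p\<in>UNIV. f p) = (\<Sum>a\<in>(UNIV::'a::finite set). \<Sum>b\<in>(UNIV::'b::finite set). f (a, b))"
  by (simp add: sum.cartesian_product flip: UNIV_Times_UNIV)

lemma sum_sum_delta:
  fixes f :: "'a::finite \<Rightarrow> 'b::finite \<Rightarrow> 'c::comm_monoid_add"
  shows "(\<Sum>a\<in>UNIV. \<Sum>b\<in>UNIV. if x = a then f a b else 0) = (\<Sum>b\<in>UNIV. f x b)"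
    and "(\<Sum>a\<in>UNIV. \<Sum>b\<in>UNIV. if a = x then f a b else 0) = (\<Sum>b\<in>UNIV. f x b)"
proof -
  have "(\<Sum>a\<in>UNIV. \<Sum>b\<in>UNIV. if x = a then f a b else 0)
      = (\<Sum>a\<in>UNIV. if x = a then \<Sum>b\<in>UNIV. f a b else 0)"
    by (intro sum.cong) auto
  then show "(\<Sum>a\<in>UNIV. \<Sum>b\<in>UNIV. if x = a then f a b else 0) = (\<Sum>b\<in>UNIV. f x b)"
    by simp
  then show "(\<Sum>a\<in>UNIV. \<Sum>b\<in>UNIV. if a = x then f a b else 0) = (\<Sum>b\<in>UNIV. f x b)"
    by (simp add: eq_commute)
qed

definition kron :: "complex^'a^'b \<Rightarrow> complex^'c^'d \<Rightarrow> complex^('a \<times> 'c)^('b \<times> 'd)" where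
  "kron A B = (\<chi> p q. A $ fst p $ fst q * B $ snd p $ snd q)"

lemma kron_mult: "kron A B ** kron C D = kron (A ** C) (B ** D)"
  by (simp add: kron_def matrix_matrix_mult_def vec_eq_iff sum_UNIV_pair sum_product ac_simps)

lemma kron_mat_1: "kron (mat 1) (mat 1) = mat 1"
  by (auto simp: kron_def mat_def vec_eq_iff)

definition tens3 :: "complex^'n::finite^'n \<Rightarrow> 'n op3" where
  "tens3 Q = kron Q (kron Q Q)"

lemma tens3_mult: "tens3 P ** tens3 Q = tens3 (P ** Q)"
  by (simp add: tens3_def kron_mult)

lemma tens3_mat_1: "tens3 (mat 1) = mat 1"
  by (simp add: tens3_def kron_mat_1)

section \<open>Permutations of the tensor factors as substitutions of indices\<close>

definition reindex_op :: "('n \<times> 'n \<times> 'n \<Rightarrow> 'n \<times> 'n \<times> 'n) \<Rightarrow> 'n::finite op3" where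
  "reindex_op f = (\<chi> a b. if b = f a then 1 else 0)"

lemma reindex_op_mult: "(reindex_op f ** X) $ a $ b = X $ f a $ b"
  by (simp add: matrix_matrix_mult_def reindex_op_def if_distrib[of "\<lambda>x. x * _"] cong: if_cong)

text \<open>Row \<open>a\<close> of \<open>reindex_op f\<close> has its only 1 in column
  \<open>f a\<close>. Multiplication on the left thus substitutes \<open>f\<close> in the row index,
  while multiplication on the right substitutes the inverse \<open>g\<close> in the column
  index.\<close>

lemma mult_reindex_op:
  assumes "\<And>p. f (g p) = p" "\<And>p. g (f p) = p"
  shows "(X ** reindex_op f) $ a $ b = X $ a $ g b"
proof -
  have "b = f c \<longleftrightarrow> c = g b" for c
    using assms by metis
  then show ?thesis
    by (simp add: matrix_matrix_mult_def reindex_op_def if_distrib[of "\<lambda>x. _ * x"] cong: if_cong)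
qed

abbreviation (input) "p123 \<equiv> \<lambda>(x, y, z). (x, y, z)"
abbreviation (input) "p213 \<equiv> \<lambda>(x, y, z). (y, x, z)"
abbreviation (input) "p132 \<equiv> \<lambda>(x, y, z). (x, z, y)"
abbreviation (input) "p321 \<equiv> \<lambda>(x, y, z). (z, y, x)"
abbreviation (input) "p231 \<equiv> \<lambda>(x, y, z). (y, z, x)"
abbreviation (input) "p312 \<equiv> \<lambda>(x, y, z). (z, x, y)"

lemma perm_op_eq_reindex:
  assumes "\<sigma> permutes {1, 2, 3}"
  shows "perm_op \<sigma> = reindex_op (\<lambda>a. (slot (\<sigma> 1) a, slot (\<sigma> 2) a, slot (\<sigma> 3) a))"
  by (auto simp: perm_op_def reindex_op_def vec_eq_iff slot_def)

lemma P12_eq: "P12 = reindex_op p213"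
  unfolding P12_def by (subst perm_op_eq_reindex)
    (auto intro!: permutes_swap_id arg_cong[of _ _ reindex_op] simp: slot_def transpose_def fun_eq_iff)

lemma P23_eq: "P23 = reindex_op p132"
  unfolding P23_def by (subst perm_op_eq_reindex)
    (auto intro!: permutes_swap_id arg_cong[of _ _ reindex_op] simp: slot_def transpose_def fun_eq_iff)

lemma slot_triples:
  "(\<lambda>a. (slot 1 a, slot 2 a, slot 3 a)) = p123" "(\<lambda>a. (slot 2 a, slot 1 a, slot 3 a)) = p213"
  "(\<lambda>a. (slot 1 a, slot 3 a, slot 2 a)) = p132" "(\<lambda>a. (slot 3 a, slot 2 a, slot 1 a)) = p321"
  "(\<lambda>a. (slot 2 a, slot 3 a, slot 1 a)) = p231" "(\<lambda>a. (slot 3 a, slot 1 a, slot 2 a)) = p312"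
  by (simp_all add: slot_def case_prod_unfold)

lemma distinct_123:
  assumes "x \<in> {1, 2, 3::nat}" "y \<in> {1, 2, 3}" "z \<in> {1,2,3}" "x \<noteq> y" "x \<noteq> z" "y \<noteq> z"
  shows "(x, y, z) \<in> {(1, 2, 3), (2, 1, 3), (1, 3, 2), (3, 2, 1), (2, 3, 1), (3, 1, 2)}"
  using assms by auto

lemma permutes_123_values:
  assumes s: "\<sigma> permutes {1::nat, 2, 3}"
  shows "(\<sigma> 1, \<sigma> 2, \<sigma> 3) \<in> {(1, 2, 3), (2, 1, 3), (1, 3, 2), (3, 2, 1), (2, 3, 1), (3, 1, 2)}"
  using inj_eq[OF permutes_inj[OF s]] permutes_in_image[OF s]
  by (intro distinct_123) simp_all

lemma perm_op_triple:
  assumes "\<sigma> permutes {1, 2, 3}" "(\<sigma> 1, \<sigma> 2, \<sigma> 3) = (i, j, k)"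
  shows "perm_op \<sigma> = reindex_op (\<lambda>a. (slot i a, slot j a, slot k a))"
  using perm_op_eq_reindex[OF assms(1)] assms(2) by simp

text \<open>A permutation of {1, 2, 3} is determined by its triple of values, which leaves six
  explicit rearrangements of a triple of indices.\<close>

lemma order_zero_eq:
  "(order_zero :: 'n::finite op3 set) = reindex_op ` {p123, p213, p132, p321, p231, p312}"
    (is "_ = ?R")
proof
  show "order_zero \<subseteq> ?R"
  proof
    fix X :: "'n op3" assume "X \<in> order_zero"
    then obtain \<sigma> where s: "\<sigma> permutes {1::nat, 2, 3}" and X: "X = perm_op \<sigma>"
      unfolding order_zero_def by blast
    consider "(\<sigma> 1, \<sigma> 2, \<sigma> 3) = (1, 2, 3)"
      | "(\<sigma> 1, \<sigma> 2, \<sigma> 3) = (2, 1, 3)"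
      | "(\<sigma> 1, \<sigma> 2, \<sigma> 3) = (1, 3, 2)"
      | "(\<sigma> 1, \<sigma> 2, \<sigma> 3) = (3, 2, 1)"
      | "(\<sigma> 1, \<sigma> 2, \<sigma> 3) = (2, 3, 1)"
      | "(\<sigma> 1, \<sigma> 2, \<sigma> 3) = (3, 1, 2)"
      using permutes_123_values[OF s] by blast
    then show "X \<in> ?R"
      by cases
        (drule perm_op_triple[OF s],
         simp only: X slot_triples image_insert, blast)+
  qed
  let ?a = "Transposition.transpose (1::nat) 2" and ?b = "Transposition.transpose (2::nat) 3"
  have a: "?a permutes {1, 2, 3}" and b: "?b permutes {1, 2, 3}"
    and c: "Transposition.transpose (1::nat) 3 permutes {1, 2, 3}"
    by (auto intro: permutes_swap_id)
  have *: "reindex_op (\<lambda>a. (slot i a, slot j a, slot k a)) \<in> (order_zero :: 'n op3 set)"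
    if "\<sigma> permutes {1, 2, 3}" "(\<sigma> 1, \<sigma> 2, \<sigma> 3) = (i, j, k)" for \<sigma> i j k
    using perm_op_triple[OF that, symmetric] that(1) unfolding order_zero_def by blast
  show "?R \<subseteq> order_zero"
    unfolding image_insert image_empty insert_subset slot_triples[symmetric]
  proof (intro conjI empty_subsetI)
    show "reindex_op (\<lambda>a. (slot 1 a, slot 2 a, slot 3 a)) \<in> (order_zero :: 'n op3 set)"
      by (rule *[OF permutes_id]) (simp add: transpose_def)
    show "reindex_op (\<lambda>a. (slot 2 a, slot 1 a, slot 3 a)) \<in> (order_zero :: 'n op3 set)"
      by (rule *[OF a]) (simp add: transpose_def)
    show "reindex_op (\<lambda>a. (slot 1 a, slot 3 a, slot 2 a)) \<in> (order_zero :: 'n op3 set)"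
      by (rule *[OF b]) (simp add: transpose_def)
    show "reindex_op (\<lambda>a. (slot 3 a, slot 2 a, slot 1 a)) \<in> (order_zero :: 'n op3 set)"
      by (rule *[OF c]) (simp add: transpose_def)
    show "reindex_op (\<lambda>a. (slot 2 a, slot 3 a, slot 1 a)) \<in> (order_zero :: 'n op3 set)"
      by (rule *[OF permutes_compose[OF b a]]) (simp add: transpose_def)
    show "reindex_op (\<lambda>a. (slot 3 a, slot 1 a, slot 2 a)) \<in> (order_zero :: 'n op3 set)"
      by (rule *[OF permutes_compose[OF a b]]) (simp add: transpose_def)
  qed
qed


section \<open>The commutant of a set of matrices on the third tensor power\<close>

lemma sum_if_conj_delta:
  fixes f :: "'a::finite \<Rightarrow> 'b::finite \<Rightarrow> complex"
  shows "(\<Sum>x\<in>UNIV. \<Sum>y\<in>UNIV. if x = a \<and> y = b then f x y else 0) = f a b"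
proof -
  have "(\<Sum>x\<in>UNIV. \<Sum>y\<in>UNIV. if x = a \<and> y = b then f x y else 0)
      = (\<Sum>x\<in>UNIV. if x = a then (\<Sum>y\<in>UNIV. if y = b then f x y else 0) else 0)"
    by (intro sum.cong) auto
  then show ?thesis by simp
qed

lemma act3_vec:
  "(act3 A *v w) $ (a, b, c) =
    (\<Sum>e\<in>UNIV. A $ a $ e * w $ (e, b, c) + A $ b $ e * w $ (a, e, c) + A $ c $ e * w $ (a, b, e))"
proof -
  have "(act3 A *v w) $ (a, b, c) =
     (\<Sum>x\<in>UNIV. \<Sum>y\<in>UNIV. \<Sum>z\<in>UNIV. if y = b \<and> z = c then A $ a $ x * w $ (x, y, z) else 0)
   + (\<Sum>y\<in>UNIV. \<Sum>x\<in>UNIV. \<Sum>z\<in>UNIV. if x = a \<and> z = c then A $ b $ y * w $ (x, y, z) else 0)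
   + (\<Sum>z\<in>UNIV. \<Sum>x\<in>UNIV. \<Sum>y\<in>UNIV. if x = a \<and> y = b then A $ c $ z * w $ (x, y, z) else 0)"
    (is "_ = ?p + ?q + ?r")
  proof -
    have q: "?q = (\<Sum>x\<in>UNIV. \<Sum>y\<in>UNIV. \<Sum>z\<in>UNIV. if x = a \<and> z = c then A $ b $ y * w $ (x, y, z) else 0)"
      by (rule sum.swap)
    have "?r = (\<Sum>x\<in>UNIV. \<Sum>z\<in>UNIV. \<Sum>y\<in>UNIV. if x = a \<and> y = b then A $ c $ z * w $ (x, y, z) else 0)"
      by (rule sum.swap)
    also have "\<dots> = (\<Sum>x\<in>UNIV. \<Sum>y\<in>UNIV. \<Sum>z\<in>UNIV. if x = a \<and> y = b then A $ c $ z * w $ (x, y, z) else 0)"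
      by (intro sum.cong refl sum.swap)
    finally have r: "?r = \<dots>" .
    show ?thesis unfolding q r
      by (simp add: matrix_vector_mult_def act3_def sum_UNIV_pair if_distrib[of "\<lambda>x. x * _"]
          sum.distrib[symmetric] distrib_right, intro sum.cong refl) auto
  qed
  also have "\<dots> = (\<Sum>x\<in>UNIV. A $ a $ x * w $ (x, b, c)) + (\<Sum>y\<in>UNIV. A $ b $ y * w $ (a, y, c))
      + (\<Sum>z\<in>UNIV. A $ c $ z * w $ (a, b, z))"
    by (simp add: sum_if_conj_delta)
  finally show ?thesis by (simp add: sum.distrib)
qed

lemma act3_nth:
  "act3 A $ (a1, a2, a3) $ (b1, b2, b3) =
    (if a2 = b2 \<and> a3 = b3 then A $ a1 $ b1 else 0) +
    (if a1 = b1 \<and> a3 = b3 then A $ a2 $ b2 else 0) +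
    (if a1 = b1 \<and> a2 = b2 then A $ a3 $ b3 else 0)"
  by (simp add: act3_def)

lemma transpose_act3: "transpose (act3 A) = act3 (transpose A)"
  by (auto simp: transpose_def act3_def vec_eq_iff)

lemma matrix_mult_column: "(X ** Y) $ a $ b = (X *v (\<chi> p. Y $ p $ b)) $ a"
  by (simp add: matrix_matrix_mult_def matrix_vector_mult_def)

lemma act3_mult_left:
  "(act3 A ** X) $ (a, b, c) $ p =
    (\<Sum>e\<in>UNIV. A $ a $ e * X $ (e, b, c) $ p + A $ b $ e * X $ (a, e, c) $ p + A $ c $ e * X $ (a, b, e) $ p)"
  by (simp add: matrix_mult_column act3_vec)

lemma act3_covec:
  "(w v* act3 A) $ (a, b, c) =
    (\<Sum>e\<in>UNIV. A $ e $ a * w $ (e, b, c) + A $ e $ b * w $ (a, e, c) + A $ e $ c * w $ (a, b, e))"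
proof -
  have "w v* act3 A = act3 (transpose A) *v w"
    by (simp flip: transpose_act3)
  then show ?thesis by (simp add: act3_vec transpose_def)
qed

lemma act3_mult_right:
  "(X ** act3 A) $ p $ (a, b, c) =
    (\<Sum>e\<in>UNIV. A $ e $ a * X $ p $ (e, b, c) + A $ e $ b * X $ p $ (a, e, c) + A $ e $ c * X $ p $ (a, b, e))"
proof -
  have "(X ** act3 A) $ p $ (a, b, c) = ((X $ p) v* act3 A) $ (a, b, c)"
    by (simp add: matrix_matrix_mult_def vector_matrix_mult_def mult.commute)
  then show ?thesis by (simp add: act3_covec)
qed

lemma tens3_nth: "tens3 Q $ (a, b, c) $ (x, y, z) = Q $ a $ x * (Q $ b $ y * Q $ c $ z)"
  by (simp add: tens3_def kron_def)

text \<open>By the Leibniz rule both products split into three terms, one per tensor factor, and in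
  each of them a single \<open>Q ** A\<close> is exchanged for \<open>B ** Q\<close>.\<close>

lemma tens3_act3:
  assumes "Q ** A = B ** Q"
  shows "tens3 Q ** act3 A = act3 B ** tens3 Q"
proof -
  have QA: "(\<Sum>e\<in>UNIV. Q $ a $ e * A $ e $ x) = (\<Sum>e\<in>UNIV. B $ a $ e * Q $ e $ x)" for a x
    using assms by (simp add: matrix_matrix_mult_def vec_eq_iff)
  have "(tens3 Q ** act3 A) $ (a, b, c) $ (x, y, z) = (act3 B ** tens3 Q) $ (a, b, c) $ (x, y, z)"
    for a b c x y z
  proof -
    have "(tens3 Q ** act3 A) $ (a, b, c) $ (x, y, z) =
        (\<Sum>e\<in>UNIV. Q $ a $ e * A $ e $ x) * (Q $ b $ y * Q $ c $ z)
      + (\<Sum>e\<in>UNIV. Q $ b $ e * A $ e $ y) * (Q $ a $ x * Q $ c $ z)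
      + (\<Sum>e\<in>UNIV. Q $ c $ e * A $ e $ z) * (Q $ a $ x * Q $ b $ y)"
      by (simp add: act3_mult_right tens3_nth sum.distrib sum_distrib_left sum_distrib_right ac_simps)
    moreover have "(act3 B ** tens3 Q) $ (a, b, c) $ (x, y, z) =
        (\<Sum>e\<in>UNIV. B $ a $ e * Q $ e $ x) * (Q $ b $ y * Q $ c $ z)
      + (\<Sum>e\<in>UNIV. B $ b $ e * Q $ e $ y) * (Q $ a $ x * Q $ c $ z)
      + (\<Sum>e\<in>UNIV. B $ c $ e * Q $ e $ z) * (Q $ a $ x * Q $ b $ y)"
      by (simp add: act3_mult_left tens3_nth sum.distrib sum_distrib_left sum_distrib_right ac_simps)
    ultimately show ?thesis by (simp only: QA)
  qed
  then show ?thesis by (simp add: vec_eq_iff)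
qed

lemma operator_algebra_End3: "operator_algebra (End3 L)"
proof -
  have distrib: "(X + Y) ** Z = X ** Z + Y ** Z" for X Y Z :: "'a op3"
    by (simp add: matrix_matrix_mult_def vec_eq_iff distrib_right sum.distrib)
  have "cmat_scale c X ** Y = cmat_scale c (X ** Y)" "Y ** cmat_scale c X = cmat_scale c (Y ** X)"
    for c and X Y :: "'a op3"
    by (simp_all add: cmat_scale_def matrix_matrix_mult_def vec_eq_iff sum_distrib_left ac_simps)
  then show ?thesis
    unfolding operator_algebra_def cmat.subspace_def End3_def
    by (auto simp: matrix_add_ldistrib distrib simp flip: matrix_mul_assoc)
       (simp add: matrix_mul_assoc)
qed

lemma End3_mult: "X \<in> End3 L \<Longrightarrow> Y \<in> End3 L \<Longrightarrow> X ** Y \<in> End3 L"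
  using operator_algebra_End3 unfolding operator_algebra_def by blast

lemma reindex_op_commute:
  assumes "\<And>p. f (g p) = p" "\<And>p. g (f p) = p" "\<And>a b. M $ f a $ b = M $ a $ g b"
  shows "M ** reindex_op f = reindex_op f ** M"
  by (simp add: vec_eq_iff reindex_op_mult mult_reindex_op[of f g] assms)

lemma reindex_op_in_End3:
  assumes "\<And>p. f (g p) = p" "\<And>p. g (f p) = p"
    and "\<And>A a b. A \<in> L \<Longrightarrow> act3 A $ f a $ b = act3 A $ a $ g b"
  shows "reindex_op f \<in> End3 L"
  unfolding End3_def by (simp add: vec_eq_iff reindex_op_mult mult_reindex_op[of f g] assms)

lemma order_zero_subset_End3: "order_zero \<subseteq> End3 L"
proof -
  have "reindex_op p123 \<in> End3 L"
    by (rule reindex_op_in_End3[of _ p123]) (simp_all add: split_paired_all act3_nth conj_ac add.commute add.left_commute)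
  moreover have "reindex_op p213 \<in> End3 L"
    by (rule reindex_op_in_End3[of _ p213]) (simp_all add: split_paired_all act3_nth conj_ac add.commute add.left_commute)
  moreover have "reindex_op p132 \<in> End3 L"
    by (rule reindex_op_in_End3[of _ p132]) (simp_all add: split_paired_all act3_nth conj_ac add.commute add.left_commute)
  moreover have "reindex_op p321 \<in> End3 L"
    by (rule reindex_op_in_End3[of _ p321]) (simp_all add: split_paired_all act3_nth conj_ac add.commute add.left_commute)
  \<comment> \<open>The two cyclic rearrangements are inverse to each other, whereas each of the
    four above is its own inverse.\<close>
  moreover have "reindex_op p231 \<in> End3 L"
    by (rule reindex_op_in_End3[of _ p312]) (simp_all add: split_paired_all act3_nth conj_ac add.commute add.left_commute)
  moreover have "reindex_op p312 \<in> End3 L"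
    by (rule reindex_op_in_End3[of _ p231]) (simp_all add: split_paired_all act3_nth conj_ac add.commute add.left_commute)
  ultimately show ?thesis unfolding order_zero_eq by (simp only: image_insert image_empty insert_subset empty_subsetI simp_thms)
qed

section \<open>Invariance of the operators built from invariant tensors\<close>

definition vec3 :: "('n::finite \<Rightarrow> 'n \<Rightarrow> 'n \<Rightarrow> complex) \<Rightarrow> complex^('n \<times> 'n \<times> 'n)" where
  "vec3 u = (\<chi> p. u (fst p) (fst (snd p)) (snd (snd p)))"

lemma vec3_nth [simp]: "vec3 u $ (a, b, c) = u a b c"
  by (simp add: vec3_def)

lemma upper_invariant_act3:
  assumes "upper_invariant L u" "A \<in> L"
  shows "act3 A *v vec3 u = 0"
  using assms by (simp add: upper_invariant_def vec_eq_iff act3_vec)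

lemma lower_invariant_act3:
  assumes "lower_invariant L d" "A \<in> L"
  shows "vec3 d v* act3 A = 0"
  using assms by (simp add: lower_invariant_def vec_eq_iff act3_covec)

text \<open>The upper tensor becomes a map from V* to the tensor square of V, and the lower one
  (\<open>lowmat\<close>) a map back to V*; their composite on factors 2 and 3 is S_11.\<close>

definition upmat :: "('n::finite \<Rightarrow> 'n \<Rightarrow> 'n \<Rightarrow> complex) \<Rightarrow> complex^'n^('n \<times> 'n)" where
  "upmat u = (\<chi> p e. u (fst p) (snd p) e)"

definition lowmat :: "('n::finite \<Rightarrow> 'n \<Rightarrow> 'n \<Rightarrow> complex) \<Rightarrow> complex^('n \<times> 'n)^'n" where
  "lowmat d = (\<chi> e q. d e (fst q) (snd q))"

definition act2 :: "complex^'n::finite^'n \<Rightarrow> complex^('n \<times> 'n)^('n \<times> 'n)" where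
  "act2 A = kron A (mat 1) + kron (mat 1) A"

lemma matrix_mult_add_left: "(X + Y) ** Z = X ** Z + Y ** (Z :: complex^'a^'b)"
  by (simp add: matrix_matrix_mult_def vec_eq_iff distrib_right sum.distrib)

lemma matrix_mult_uminus:
  "(- X) ** Y = - (X ** (Y :: complex^'a^'b))" "X ** (- Y) = - (X ** (Y :: complex^'a^'b))"
  by (simp_all add: matrix_matrix_mult_def vec_eq_iff sum_negf)

lemma act3_eq_kron: "act3 A = kron A (mat 1) + kron (mat 1) (act2 A)"
  by (auto simp: vec_eq_iff act3_nth kron_def act2_def mat_def)

text \<open>V* carries the action of \<open>- transpose A\<close>. Invariance of the tensor is
  therefore equivariance of this map, the sign arising when the third index changes sides.\<close>

lemma act2_upmat:
  assumes "act3 A *v vec3 u = 0"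
  shows "act2 A ** upmat u = - (upmat u ** transpose A)"
proof -
  have "(act2 A ** upmat u) $ (a, b) $ c + (upmat u ** transpose A) $ (a, b) $ c
      = (act3 A *v vec3 u) $ (a, b, c)" for a b c
    by (simp add: act3_vec act2_def matrix_mult_add_left)
       (simp add: matrix_matrix_mult_def kron_def mat_def upmat_def transpose_def sum_UNIV_pair
         if_distrib[of "\<lambda>x. x * _"] if_distrib[of "\<lambda>x. _ * x"] sum.distrib sum_sum_delta mult.commute cong: if_cong)
  then show ?thesis using assms by (simp add: vec_eq_iff eq_neg_iff_add_eq_0)
qed

lemma lowmat_act2:
  assumes "vec3 d v* act3 A = 0"
  shows "lowmat d ** act2 A = - (transpose A ** lowmat d)"
proof -
  have "(lowmat d ** act2 A) $ a $ (b, c) + (transpose A ** lowmat d) $ a $ (b, c)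
      = (vec3 d v* act3 A) $ (a, b, c)" for a b c
    by (simp add: act3_covec act2_def matrix_add_ldistrib)
       (simp add: matrix_matrix_mult_def kron_def mat_def lowmat_def transpose_def sum_UNIV_pair
         if_distrib[of "\<lambda>x. x * _"] if_distrib[of "\<lambda>x. _ * x"] sum.distrib sum_sum_delta mult.commute cong: if_cong)
  then show ?thesis using assms by (simp add: vec_eq_iff eq_neg_iff_add_eq_0)
qed

text \<open>The minus signs of the two actions on V* cancel in the composite, so it commutes with
  the action on factors 2 and 3; factor 1 is untouched.\<close>

lemma kron_contraction_in_End3:
  assumes "upper_invariant L u" "lower_invariant L d"
  shows "kron (mat 1) (upmat u ** lowmat d) \<in> End3 L"
proof -
  have "act2 A ** (upmat u ** lowmat d) = (upmat u ** lowmat d) ** act2 A" if "A \<in> L" for A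
  proof -
    have "act2 A ** (upmat u ** lowmat d) = - (upmat u ** transpose A) ** lowmat d"
      by (simp add: matrix_mul_assoc act2_upmat[OF upper_invariant_act3[OF assms(1) that]])
    also have "\<dots> = upmat u ** (lowmat d ** act2 A)"
      by (simp add: lowmat_act2[OF lower_invariant_act3[OF assms(2) that]] matrix_mult_uminus matrix_mul_assoc)
    finally show ?thesis by (simp add: matrix_mul_assoc)
  qed
  then show ?thesis
    by (simp add: End3_def act3_eq_kron matrix_add_ldistrib matrix_mult_add_left kron_mult)
qed

text \<open>Every S_ij is S_11 between two rearrangements: \<open>F k\<close> brings factor k to the
  front and keeps the order of the other two, \<open>G k\<close> undoes this. The rearrangements are
  independent of the tensors, so one choice serves both pairs of tensors in
  \<open>tens3_S_op\<close>.\<close>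

lemma S_op_factor:
  assumes "i \<in> {1, 2, 3}" "j \<in> {1, 2, 3}"
  obtains f g where "f \<in> {p123, p213, p312}" "g \<in> {p123, p213, p231}"
    "\<And>u d :: 'n::finite \<Rightarrow> _. S_op u d i j = reindex_op f ** kron (mat 1) (upmat u ** lowmat d) ** reindex_op g"
proof -
  define F :: "nat \<Rightarrow> 'n \<times> 'n \<times> 'n \<Rightarrow> _" where
    "F k = (if k = 1 then p123 else if k = 2 then p213 else p312)" for k
  define G :: "nat \<Rightarrow> 'n \<times> 'n \<times> 'n \<Rightarrow> _" where
    "G k = (if k = 1 then p123 else if k = 2 then p213 else p231)" for k
  have F: "F k a = (slot k a, slot (other1 k) a, slot (other2 k) a)" if "k \<in> {1, 2, 3}" for k a
    using that by (cases a) (auto simp: F_def slot_def other1_def other2_def)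
  have FG: "G k (F k p) = p" "F k (G k p) = p" if "k \<in> {1, 2, 3}" for k p
    using that by (cases p; auto simp: F_def G_def)+
  have "S_op u d i j = reindex_op (F i) ** kron (mat 1) (upmat u ** lowmat d) ** reindex_op (G j)"
    for u d :: "'n \<Rightarrow> _"
    by (simp add: vec_eq_iff mult_reindex_op[of "G j" "F j"] FG[OF assms(2)] reindex_op_mult)
       (simp add: F[OF assms(1)] F[OF assms(2)] kron_def S_op_def mat_def matrix_matrix_mult_def
          upmat_def lowmat_def)
  moreover have "F i \<in> {p123, p213, p312}" "G j \<in> {p123, p213, p231}"
    by (simp_all add: F_def G_def)
  ultimately show thesis using that by blast
qed

lemma reindex_op_permutations_in_End3:
  assumes "f \<in> {p123, p213, p132, p321, p231, p312}"
  shows "reindex_op f \<in> End3 L"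
  using imageI[OF assms, of reindex_op] order_zero_subset_End3[of L]
  unfolding order_zero_eq by (rule rev_subsetD)

lemma S_op_in_End3:
  assumes "upper_invariant L u" "lower_invariant L d" "i \<in> {1, 2, 3}" "j \<in> {1, 2, 3}"
  shows "S_op u d i j \<in> End3 L"
proof -
  obtain f g where "f \<in> {p123, p213, p312}" "g \<in> {p123, p213, p231}"
    and *: "S_op u d i j = reindex_op f ** kron (mat 1) (upmat u ** lowmat d) ** reindex_op g"
    using S_op_factor[OF assms(3,4)] by metis
  then have "reindex_op f \<in> End3 L" "reindex_op g \<in> End3 L"
    by (auto intro: reindex_op_permutations_in_End3)
  then show ?thesis
    unfolding * by (intro End3_mult kron_contraction_in_End3 assms)
qed

text \<open>\<open>T\<close> has rank one, a column \<open>vec3 u\<close> times a row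
  \<open>vec3 d\<close>, so a further factor only acts on one of the two vectors.\<close>

lemma mult_T_op: "(X ** T_op u d) $ a $ b = (X *v vec3 u) $ a * vec3 d $ b"
  by (cases b) (simp add: matrix_matrix_mult_def matrix_vector_mult_def T_op_def vec3_def slot_def
    case_prod_unfold sum_distrib_right mult.assoc)

lemma T_op_mult: "(T_op u d ** X) $ a $ b = vec3 u $ a * (vec3 d v* X) $ b"
  by (cases a) (simp add: matrix_matrix_mult_def vector_matrix_mult_def T_op_def vec3_def slot_def
    case_prod_unfold sum_distrib_left ac_simps)

lemma T_op_in_End3:
  assumes "upper_invariant L u" "lower_invariant L d"
  shows "T_op u d \<in> End3 L"
  by (auto simp: End3_def vec_eq_iff mult_T_op T_op_mult upper_invariant_act3[OF assms(1)]
      lower_invariant_act3[OF assms(2)])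

lemma generators_subset_End3:
  assumes "upper_invariant L u" "lower_invariant L d"
  shows "order_zero \<union> order_two u d \<union> order_four u d \<subseteq> End3 L"
proof -
  note S = S_op_in_End3[OF assms]
  have P: "P12 \<in> End3 L" "P23 \<in> End3 L"
    unfolding P12_eq P23_eq by (rule reindex_op_permutations_in_End3, simp only: insert_iff simp_thms)+
  have "order_two u d \<subseteq> End3 L"
    using S T_op_in_End3[OF assms] unfolding order_two_def by blast
  moreover have "order_four u d \<subseteq> End3 L"
    unfolding order_four_def Let_def insert_subset
    by (intro conjI End3_mult S P empty_subsetI) simp_all
  ultimately show ?thesis using order_zero_subset_End3 by blast
qed


section \<open>Change of basis\<close>

lemma tens3_reindex_op:
  assumes "f \<in> {p123, p213, p132, p321, p231, p312}"
  shows "tens3 Q ** reindex_op f = reindex_op f ** tens3 Q"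
proof -
  have "tens3 Q ** reindex_op p123 = reindex_op p123 ** tens3 Q"
    by (rule reindex_op_commute[of _ p123]) (simp_all add: split_paired_all tens3_nth ac_simps)
  moreover have "tens3 Q ** reindex_op p213 = reindex_op p213 ** tens3 Q"
    by (rule reindex_op_commute[of _ p213]) (simp_all add: split_paired_all tens3_nth ac_simps)
  moreover have "tens3 Q ** reindex_op p132 = reindex_op p132 ** tens3 Q"
    by (rule reindex_op_commute[of _ p132]) (simp_all add: split_paired_all tens3_nth ac_simps)
  moreover have "tens3 Q ** reindex_op p321 = reindex_op p321 ** tens3 Q"
    by (rule reindex_op_commute[of _ p321]) (simp_all add: split_paired_all tens3_nth ac_simps)
  moreover have "tens3 Q ** reindex_op p231 = reindex_op p231 ** tens3 Q"
    by (rule reindex_op_commute[of _ p312]) (simp_all add: split_paired_all tens3_nth ac_simps)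
  moreover have "tens3 Q ** reindex_op p312 = reindex_op p312 ** tens3 Q"
    by (rule reindex_op_commute[of _ p231]) (simp_all add: split_paired_all tens3_nth ac_simps)
  ultimately show ?thesis using assms by (elim insertE emptyE) (simp_all only:)
qed

lemma upmat_change_basis:
  assumes "vec3 u = tens3 Q *v vec3 u'"
  shows "upmat u = kron Q Q ** upmat u' ** transpose Q"
proof -
  have "u a b c = (kron Q Q ** upmat u' ** transpose Q) $ (a, b) $ c" for a b c
  proof -
    have "u a b c = vec3 u $ (a, b, c)" by simp
    also have "\<dots> = (\<Sum>x\<in>UNIV. \<Sum>y\<in>UNIV. \<Sum>z\<in>UNIV. Q $ a $ x * (Q $ b $ y * Q $ c $ z) * u' x y z)"
      unfolding assms by (simp add: matrix_vector_mult_def sum_UNIV_pair tens3_nth)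
    also have "\<dots> = (\<Sum>x\<in>UNIV. \<Sum>z\<in>UNIV. \<Sum>y\<in>UNIV. Q $ a $ x * (Q $ b $ y * Q $ c $ z) * u' x y z)"
      by (intro sum.cong refl sum.swap)
    also have "\<dots> = (\<Sum>z\<in>UNIV. \<Sum>x\<in>UNIV. \<Sum>y\<in>UNIV. Q $ a $ x * (Q $ b $ y * Q $ c $ z) * u' x y z)"
      by (rule sum.swap)
    also have "\<dots> = (kron Q Q ** upmat u' ** transpose Q) $ (a, b) $ c"
      by (simp add: matrix_matrix_mult_def sum_UNIV_pair kron_def upmat_def transpose_def
          sum_distrib_right sum_distrib_left ac_simps)
    finally show ?thesis .
  qed
  then show ?thesis by (simp add: vec_eq_iff upmat_def)
qed

lemma lowmat_change_basis:
  assumes "vec3 d' = vec3 d v* tens3 Q"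
  shows "lowmat d' = transpose Q ** lowmat d ** kron Q Q"
proof -
  have "d' a b c = (transpose Q ** lowmat d ** kron Q Q) $ a $ (b, c)" for a b c
  proof -
    have "d' a b c = vec3 d' $ (a, b, c)" by simp
    also have "\<dots> = (\<Sum>x\<in>UNIV. \<Sum>y\<in>UNIV. \<Sum>z\<in>UNIV. Q $ x $ a * (Q $ y $ b * Q $ z $ c) * d x y z)"
      unfolding assms by (simp add: vector_matrix_mult_def sum_UNIV_pair tens3_nth ac_simps)
    also have "\<dots> = (\<Sum>y\<in>UNIV. \<Sum>x\<in>UNIV. \<Sum>z\<in>UNIV. Q $ x $ a * (Q $ y $ b * Q $ z $ c) * d x y z)"
      by (rule sum.swap)
    also have "\<dots> = (\<Sum>y\<in>UNIV. \<Sum>z\<in>UNIV. \<Sum>x\<in>UNIV. Q $ x $ a * (Q $ y $ b * Q $ z $ c) * d x y z)"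
      by (intro sum.cong refl sum.swap)
    also have "\<dots> = (transpose Q ** lowmat d ** kron Q Q) $ a $ (b, c)"
      by (simp add: matrix_matrix_mult_def sum_UNIV_pair kron_def lowmat_def transpose_def
          sum_distrib_right sum_distrib_left ac_simps)
    finally show ?thesis .
  qed
  then show ?thesis by (simp add: vec_eq_iff lowmat_def)
qed

text \<open>The factor \<open>transpose Q\<close> produced by pulling back \<open>d\<close> is the
  one needed to turn \<open>upmat u'\<close> into \<open>upmat u\<close>; thus
  \<open>kron Q Q\<close> passes through the contraction.\<close>

lemma tens3_S_op:
  fixes Q :: "complex^'n::finite^'n" and u d u' d' :: "'n \<Rightarrow> 'n \<Rightarrow> 'n \<Rightarrow> complex"
  assumes u: "vec3 u = tens3 Q *v vec3 u'" and d: "vec3 d' = vec3 d v* tens3 Q"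
    and ij: "i \<in> {1, 2, 3}" "j \<in> {1, 2, 3}"
  shows "tens3 Q ** S_op u' d' i j = S_op u d i j ** tens3 Q"
proof -
  obtain f g where fg: "f \<in> {p123, p213, p312}" "g \<in> {p123, p213, p231}"
    and *: "\<And>u d :: 'n \<Rightarrow> _. S_op u d i j = reindex_op f ** kron (mat 1) (upmat u ** lowmat d) ** reindex_op g"
    using S_op_factor[OF ij] by metis
  have comm: "tens3 Q ** reindex_op f = reindex_op f ** tens3 Q"
       "tens3 Q ** reindex_op g = reindex_op g ** tens3 Q"
    using fg by (auto intro: tens3_reindex_op)
  have "kron Q Q ** (upmat u' ** lowmat d') = (upmat u ** lowmat d) ** kron Q Q"
    unfolding upmat_change_basis[OF u] lowmat_change_basis[OF d] by (simp add: matrix_mul_assoc)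
  then have k: "tens3 Q ** kron (mat 1) (upmat u' ** lowmat d') = kron (mat 1) (upmat u ** lowmat d) ** tens3 Q"
    by (simp add: tens3_def kron_mult)
  have "tens3 Q ** S_op u' d' i j = reindex_op f ** (tens3 Q ** kron (mat 1) (upmat u' ** lowmat d')) ** reindex_op g"
    unfolding * by (simp add: matrix_mul_assoc comm)
  also have "\<dots> = reindex_op f ** kron (mat 1) (upmat u ** lowmat d) ** (tens3 Q ** reindex_op g)"
    unfolding k by (simp add: matrix_mul_assoc)
  also have "\<dots> = S_op u d i j ** tens3 Q"
    unfolding * comm by (simp add: matrix_mul_assoc)
  finally show ?thesis .
qed

lemma tens3_T_op:
  assumes "vec3 u = tens3 Q *v vec3 u'" and "vec3 d' = vec3 d v* tens3 Q"
  shows "tens3 Q ** T_op u' d' = T_op u d ** tens3 Q"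
  by (simp add: vec_eq_iff mult_T_op T_op_mult assms)

section \<open>Schur--Weyl duality for the third tensor power\<close>

definition unit_mat :: "'n \<Rightarrow> 'n \<Rightarrow> complex^'n::finite^'n" where
  "unit_mat x y = (\<chi> a b. if a = x \<and> b = y then 1 else 0)"

lemma act3_scale: "act3 (cmat_scale c A) = cmat_scale c (act3 A)"
  by (auto simp: vec_eq_iff act3_nth cmat_scale_def algebra_simps)

lemma act3_add: "act3 (A + B) = act3 A + act3 B"
  by (auto simp: vec_eq_iff act3_nth)

text \<open>The algebra su(n) is only a real vector space. Since the condition is complex linear in
  \<open>A\<close>, commuting with su(n) implies commuting with its complex span, which contains the
  off-diagonal matrix units.\<close>

lemma commutant_subspace: "cmat.subspace {A. X ** act3 A = act3 A ** X}"
proof -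
  have "(A + B) ** X = A ** X + B ** X" for A B :: "'a op3"
    by (simp add: matrix_matrix_mult_def vec_eq_iff distrib_right sum.distrib)
  moreover have "cmat_scale c A ** X = cmat_scale c (A ** X)" "X ** cmat_scale c A = cmat_scale c (X ** A)"
    for c and A :: "'a op3"
    by (simp_all add: cmat_scale_def matrix_matrix_mult_def vec_eq_iff sum_distrib_left ac_simps)
  moreover have "act3 0 = (0 :: 'a op3)"
    by (auto simp: vec_eq_iff act3_nth)
  ultimately show ?thesis
    by (simp add: cmat.subspace_def act3_add act3_scale matrix_add_ldistrib)
qed

lemma special_unitary_algebraI:
  assumes "\<And>i j. A $ j $ i = - cnj (A $ i $ j)" "\<And>i. A $ i $ i = t i" "sum t UNIV = 0"
  shows "A \<in> special_unitary_algebra"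
  unfolding special_unitary_algebra_def mem_Collect_eq trace_def assms(2)
  by (intro conjI allI assms(1,3))

lemma unit_mat_special_unitary:
  assumes "x \<noteq> y"
  shows "unit_mat x y - unit_mat y x \<in> special_unitary_algebra"
  by (rule special_unitary_algebraI[where t = "\<lambda>_. 0"]) (use assms in \<open>auto simp: unit_mat_def\<close>)

lemma unit_mat_special_unitary_add:
  assumes "x \<noteq> y"
  shows "cmat_scale \<i> (unit_mat x y + unit_mat y x) \<in> special_unitary_algebra"
  by (rule special_unitary_algebraI[where t = "\<lambda>_. 0"])
    (use assms in \<open>auto simp: unit_mat_def cmat_scale_def\<close>)

lemma unit_mat_special_unitary_diag:
  "cmat_scale \<i> (unit_mat x x - unit_mat y y) \<in> special_unitary_algebra"
  by (rule special_unitary_algebraI[where t = "\<lambda>i. (if i = x then \<i> else 0) + (if i = y then - \<i> else 0)"])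
    (auto simp: unit_mat_def cmat_scale_def sum.distrib)

lemma End3_special_unitary_unit_mat:
  assumes X: "X \<in> End3 special_unitary_algebra" and "x \<noteq> y"
  shows "X ** act3 (unit_mat x y) = act3 (unit_mat x y) ** X"
    and "X ** act3 (unit_mat x x - unit_mat y y) = act3 (unit_mat x x - unit_mat y y) ** X"
proof -
  let ?C = "{A. X ** act3 A = act3 A ** X}"
  note sub = commutant_subspace[of X]
  have su: "A \<in> ?C" if "A \<in> special_unitary_algebra" for A
    using X that by (simp add: End3_def)
  note 1 = su[OF unit_mat_special_unitary[OF \<open>x \<noteq> y\<close>]] su[OF unit_mat_special_unitary_add[OF \<open>x \<noteq> y\<close>]]
    su[OF unit_mat_special_unitary_diag[of x y]]
  \<comment> \<open>With the anti-Hermitian matrices a = E_xy - E_yx and b = i (E_xy + E_yx), one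
    has E_xy = (a - i b) / 2.\<close>
  have "cmat_scale (1/2) ((unit_mat x y - unit_mat y x) + cmat_scale (- \<i>) (cmat_scale \<i> (unit_mat x y + unit_mat y x))) \<in> ?C"
    by (intro cmat.subspace_scale cmat.subspace_add sub 1)
  also have "cmat_scale (1/2) ((unit_mat x y - unit_mat y x) + cmat_scale (- \<i>) (cmat_scale \<i> (unit_mat x y + unit_mat y x))) = unit_mat x y"
    by (simp add: vec_eq_iff cmat_scale_def unit_mat_def)
  finally show "X ** act3 (unit_mat x y) = act3 (unit_mat x y) ** X" by simp
  have "cmat_scale (- \<i>) (cmat_scale \<i> (unit_mat x x - unit_mat y y)) \<in> ?C"
    by (intro cmat.subspace_scale sub 1)
  also have "cmat_scale (- \<i>) (cmat_scale \<i> (unit_mat x x - unit_mat y y)) = unit_mat x x - unit_mat y y"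
    by (simp add: vec_eq_iff cmat_scale_def)
  finally show "X ** act3 (unit_mat x x - unit_mat y y) = act3 (unit_mat x x - unit_mat y y) ** X" by simp
qed

lemma act3_diagonal:
  fixes D :: "complex^'n::finite^'n"
  assumes "\<And>a b. D $ a $ b = (if a = b then h a else 0)"
  shows "(act3 D ** X) $ (a, b, c) $ p = (h a + h b + h c) * X $ (a, b, c) $ p"
    and "(X ** act3 D) $ p $ (a, b, c) = (h a + h b + h c) * X $ p $ (a, b, c)"
  by (simp_all add: act3_mult_left act3_mult_right assms sum.distrib distrib_right
      if_distrib[of "\<lambda>x. x * _"] cong: if_cong)

text \<open>An operator in the commutant preserves the number of occurrences of each basis vector.\<close>

lemma End3_special_unitary_weight:
  fixes X :: "'n::finite op3"
  assumes X: "X \<in> End3 special_unitary_algebra"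
    and q: "distinct [q1, q2, q3, q4]" and nz: "X $ (a, b, c) $ (q1, q2, q3) \<noteq> 0"
  shows "(a, b, c) \<in> {(q1, q2, q3), (q2, q1, q3), (q1, q3, q2), (q3, q2, q1), (q2, q3, q1), (q3, q1, q2)}"
proof -
  define n :: "'n \<Rightarrow> 'n \<Rightarrow> int" where "n x y = (if y = x then 1 else 0)" for x y
  have eq: "n x a + n x b + n x c - (n y a + n y b + n y c)
      = n x q1 + n x q2 + n x q3 - (n y q1 + n y q2 + n y q3)" if "x \<noteq> y" for x y
  proof -
    have D: "(unit_mat x x - unit_mat y y) $ u $ v = (if u = v then of_int (n x u - n y u) else 0)" for u v
      by (auto simp: unit_mat_def n_def)
    have "(X ** act3 (unit_mat x x - unit_mat y y)) $ (a, b, c) $ (q1, q2, q3)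
        = (act3 (unit_mat x x - unit_mat y y) ** X) $ (a, b, c) $ (q1, q2, q3)"
      using End3_special_unitary_unit_mat(2)[OF X that] by simp
    then have "of_int (n x q1 - n y q1 + (n x q2 - n y q2) + (n x q3 - n y q3)) * X $ (a, b, c) $ (q1, q2, q3)
        = of_int (n x a - n y a + (n x b - n y b) + (n x c - n y c)) * X $ (a, b, c) $ (q1, q2, q3)"
      by (simp only: act3_diagonal[of _ "\<lambda>u. of_int (n x u - n y u)", OF D] of_int_add)
    then have "(of_int (n x q1 - n y q1 + (n x q2 - n y q2) + (n x q3 - n y q3)) :: complex)
        = of_int (n x a - n y a + (n x b - n y b) + (n x c - n y c))"
      by (rule mult_right_cancel[OF nz, THEN iffD1])
    then show ?thesis by (simp only: of_int_eq_iff)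
  qed
  have nonneg: "n x y \<ge> 0" for x y by (simp add: n_def)
  \<comment> \<open>Only traceless diagonal matrices are available, so only differences of counts
    are known. As \<open>q4\<close> does not occur in the input, the count of \<open>q\<close> in
    the output exceeds that of \<open>q4\<close> by one and is positive.\<close>
  have "q \<in> {a, b, c}" if "q \<in> {q1, q2, q3}" for q
  proof -
    have "n q q1 + n q q2 + n q q3 = 1" "n q4 q1 + n q4 q2 + n q4 q3 = 0" "q \<noteq> q4"
      using q that by (auto simp: n_def)
    then have "n q a + n q b + n q c > 0"
      using eq[of q q4] nonneg[of q4 a] nonneg[of q4 b] nonneg[of q4 c] by linarith
    then show ?thesis by (auto simp: n_def split: if_splits)
  qed
  from this[of q1] this[of q2] this[of q3] show ?thesis using q by auto
qed

text \<open>The slots are changed one at a time. A matrix unit replaces the entry of one slot by an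
  arbitrary index; its action on the other slots gives only vectors already known to be killed,
  because the entries of the input are distinct.\<close>

lemma End3_special_unitary_column:
  fixes Y :: "'n::finite op3"
  assumes Y: "Y \<in> End3 special_unitary_algebra"
    and q: "distinct [q1, q2, q3]" and zero: "\<And>p. Y $ p $ (q1, q2, q3) = 0"
  shows "Y = 0"
proof -
  have rule: "(if a = y then Y $ p $ (x, b, c) else 0) + (if b = y then Y $ p $ (a, x, c) else 0)
      + (if c = y then Y $ p $ (a, b, x) else 0) = 0"
    if "\<And>p. Y $ p $ (a, b, c) = 0" "x \<noteq> y" for a b c x y p
  proof -
    obtain p1 p2 p3 where p: "p = (p1, p2, p3)" by (cases p)
    have "(Y ** act3 (unit_mat x y)) $ p $ (a, b, c) = (act3 (unit_mat x y) ** Y) $ p $ (a, b, c)"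
      using End3_special_unitary_unit_mat(1)[OF Y that(2)] by simp
    also have "\<dots> = 0"
      unfolding p by (simp add: act3_mult_left that(1))
    also have "(Y ** act3 (unit_mat x y)) $ p $ (a, b, c) =
      (\<Sum>e\<in>UNIV. if e = x then (if a = y then Y $ p $ (e, b, c) else 0) + (if b = y then Y $ p $ (a, e, c) else 0)
        + (if c = y then Y $ p $ (a, b, e) else 0) else 0)"
      unfolding act3_mult_right unit_mat_def by (intro sum.cong) auto
    finally show ?thesis by simp
  qed
  have 1: "Y $ p $ (x, q2, q3) = 0" for p x
    using rule[of q1 q2 q3 x q1 p] zero q by (cases "x = q1") auto
  have 2: "Y $ p $ (x, z, q3) = 0" for p x z
    using rule[of x q2 q3 z q2 p] 1 q by (cases "z = q2") (auto split: if_splits)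
  have 3: "Y $ p $ (x, z, w) = 0" for p x z w
    using rule[of x z q3 w q3 p] 2 q by (cases "w = q3") (auto split: if_splits)
  show ?thesis by (simp add: vec_eq_iff 3)
qed

theorem schur_weyl_3:
  assumes "CARD('n::finite) \<ge> 4"
  shows "End3 (special_unitary_algebra :: (complex^'n^'n) set) = cmat.span order_zero"
proof
  have sub: "cmat.subspace (End3 (special_unitary_algebra :: (complex^'n^'n) set))"
    using operator_algebra_End3 by (auto simp: operator_algebra_def)
  show "cmat.span order_zero \<subseteq> End3 (special_unitary_algebra :: (complex^'n^'n) set)"
    by (intro cmat.span_minimal order_zero_subset_End3 sub)
  obtain S :: "'n set" where S: "card S = 4" "finite S"
    using obtain_subset_with_card_n[OF assms] by blast
  then obtain qs where "set qs = S" "distinct qs"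
    using finite_distinct_list by blast
  moreover from this have "length qs = 4"
    using S distinct_card by fastforce
  ultimately obtain q1 q2 q3 q4 :: 'n where q: "distinct [q1, q2, q3, q4]"
    by (auto simp: length_Suc_conv numeral_eq_Suc)
  show "End3 (special_unitary_algebra :: (complex^'n^'n) set) \<subseteq> cmat.span order_zero"
  proof
    fix X :: "'n op3" assume X: "X \<in> End3 special_unitary_algebra"
    let ?x = "\<lambda>p. X $ p $ (q1, q2, q3)"
    \<comment> \<open>\<open>reindex_op f\<close> sends the basis vector of a triple q to that of
      the preimage of q under f; this is why the coefficients of the two 3-cycles appear
      crosswise.\<close>
    define Z :: "'n op3" where "Z = cmat_scale (?x (q1, q2, q3)) (reindex_op p123)
      + cmat_scale (?x (q2, q1, q3)) (reindex_op p213) + cmat_scale (?x (q1, q3, q2)) (reindex_op p132)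
      + cmat_scale (?x (q3, q2, q1)) (reindex_op p321) + cmat_scale (?x (q2, q3, q1)) (reindex_op p312)
      + cmat_scale (?x (q3, q1, q2)) (reindex_op p231)"
    have Z: "Z \<in> cmat.span order_zero"
      unfolding Z_def order_zero_eq
      by (intro cmat.span_add cmat.span_scale cmat.span_base imageI) (simp_all only: insert_iff simp_thms)
    then have "Z \<in> End3 special_unitary_algebra"
      using cmat.span_minimal[OF order_zero_subset_End3 sub] by blast
    then have XZ: "X - Z \<in> End3 special_unitary_algebra"
      by (rule cmat.subspace_diff[OF sub X])
    have Zq: "Z $ (a, b, c) $ (q1, q2, q3) = (if (a, b, c) = (q1, q2, q3) then ?x (q1, q2, q3) else 0)
      + (if (a, b, c) = (q2, q1, q3) then ?x (q2, q1, q3) else 0)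
      + (if (a, b, c) = (q1, q3, q2) then ?x (q1, q3, q2) else 0)
      + (if (a, b, c) = (q3, q2, q1) then ?x (q3, q2, q1) else 0)
      + (if (a, b, c) = (q2, q3, q1) then ?x (q2, q3, q1) else 0)
      + (if (a, b, c) = (q3, q1, q2) then ?x (q3, q1, q2) else 0)" for a b c
    proof -
      have tuple: "((q1, q2, q3) = (a, b, c)) = ((a, b, c) = (q1, q2, q3))"
        "((q1, q2, q3) = (b, a, c)) = ((a, b, c) = (q2, q1, q3))"
        "((q1, q2, q3) = (a, c, b)) = ((a, b, c) = (q1, q3, q2))"
        "((q1, q2, q3) = (c, b, a)) = ((a, b, c) = (q3, q2, q1))"
        "((q1, q2, q3) = (c, a, b)) = ((a, b, c) = (q2, q3, q1))"
        "((q1, q2, q3) = (b, c, a)) = ((a, b, c) = (q3, q1, q2))"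
        by (simp_all only: prod.inject) blast+
      show ?thesis
        by (simp only: Z_def cmat_scale_def reindex_op_def vector_add_component vec_lambda_beta prod.case
            tuple if_distrib[of "\<lambda>x. _ * x"] mult_1_right mult_zero_right)
    qed
    have ne: "q1 \<noteq> q2" "q1 \<noteq> q3" "q2 \<noteq> q3" "q2 \<noteq> q1" "q3 \<noteq> q1" "q3 \<noteq> q2"
      using q by auto
    have "(X - Z) $ (a, b, c) $ (q1, q2, q3) = 0" for a b c
    proof (cases "(a, b, c) \<in> {(q1, q2, q3), (q2, q1, q3), (q1, q3, q2), (q3, q2, q1), (q2, q3, q1), (q3, q1, q2)}")
      case True
      then show ?thesis
        by (elim insertE emptyE)
          (simp_all only: vector_minus_component Zq prod.inject ne simp_thms if_True if_False add_0_left add_0_right diff_self)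
    next
      case False
      then have "?x (a, b, c) = 0" using End3_special_unitary_weight[OF X q] by blast
      moreover have "Z $ (a, b, c) $ (q1, q2, q3) = 0"
        using False unfolding Zq insert_iff de_Morgan_disj by (simp only: if_False add_0_left)
      ultimately show ?thesis by simp
    qed
    then have "(X - Z) $ p $ (q1, q2, q3) = 0" for p
      by (cases p) blast
    moreover have "distinct [q1, q2, q3]"
      using q by simp
    ultimately have "X - Z = 0"
      using End3_special_unitary_column[OF XZ] by blast
    then show "X \<in> cmat.span order_zero" using Z by simp
  qed
qed

section \<open>Linear algebra\<close>

text \<open>Gaussian elimination: the pivot \<open>a j k\<close> removes the unknown
  \<open>j\<close> from the other equations, and equation \<open>k\<close> determines its value
  afterwards.\<close>

lemma homogeneous_system_solution:
  fixes a :: "'i \<Rightarrow> 'k \<Rightarrow> 'f::field"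
  assumes "finite K" "finite I" "card K < card I"
  shows "\<exists>c. (\<exists>i\<in>I. c i \<noteq> 0) \<and> (\<forall>k\<in>K. (\<Sum>i\<in>I. c i * a i k) = 0)"
  using assms
proof (induction K arbitrary: I a rule: finite_induct)
  case empty
  then obtain i where "i \<in> I" by fastforce
  then show ?case by (intro exI[of _ "\<lambda>_. 1"]) auto
next
  case (insert k K)
  show ?case
  proof (cases "\<forall>i\<in>I. a i k = 0")
    case True
    obtain c where "\<exists>i\<in>I. c i \<noteq> 0" "\<forall>k\<in>K. (\<Sum>i\<in>I. c i * a i k) = 0"
      using insert.IH[of I a] insert.prems insert.hyps by auto
    then show ?thesis using True by (intro exI[of _ c]) simp
  next
    case False
    then obtain j where j: "j \<in> I" "a j k \<noteq> 0" by blast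
    define r where "r i = a i k / a j k" for i
    have "card K < card (I - {j})"
      using insert.prems insert.hyps j by simp
    then obtain c where c: "\<exists>i\<in>I - {j}. c i \<noteq> 0"
      and 0: "\<forall>l\<in>K. (\<Sum>i\<in>I - {j}. c i * (a i l - r i * a j l)) = 0"
      using insert.IH[of "I - {j}" "\<lambda>i l. a i l - r i * a j l"] insert.prems by auto
    define c' where "c' i = (if i = j then - (\<Sum>i\<in>I - {j}. c i * r i) else c i)" for i
    have sum: "(\<Sum>i\<in>I. c' i * a i l) = (\<Sum>i\<in>I - {j}. c i * (a i l - r i * a j l))" for l
    proof -
      have "(\<Sum>i\<in>I. c' i * a i l) = c' j * a j l + (\<Sum>i\<in>I - {j}. c' i * a i l)"
        using insert.prems(1) j(1) by (rule sum.remove)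
      also have "(\<Sum>i\<in>I - {j}. c' i * a i l) = (\<Sum>i\<in>I - {j}. c i * a i l)"
        by (intro sum.cong) (auto simp: c'_def)
      also have "c' j * a j l = - (\<Sum>i\<in>I - {j}. c i * r i * a j l)"
        by (simp add: c'_def sum_distrib_right)
      finally show ?thesis
        by (simp add: right_diff_distrib sum_subtractf mult.assoc)
    qed
    have "(\<Sum>i\<in>I. c' i * a i k) = 0"
      unfolding sum using j by (simp add: r_def)
    moreover have "\<exists>i\<in>I. c' i \<noteq> 0"
      using c by (auto simp: c'_def)
    ultimately show ?thesis
      using 0 sum by (intro exI[of _ c']) simp
  qed
qed

text \<open>More vectors than functionals admit a nontrivial combination on which all functionals
  vanish, and separation makes this combination zero. The bound is proved for finite subsets of a
  basis because finiteness of the basis is part of the claim.\<close>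

lemma (in vector_space) basis_of_separating_functionals:
  fixes \<phi> :: "'k \<Rightarrow> 'b \<Rightarrow> 'a"
  assumes S: "subspace S" and K: "finite K"
    and add: "\<And>k x y. \<phi> k (x + y) = \<phi> k x + \<phi> k y" and sc: "\<And>k c x. \<phi> k (c *s x) = c * \<phi> k x"
    and sep: "\<And>x. x \<in> S \<Longrightarrow> (\<And>k. k \<in> K \<Longrightarrow> \<phi> k x = 0) \<Longrightarrow> x = 0"
  shows "\<exists>B. B \<subseteq> S \<and> finite B \<and> independent B \<and> S \<subseteq> span B \<and> card B \<le> card K"
proof -
  obtain B where B: "B \<subseteq> S" "independent B" "S \<subseteq> span B"
    by (rule maximal_independent_subset[of S])
  have "finite B0 \<Longrightarrow> B0 \<subseteq> B \<Longrightarrow> card B0 \<le> card K" for B0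
  proof (rule ccontr)
    assume B0: "finite B0" "B0 \<subseteq> B" "\<not> card B0 \<le> card K"
    then have "card K < card B0" by simp
    from homogeneous_system_solution[OF K B0(1) this, of "\<lambda>b k. \<phi> k b"]
    obtain c where c: "\<exists>b\<in>B0. c b \<noteq> 0" and 0: "\<forall>k\<in>K. (\<Sum>b\<in>B0. c b * \<phi> k b) = 0"
      by blast
    have zero: "\<phi> k 0 = 0" for k using sc[of k 0 0] by simp
    have "\<phi> k (\<Sum>b\<in>B0. c b *s b) = (\<Sum>b\<in>B0. c b * \<phi> k b)" for k
      using B0(1) by induction (simp_all add: zero add sc)
    moreover have "(\<Sum>b\<in>B0. c b *s b) \<in> S"
      using B0 B by (intro subspace_sum[OF S] subspace_scale[OF S]) blast
    ultimately have "(\<Sum>b\<in>B0. c b *s b) = 0"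
      using sep 0 by simp
    then have "dependent B0"
      using c B0(1) unfolding dependent_finite[OF B0(1)] by blast
    then show False using B(2) B0(2) dependent_mono by blast
  qed
  then have "finite B \<and> card B \<le> card K"
    by (metis finite_if_finite_subsets_card_bdd)
  then show ?thesis using B by blast
qed

lemma linear_dependence_relation:
  fixes x :: "'i \<Rightarrow> complex^'n"
  assumes "finite I" "CARD('n) < card I"
  shows "\<exists>c. (\<exists>i\<in>I. c i \<noteq> 0) \<and> (\<Sum>i\<in>I. c i *s x i) = 0"
  using homogeneous_system_solution[of "UNIV :: 'n set" I "\<lambda>i k. x i $ k"] assms
  by (simp add: vec_eq_iff)

text \<open>Here \<open>ap p\<close> is p(H) v, evaluated by Horner's scheme. For a nonzero p of
  least degree with p(H) v = 0, a root z splits off a linear factor; the cofactor applied to v is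
  nonzero by minimality and is an eigenvector for z.\<close>

lemma eigenvector_in_invariant_subspace:
  fixes H :: "complex^'n^'n"
  assumes U: "vec.subspace U" and inv: "\<And>v. v \<in> U \<Longrightarrow> H *v v \<in> U" and v: "v \<in> U" "v \<noteq> 0"
  shows "\<exists>z w. w \<in> U \<and> w \<noteq> 0 \<and> H *v w = z *s w"
proof -
  define ap where "ap p = fold_coeffs (\<lambda>a w. a *s v + H *v w) p 0" for p
  have ap_pCons [simp]: "ap 0 = 0" "ap (pCons a p) = a *s v + H *v ap p" for a p
    by (cases "p = 0 \<and> a = 0"; auto simp: ap_def)+
  have ap_add [simp]: "ap (p + q) = ap p + ap q" for p q
    by (induction p q rule: poly_induct2) (simp_all add: algebra_simps vec.add)
  have ap_smult [simp]: "ap (smult c p) = c *s ap p" for c p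
    by (induction p) (simp_all add: vec.scale vector_add_ldistrib vector_smult_assoc)
  have "ap (\<Sum>i\<in>I. q i) = (\<Sum>i\<in>I. ap (q i))" if "finite I" for I and q :: "nat \<Rightarrow> complex poly"
    using that by induction simp_all
  moreover have apU: "ap p \<in> U" for p
    by (induction p) (auto intro!: vec.subspace_add vec.subspace_scale U v inv vec.subspace_0)
  moreover obtain c where c: "\<exists>i\<in>{..CARD('n)}. c i \<noteq> 0"
    "(\<Sum>i\<in>{..CARD('n)}. c i *s ap (monom 1 i)) = 0"
    using linear_dependence_relation[of "{..CARD('n)}" "\<lambda>i. ap (monom 1 i)"] by auto
  moreover define p where "p = (\<Sum>i\<in>{..CARD('n)}. smult (c i) (monom 1 i))"
  ultimately have "ap p = 0" by simp
  moreover have "p \<noteq> 0"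
  proof
    assume "p = 0"
    then have "coeff p i = 0" for i by simp
    then have *: "(\<Sum>j\<in>{..CARD('n)}. if j = i then c j else 0) = 0" for i
      by (simp add: p_def coeff_sum if_distrib[of "\<lambda>x. _ * x"] cong: if_cong)
    from c(1) obtain i where "i \<in> {..CARD('n)}" "c i \<noteq> 0" by blast
    then show False using *[of i] by (simp add: sum.delta)
  qed
  ultimately have "\<exists>p. p \<noteq> 0 \<and> ap p = 0" by blast
  then obtain p where p: "p \<noteq> 0" "ap p = 0" and min: "\<And>q. q \<noteq> 0 \<Longrightarrow> ap q = 0 \<Longrightarrow> degree p \<le> degree q"
    using arg_min_natI[of "\<lambda>p. p \<noteq> 0 \<and> ap p = 0" _ degree]
      arg_min_nat_le[of "\<lambda>p. p \<noteq> 0 \<and> ap p = 0" _ degree] by (metis (mono_tags, lifting))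
  have "\<not> constant (poly p)"
  proof
    assume "constant (poly p)"
    then have "degree p = 0" by (simp add: constant_degree)
    then obtain a where "p = [:a:]" by (rule degree_eq_zeroE)
    then show False using p v by simp
  qed
  then obtain z where "poly p z = 0"
    using fundamental_theorem_of_algebra by blast
  then obtain q where q: "p = [:- z, 1:] * q"
    by (auto simp: poly_eq_0_iff_dvd)
  have "q \<noteq> 0" using p(1) q by auto
  moreover have "degree q < degree p"
    unfolding q using \<open>q \<noteq> 0\<close> by (subst degree_mult_eq) auto
  ultimately have "ap q \<noteq> 0" using min[of q] by auto
  moreover have "H *v ap q = z *s ap q"
  proof -
    have "p = smult (- z) q + pCons 0 q" using q by simp
    then have "0 = (- z) *s ap q + (0 *s v + H *v ap q)"
      using p(2) by (simp only: ap_add ap_smult ap_pCons)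
    then show ?thesis by (simp add: vec_eq_iff)
  qed
  ultimately show ?thesis using apU by blast
qed

text \<open>The eigenspace of one matrix inside U is invariant under the others because they
  commute, so the induction continues inside it.\<close>

lemma common_eigenvector:
  fixes H :: "'i \<Rightarrow> complex^'n^'n"
  assumes "finite I" and "\<And>i j w. i \<in> I \<Longrightarrow> j \<in> I \<Longrightarrow> H i *v (H j *v w) = H j *v (H i *v w)"
    and "vec.subspace U" and "\<And>i v. i \<in> I \<Longrightarrow> v \<in> U \<Longrightarrow> H i *v v \<in> U" and "v \<in> U" "v \<noteq> 0"
  shows "\<exists>w \<mu>. w \<in> U \<and> w \<noteq> 0 \<and> (\<forall>i\<in>I. H i *v w = \<mu> i *s w)"
  using assms
proof (induction I arbitrary: U v rule: finite_induct)
  case empty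
  then show ?case by auto
next
  case (insert i I)
  obtain z w where zw: "w \<in> U" "w \<noteq> 0" "H i *v w = z *s w"
    using eigenvector_in_invariant_subspace[of U "H i" v] insert.prems by auto
  define U' where "U' = {v \<in> U. H i *v v = z *s v}"
  have "vec.subspace U'"
    using insert.prems(2) unfolding vec.subspace_def U'_def
    by (auto simp: vec.add vec.scale vector_add_ldistrib vector_smult_assoc mult.commute)
  moreover have "H j *v u \<in> U'" if "j \<in> I" "u \<in> U'" for j u
    using that insert.prems(1)[of i j u] insert.prems(3)[of j u] by (auto simp: U'_def vec.scale)
  moreover have "w \<in> U'" using zw by (simp add: U'_def)
  ultimately obtain w' \<mu> where w': "w' \<in> U'" "w' \<noteq> 0" "\<forall>j\<in>I. H j *v w' = \<mu> j *s w'"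
    using insert.IH[of U' w] insert.prems(1) zw(2) by blast
  then show ?case
    using insert.hyps by (intro exI[of _ w'] exI[of _ "\<mu>(i := z)"]) (auto simp: U'_def)
qed

text \<open>Applying \<open>H i\<close> minus the eigenvalue of term k removes that term from a
  relation and multiplies term l by a difference of eigenvalues, nonzero for a suitable i depending
  on l.\<close>

lemma joint_eigenvectors_independent:
  fixes H :: "'i \<Rightarrow> complex^'n^'n" and x :: "'k \<Rightarrow> complex^'n"
  assumes "finite K" and "\<And>k. k \<in> K \<Longrightarrow> x k \<noteq> 0"
    and "\<And>k i. k \<in> K \<Longrightarrow> i \<in> I \<Longrightarrow> H i *v x k = \<mu> k i *s x k"
    and "\<And>k l. k \<in> K \<Longrightarrow> l \<in> K \<Longrightarrow> k \<noteq> l \<Longrightarrow> \<exists>i\<in>I. \<mu> k i \<noteq> \<mu> l i"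
    and "(\<Sum>k\<in>K. c k *s x k) = 0"
  shows "\<forall>k\<in>K. c k = 0"
  using assms
proof (induction K arbitrary: c rule: finite_induct)
  case empty
  then show ?case by simp
next
  case (insert k K)
  have cK: "c l = 0" if l: "l \<in> K" for l
  proof -
    obtain i where i: "i \<in> I" "\<mu> l i \<noteq> \<mu> k i"
      using insert.prems(3)[of l k] insert.hyps l by blast
    have "0 = H i *v (\<Sum>l\<in>insert k K. c l *s x l) - \<mu> k i *s (\<Sum>l\<in>insert k K. c l *s x l)"
      unfolding insert.prems(4) by simp
    also have "\<dots> = (\<Sum>l\<in>insert k K. c l *s (H i *v x l) - \<mu> k i *s (c l *s x l))"
      by (simp only: vec.sum vec.scale vec.scale_sum_right sum_subtractf)
    also have "\<dots> = (\<Sum>l\<in>insert k K. (c l * (\<mu> l i - \<mu> k i)) *s x l)"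
      using insert.prems(2)[OF _ i(1)] by (intro sum.cong refl)
        (simp add: vector_smult_assoc algebra_simps vec.scale_left_diff_distrib)
    also have "\<dots> = (\<Sum>l\<in>K. (c l * (\<mu> l i - \<mu> k i)) *s x l)"
      using insert.hyps by simp
    finally have "\<forall>l\<in>K. c l * (\<mu> l i - \<mu> k i) = 0"
      using insert.prems by (intro insert.IH) auto
    then show ?thesis using l i by auto
  qed
  then have "c k *s x k = 0"
    using insert.prems(4) insert.hyps by simp
  then have "c k = 0" using insert.prems(1)[of k] by simp
  then show ?case using cK by simp
qed

lemma card_joint_eigenvectors:
  fixes H :: "'i \<Rightarrow> complex^'n^'n" and x :: "'k \<Rightarrow> complex^'n"
  assumes "finite K" and "\<And>k. k \<in> K \<Longrightarrow> x k \<noteq> 0"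
    and "\<And>k i. k \<in> K \<Longrightarrow> i \<in> I \<Longrightarrow> H i *v x k = \<mu> k i *s x k"
    and "\<And>k l. k \<in> K \<Longrightarrow> l \<in> K \<Longrightarrow> k \<noteq> l \<Longrightarrow> \<exists>i\<in>I. \<mu> k i \<noteq> \<mu> l i"
  shows "card K \<le> CARD('n)"
proof (rule ccontr)
  assume "\<not> card K \<le> CARD('n)"
  then obtain c where c: "\<exists>i\<in>K. c i \<noteq> 0" "(\<Sum>i\<in>K. c i *s x i) = 0"
    using linear_dependence_relation[OF assms(1), of x] by auto
  have "\<forall>k\<in>K. c k = 0"
    by (rule joint_eigenvectors_independent[of K x I H \<mu> c]) (fact assms c)+
  then show False using c(1) by blast
qed

text \<open>From E F^(k+1) v = (k+1) (m-k) F^k v it follows that all F^k v are nonzero unless m is a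
  natural number. Their H-eigenvalues m - 2k are pairwise distinct, which is impossible in finite
  dimension.\<close>

lemma sl2_highest_weight:
  fixes E F H :: "complex^'n^'n"
  assumes EF: "\<And>w. E *v (F *v w) = F *v (E *v w) + H *v w"
    and HF: "\<And>w. H *v (F *v w) = F *v (H *v w) - 2 *s (F *v w)"
    and v: "v \<noteq> 0" "E *v v = 0" "H *v v = m *s v"
  shows "\<exists>k. m = of_nat k"
proof (rule ccontr)
  assume m: "\<nexists>k. m = of_nat k"
  define x where "x k = (((*v) F) ^^ k) v" for k
  have H: "H *v x k = (m - 2 * of_nat k) *s x k" for k
  proof (induction k)
    case 0
    then show ?case by (simp add: x_def v)
  next
    case (Suc k)
    have "H *v x (Suc k) = F *v (H *v x k) - 2 *s x (Suc k)"
      by (simp add: x_def HF)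
    also have "F *v (H *v x k) = (m - 2 * of_nat k) *s x (Suc k)"
      unfolding Suc vec.scale by (simp add: x_def)
    finally show ?case
      by (simp only: vec.scale_left_diff_distrib[symmetric]) (simp add: algebra_simps)
  qed
  have E: "E *v x (Suc k) = (of_nat (Suc k) * (m - of_nat k)) *s x k" for k
  proof (induction k)
    case 0
    then show ?case by (simp add: x_def EF v)
  next
    case (Suc k)
    have "E *v x (Suc (Suc k)) = F *v (E *v x (Suc k)) + H *v x (Suc k)"
      using EF by (simp add: x_def)
    also have "F *v (E *v x (Suc k)) = (of_nat (Suc k) * (m - of_nat k)) *s x (Suc k)"
      unfolding Suc vec.scale by (simp add: x_def)
    finally show ?case
      unfolding H by (simp only: vec.scale_left_distrib[symmetric]) (simp add: algebra_simps)
  qed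
  have nz: "x k \<noteq> 0" for k
  proof (induction k)
    case (Suc k)
    have "of_nat (Suc k) * (m - of_nat k) \<noteq> 0"
      using m by (auto simp del: of_nat_Suc)
    then have "E *v x (Suc k) \<noteq> 0"
      unfolding E using Suc by (simp del: of_nat_Suc)
    then show ?case by auto
  qed (simp add: x_def v)
  have "card {..CARD('n)} \<le> CARD('n)"
    by (rule card_joint_eigenvectors[of _ x "{()}" "\<lambda>_. H" "\<lambda>k _. m - 2 * of_nat k"]) (auto simp: H nz)
  then show False by simp
qed

section \<open>Weights of the minuscule representation\<close>

text \<open>Weights and roots are written in fundamental weight coordinates, with a dummy entry 0 in front
  so that the labels 1 to 6 are list positions. The nodes 0 to 26 are the weights of the
  representation with highest weight \<open>\<omega>\<^sub>1\<close>. Row \<open>i\<close> of the tables of arrows says which node is reached by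
  subtracting or adding the \<open>i\<close>-th simple root, where 27 means that there is none.\<close>

definition weights27 :: "int list list" where
  "weights27 =
   [[0,1,0,0,0,0,0], [0,-1,0,1,0,0,0], [0,0,0,-1,1,0,0],
   [0,0,1,0,-1,1,0], [0,0,-1,0,0,1,0], [0,0,1,0,0,-1,1],
   [0,0,-1,0,1,-1,1], [0,0,1,0,0,0,-1], [0,0,0,1,-1,0,1],
   [0,0,-1,0,1,0,-1], [0,1,0,-1,0,0,1], [0,0,0,1,-1,1,-1],
   [0,-1,0,0,0,0,1], [0,1,0,-1,0,1,-1], [0,0,0,1,0,-1,0],
   [0,-1,0,0,0,1,-1], [0,1,0,-1,1,-1,0], [0,-1,0,0,1,-1,0],
   [0,1,1,0,-1,0,0], [0,-1,1,1,-1,0,0], [0,1,-1,0,0,0,0],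
   [0,-1,-1,1,0,0,0], [0,0,1,-1,0,0,0], [0,0,-1,-1,1,0,0],
   [0,0,0,0,-1,1,0], [0,0,0,0,0,-1,1], [0,0,0,0,0,0,-1]]"

definition e6_roots :: "int list list" where
  "e6_roots =
   [[0,0,0,0,0,0,0], [0,2,0,-1,0,0,0], [0,0,2,0,-1,0,0],
   [0,-1,0,2,-1,0,0], [0,0,-1,-1,2,-1,0], [0,0,0,0,-1,2,-1],
   [0,0,0,0,0,-1,2]]"

definition lower_table :: "nat list list" where
  "lower_table =
   [[27,27,27,27,27,27,27,27,27,27,27,27,27,27,27,27,27,27,27,27,27,27,27,27,27,27,27],
   [1,27,27,27,27,27,27,27,27,27,12,27,27,15,27,27,17,27,19,27,21,27,27,27,27,27,27],
   [27,27,27,4,27,6,27,9,27,27,27,27,27,27,27,27,27,27,20,21,27,27,23,27,27,27,27],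
   [27,2,27,27,27,27,27,27,10,27,27,13,27,27,16,27,27,27,27,22,27,23,27,27,27,27,27],
   [27,27,3,27,27,27,8,27,27,11,27,27,27,27,27,27,18,19,27,27,27,27,27,24,27,27,27],
   [27,27,27,5,6,27,27,27,27,27,27,14,27,16,27,17,27,27,27,27,27,27,27,27,25,27,27],
   [27,27,27,27,27,7,9,27,11,27,13,27,15,27,27,27,27,27,27,27,27,27,27,27,27,26,27]]"

definition raise_table :: "nat list list" where
  "raise_table =
   [[27,27,27,27,27,27,27,27,27,27,27,27,27,27,27,27,27,27,27,27,27,27,27,27,27,27,27],
   [27,0,27,27,27,27,27,27,27,27,27,27,10,27,27,13,27,16,27,18,27,20,27,27,27,27,27],
   [27,27,27,27,3,27,5,27,27,7,27,27,27,27,27,27,27,27,27,27,18,19,27,22,27,27,27],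
   [27,27,1,27,27,27,27,27,27,27,8,27,27,11,27,27,14,27,27,27,27,27,19,21,27,27,27],
   [27,27,27,2,27,27,27,27,6,27,27,9,27,27,27,27,27,27,16,17,27,27,27,27,23,27,27],
   [27,27,27,27,27,3,4,27,27,27,27,27,27,27,11,27,13,15,27,27,27,27,27,27,27,24,27],
   [27,27,27,27,27,27,27,5,27,6,27,8,27,10,27,12,27,27,27,27,27,27,27,27,27,27,25]]"

abbreviation down :: "nat \<Rightarrow> nat \<Rightarrow> nat" where
  "down i k \<equiv> lower_table ! i ! k"

abbreviation up :: "nat \<Rightarrow> nat \<Rightarrow> nat" where
  "up i k \<equiv> raise_table ! i ! k"

text \<open>One arrow into each node other than 0 is selected, by its label here and its source in
  \<open>parent_node\<close>. These arrows form a spanning tree rooted at the highest weight; the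
  entries for node 0 are dummies.\<close>

definition parent_label :: "nat list" where
  "parent_label = [0, 1, 3, 4, 2, 5, 5, 6, 4, 6, 3, 6, 1, 6, 5, 6, 5, 5, 4, 4, 2, 2, 3, 3, 4, 5, 6]"

definition parent_node :: "nat list" where
  "parent_node = [0, 0, 1, 2, 3, 3, 4, 5, 6, 6, 8, 8, 10, 10, 11, 12, 13, 15, 16, 17, 18, 19, 19, 21, 23, 24, 25]"

text \<open>Only positive coordinates are lowered: there the lowering operator does not kill a
  weight vector, so every listed weight really occurs.\<close>

definition lower_weights :: "int list \<Rightarrow> int list list" where
  "lower_weights w = map (\<lambda>i. map2 (-) w (e6_roots ! i)) (filter (\<lambda>i. w ! i > 0) [1..<7])"

primrec weight_levels :: "nat \<Rightarrow> int list list \<Rightarrow> int list list" where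
  "weight_levels 0 L = L"
| "weight_levels (Suc n) L = L @ weight_levels n (remdups (concat (map lower_weights L)))"

text \<open>Ten subtractions of simple roots suffice for all seven weights below. Duplicates are
  removed within a level only; \<open>distinct\<close> certifies that the levels do not overlap, so
  the length counts weights.\<close>

definition many_weights :: "int list \<Rightarrow> bool" where
  "many_weights w \<longleftrightarrow> (let L = weight_levels 10 [w] in 27 < length L \<and> distinct L)"

text \<open>Every nonzero dominant weight other than \<open>\<omega>\<^sub>1\<close> and \<open>\<omega>\<^sub>6\<close> is the sum of one of the following and a
  dominant weight.\<close>

definition minimal_weights :: "int list list" where
  "minimal_weights =
   [[0,0,1,0,0,0,0], [0,0,0,1,0,0,0], [0,0,0,0,1,0,0], [0,0,0,0,0,1,0],
    [0,2,0,0,0,0,0], [0,0,0,0,0,0,2], [0,1,0,0,0,0,1]]"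

text \<open>The facts on these tables are gathered in one decidable proposition, proved by a single
  evaluation. The clause on \<open>parent_label\<close> says that an arrow into \<open>c\<close>
  outside the spanning tree forms a square with the tree arrow, with opposite corner
  \<open>q\<close> and orthogonal labels; this makes lowering independent of the path.\<close>

definition weight_tables_ok :: bool where
  "weight_tables_ok \<longleftrightarrow>
    list_all (\<lambda>w. length w = 7 \<and> w ! 0 = 0) weights27 \<and> distinct weights27 \<and>
    list_all (\<lambda>r. length r = 7 \<and> r ! 0 = 0) e6_roots \<and>
    list_all (\<lambda>i. list_all (\<lambda>k.
      (let c = down i k; p = up i k in
        (if c = 27 then map2 (-) (weights27 ! k) (e6_roots ! i) \<notin> set weights27
         else c < 27 \<and> up i c = k \<and> weights27 ! k ! i = 1 \<and> p = 27 \<and> k < c \<and>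
           weights27 ! c = map2 (-) (weights27 ! k) (e6_roots ! i) \<and>
           (let j = parent_label ! c; a = parent_node ! c; q = up i a in
             i = j \<and> k = a \<or>
             q < 27 \<and> down j q = k \<and> down i q = a \<and> e6_roots ! j ! i = 0 \<and> i \<noteq> j)) \<and>
        (if p = 27 then map2 (+) (weights27 ! k) (e6_roots ! i) \<notin> set weights27
         else p < 27 \<and> down i p = k))) [0..<27]) [1..<7] \<and>
    list_all (\<lambda>k.
      (let j = parent_label ! k; a = parent_node ! k in
        0 < j \<and> j < 7 \<and> a < k \<and> down j a = k \<and>
        weights27 ! k = map2 (-) (weights27 ! a) (e6_roots ! j))) [1..<27]"

lemma many_weights_minimal: "list_all many_weights minimal_weights"
  by code_simp

lemma weight_tables_ok: weight_tables_ok
  by code_simp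

section \<open>Facts read off from the evaluated tables\<close>

lemma atLeastAtMost_1_6: "{1..6} = {1, 2, 3, 4, 5, 6::nat}"
  by auto

text \<open>Coordinate j of a weight is its value on the j-th simple coroot, so the coordinates of
  the i-th simple root form column i of the Cartan matrix.\<close>

lemma e6_roots_nth:
  assumes "i \<in> {1..6}" "j \<in> {1..6}"
  shows "e6_roots ! i ! j = e6_cartan j i"
  using assms unfolding atLeastAtMost_1_6
  by (elim insertE emptyE; simp add: e6_roots_def e6_cartan_def doubleton_eq_iff)

lemma length_weights27: "length weights27 = 27"
  by (simp add: weights27_def)

lemma distinct_weights27: "distinct weights27"
  using weight_tables_ok unfolding weight_tables_ok_def by blast

lemma weights27_form: "w \<in> set weights27 \<Longrightarrow> length w = 7 \<and> w ! 0 = 0"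
  using weight_tables_ok unfolding weight_tables_ok_def list_all_iff by blast

lemma e6_roots_form:
  assumes "i \<in> {1..6}"
  shows "length (e6_roots ! i) = 7 \<and> e6_roots ! i ! 0 = 0"
proof -
  have "e6_roots ! i \<in> set e6_roots"
    using assms by (intro nth_mem) (simp add: e6_roots_def)
  then show ?thesis
    using weight_tables_ok unfolding weight_tables_ok_def list_all_iff by blast
qed

lemma weight_table_entry:
  assumes "i \<in> {1..6}" "k < 27"
  shows "let c = down i k; p = up i k in
        (if c = 27 then map2 (-) (weights27 ! k) (e6_roots ! i) \<notin> set weights27
         else c < 27 \<and> up i c = k \<and> weights27 ! k ! i = 1 \<and> p = 27 \<and> k < c \<and>
           weights27 ! c = map2 (-) (weights27 ! k) (e6_roots ! i) \<and>
           (let j = parent_label ! c; a = parent_node ! c; q = up i a in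
             i = j \<and> k = a \<or>
             q < 27 \<and> down j q = k \<and> down i q = a \<and> e6_roots ! j ! i = 0 \<and> i \<noteq> j)) \<and>
        (if p = 27 then map2 (+) (weights27 ! k) (e6_roots ! i) \<notin> set weights27
         else p < 27 \<and> down i p = k)"
proof -
  have "i \<in> set [1..<7]" "k \<in> set [0..<27]" using assms by auto
  then show ?thesis
    using weight_tables_ok unfolding weight_tables_ok_def list_all_iff by blast
qed

lemma lower_table_none:
  assumes "i \<in> {1..6}" "k < 27" "down i k = 27"
  shows "map2 (-) (weights27 ! k) (e6_roots ! i) \<notin> set weights27"
  using weight_table_entry[OF assms(1,2)] assms(3) by (simp add: Let_def)

lemma lower_table_some:
  assumes "i \<in> {1..6}" "k < 27" "down i k = c" "c \<noteq> 27"
  shows "c < 27" "up i c = k" "weights27 ! k ! i = 1" "up i k = 27" "k < c"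
    "weights27 ! c = map2 (-) (weights27 ! k) (e6_roots ! i)"
  using weight_table_entry[OF assms(1,2)] assms(3,4) by (auto simp: Let_def)

lemma lower_table_parent:
  assumes "i \<in> {1..6}" "k < 27" "down i k = c" "c \<noteq> 27"
    and "\<not> (i = parent_label ! c \<and> k = parent_node ! c)"
  defines "q \<equiv> up i (parent_node ! c)"
  shows "q < 27" "down (parent_label ! c) q = k" "down i q = parent_node ! c"
    "e6_roots ! (parent_label ! c) ! i = 0" "i \<noteq> parent_label ! c"
  using weight_table_entry[OF assms(1,2)] assms(3,4,5) unfolding q_def by (auto simp: Let_def)

lemma raise_table_none:
  assumes "i \<in> {1..6}" "k < 27" "up i k = 27"
  shows "map2 (+) (weights27 ! k) (e6_roots ! i) \<notin> set weights27"
  using weight_table_entry[OF assms(1,2)] assms(3) by (simp add: Let_def)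

lemma raise_table_some:
  assumes "i \<in> {1..6}" "k < 27" "up i k = p" "p \<noteq> 27"
  shows "p < 27" "down i p = k"
  using weight_table_entry[OF assms(1,2)] assms(3,4) by (auto simp: Let_def)

lemma parent_props:
  assumes "0 < k" "k < 27"
  shows "parent_label ! k \<in> {1..6}" "parent_node ! k < k"
    "down (parent_label ! k) (parent_node ! k) = k"
    "weights27 ! k = map2 (-) (weights27 ! (parent_node ! k)) (e6_roots ! (parent_label ! k))"
proof -
  have "k \<in> set [1..<27]" using assms by auto
  then have "(let j = parent_label ! k; a = parent_node ! k in
        0 < j \<and> j < 7 \<and> a < k \<and> down j a = k \<and>
        weights27 ! k = map2 (-) (weights27 ! a) (e6_roots ! j))"
    using weight_tables_ok unfolding weight_tables_ok_def list_all_iff by blast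
  then show "parent_label ! k \<in> {1..6}" "parent_node ! k < k"
    "down (parent_label ! k) (parent_node ! k) = k"
    "weights27 ! k = map2 (-) (weights27 ! (parent_node ! k)) (e6_roots ! (parent_label ! k))"
    by (auto simp: Let_def)
qed

lemma weight_lists_differ:
  assumes "length w = 7 \<and> w ! 0 = 0" "length w' = 7 \<and> w' ! 0 = 0" "w \<noteq> w'"
  shows "\<exists>i\<in>{1..6}. w ! i \<noteq> w' ! i"
proof -
  obtain i where "i < 7" "w ! i \<noteq> w' ! i"
    using assms by (metis nth_equalityI)
  moreover from this have "i \<noteq> 0" using assms by metis
  ultimately show ?thesis by (intro bexI[of _ i]) auto
qed


section \<open>Classification of the 27-dimensional representations\<close>

text \<open>The form in which an irreducible representation is used: relations applied to vectors,
  and no nonzero vector killed by all generators. Being phrased in three families of matrices, it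
  can be interpreted again after a relabelling by the diagram automorphism.\<close>

locale e6_module =
  fixes E F H :: "nat \<Rightarrow> complex^27^27"
  assumes HH: "i \<in> {1..6} \<Longrightarrow> j \<in> {1..6} \<Longrightarrow> H i *v (H j *v w) = H j *v (H i *v w)"
    and EF: "i \<in> {1..6} \<Longrightarrow> j \<in> {1..6} \<Longrightarrow>
      E i *v (F j *v w) = F j *v (E i *v w) + (if i = j then H i *v w else 0)"
    and HE: "i \<in> {1..6} \<Longrightarrow> j \<in> {1..6} \<Longrightarrow>
      H i *v (E j *v w) = E j *v (H i *v w) + of_int (e6_cartan i j) *s (E j *v w)"
    and HF: "i \<in> {1..6} \<Longrightarrow> j \<in> {1..6} \<Longrightarrow>
      H i *v (F j *v w) = F j *v (H i *v w) - of_int (e6_cartan i j) *s (F j *v w)"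
    and FF: "i \<in> {1..6} \<Longrightarrow> j \<in> {1..6} \<Longrightarrow> i \<noteq> j \<Longrightarrow> e6_cartan i j = 0 \<Longrightarrow>
      F i *v (F j *v w) = F j *v (F i *v w)"
    and no_invariants: "(\<And>i. i \<in> {1..6} \<Longrightarrow> E i *v w = 0 \<and> F i *v w = 0) \<Longrightarrow> w = 0"
begin

section \<open>Weight vectors and the existence of a highest weight vector\<close>

lemma cartan_diag: "e6_cartan i i = 2"
  by (simp add: e6_cartan_def)

lemma raise_weight:
  assumes "\<And>j. j \<in> {1..6} \<Longrightarrow> H j *v v = \<mu> j *s v" "i \<in> {1..6}" "j \<in> {1..6}"
  shows "H j *v (E i *v v) = (\<mu> j + of_int (e6_cartan j i)) *s (E i *v v)"
  using assms by (simp add: HE vec.scale vec.scale_left_distrib)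

lemma lower_weight:
  assumes "\<And>j. j \<in> {1..6} \<Longrightarrow> H j *v v = \<mu> j *s v" "i \<in> {1..6}" "j \<in> {1..6}"
  shows "H j *v (F i *v v) = (\<mu> j - of_int (e6_cartan j i)) *s (F i *v v)"
  using assms by (simp add: HF vec.scale vec.scale_left_diff_distrib)

lemma highest_weight_natural:
  assumes "v \<noteq> 0" "E i *v v = 0" "H i *v v = m *s v" "i \<in> {1..6}"
  shows "\<exists>k. m = of_nat k"
  using sl2_highest_weight[of "E i" "F i" "H i" v m] EF[of i i] HF[of i i] assms by (simp add: cartan_diag)

text \<open>Exchanging E and F and negating H gives another sl_2-triple. A vector killed by F is a
  highest weight vector for it with eigenvalue -m, which cannot be negative.\<close>

lemma lower_nonzero:
  assumes "v \<noteq> 0" "H i *v v = of_int m *s v" "m > 0" "i \<in> {1..6}"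
  shows "F i *v v \<noteq> 0"
proof
  assume "F i *v v = 0"
  have neg: "(- H i) *v w = - (H i *v w)" for w
    using matrix_vector_mult_diff_rdistrib[of 0 "H i" w] by simp
  have "\<exists>k. - of_int m = (of_nat k :: complex)"
    by (rule sl2_highest_weight[of "F i" "E i" "- H i" v])
      (use EF[of i i] HE[of i i] assms \<open>F i *v v = 0\<close> in
        \<open>simp_all add: neg cartan_diag vec.neg algebra_simps\<close>)
  then obtain k where "of_int (- m) = (of_int (int k) :: complex)" by auto
  then have "- m = int k" unfolding of_int_eq_iff .
  then show False using assms by simp
qed

text \<open>Among the joint eigenvectors of the H_i, one is taken on whose weight the function
  \<open>g\<close> is largest. Each E_i would increase \<open>g\<close> by 2, hence kills it. Real
  parts are taken because integrality of the eigenvalues is a consequence of being killed.\<close>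

lemma exists_highest_weight_vector:
  "\<exists>v (l :: nat \<Rightarrow> nat). v \<noteq> 0 \<and> (\<forall>i\<in>{1..6}. E i *v v = 0 \<and> H i *v v = of_nat (l i) *s v)"
proof -
  \<comment> \<open>The coefficients of the coweight on which all simple roots take the value 2.\<close>
  define c :: "nat \<Rightarrow> complex" where "c = (!) [0, 16, 22, 30, 42, 30, 16]"
  have c: "(\<Sum>i\<in>{1..6}. c i * of_int (e6_cartan i j)) = 2" if "j \<in> {1..6}" for j
    using that unfolding atLeastAtMost_1_6
    by (elim insertE emptyE; simp add: c_def e6_cartan_def doubleton_eq_iff)
  define wt where "wt v \<mu> \<longleftrightarrow> v \<noteq> 0 \<and> (\<forall>i\<in>{1..6}. H i *v v = \<mu> i *s v)" for v and \<mu> :: "nat \<Rightarrow> complex"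
  define g where "g \<mu> = Re (\<Sum>i\<in>{1..6}. c i * \<mu> i)" for \<mu> :: "nat \<Rightarrow> complex"
  define R where "R = {g \<mu> |v \<mu>. wt v \<mu>}"
  \<comment> \<open>Different values of \<open>g\<close> belong to different weights, so only
    finitely many values occur and the maximum exists.\<close>
  have "card K \<le> 27" if "finite K" "K \<subseteq> R" for K
  proof -
    have "\<forall>r\<in>K. \<exists>v \<mu>. wt v \<mu> \<and> g \<mu> = r"
      using that unfolding R_def by blast
    then obtain v \<mu> where v\<mu>: "wt (v r) (\<mu> r)" "g (\<mu> r) = r" if "r \<in> K" for r
      by metis
    have "\<exists>i\<in>{1..6}. \<mu> r i \<noteq> \<mu> s i" if "r \<in> K" "s \<in> K" "r \<noteq> s" for r s
    proof (rule ccontr)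
      assume "\<not> (\<exists>i\<in>{1..6}. \<mu> r i \<noteq> \<mu> s i)"
      then have "g (\<mu> r) = g (\<mu> s)" unfolding g_def by (intro arg_cong[of _ _ Re] sum.cong) auto
      then show False using v\<mu> that by metis
    qed
    then have "card K \<le> CARD(27)"
      using that(1) v\<mu>(1) unfolding wt_def
      by (intro card_joint_eigenvectors[of K v "{1..6}" H \<mu>]) auto
    then show ?thesis by simp
  qed
  then have R: "finite R"
    by (metis finite_if_finite_subsets_card_bdd)
  have "\<exists>w \<mu>. w \<in> UNIV \<and> w \<noteq> 0 \<and> (\<forall>i\<in>{1..6}. H i *v w = \<mu> i *s w)"
    by (rule common_eigenvector[of _ _ _ "axis 0 1"]) (auto simp: HH axis_eq_0_iff vec.subspace_UNIV)
  then have "R \<noteq> {}" by (auto simp: R_def wt_def)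
  then have "Max R \<in> R" using R by simp
  then obtain v \<mu> where v: "wt v \<mu>" "g \<mu> = Max R" by (auto simp: R_def)
  have E0: "E i *v v = 0" if i: "i \<in> {1..6}" for i
  proof (rule ccontr)
    assume "E i *v v \<noteq> 0"
    then have "wt (E i *v v) (\<lambda>j. \<mu> j + of_int (e6_cartan j i))"
      using v(1) i raise_weight[of v \<mu> i] by (auto simp: wt_def)
    then have "g (\<lambda>j. \<mu> j + of_int (e6_cartan j i)) \<le> Max R"
      using R by (intro Max_ge) (auto simp: R_def)
    moreover have "g (\<lambda>j. \<mu> j + of_int (e6_cartan j i)) = g \<mu> + 2"
      by (simp only: g_def distrib_left sum.distrib c[OF i]) simp
    ultimately show False using v(2) by simp
  qed
  have "\<forall>i\<in>{1..6}. \<exists>k. \<mu> i = of_nat k"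
    using v(1) E0 highest_weight_natural[of v] by (auto simp: wt_def)
  then obtain l where "\<forall>i\<in>{1..6}. \<mu> i = of_nat (l i)" by metis
  then show ?thesis using v(1) E0 by (intro exI[of _ v] exI[of _ l]) (auto simp: wt_def)
qed

text \<open>The weight meant is \<nu> + w with \<nu> dominant. Positive coordinates of
  \<open>w\<close> stay positive after this shift, so the weights generated from a minimal weight
  yield equally many for every dominant weight that exceeds it by a dominant one.\<close>

definition has_weight :: "(nat \<Rightarrow> nat) \<Rightarrow> int list \<Rightarrow> bool" where
  "has_weight \<nu> w \<longleftrightarrow> length w = 7 \<and> w ! 0 = 0 \<and>
     (\<exists>v. v \<noteq> 0 \<and> (\<forall>i\<in>{1..6}. H i *v v = of_int (int (\<nu> i) + w ! i) *s v))"

lemma nth_map2_7: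
  assumes "length w = 7 \<and> w ! 0 = 0" "length r = 7 \<and> r ! 0 = (0 :: int)" "f 0 0 = 0"
  shows "length (map2 f w r) = 7 \<and> map2 f w r ! 0 = 0" "j \<in> {1..6} \<Longrightarrow> map2 f w r ! j = f (w ! j) (r ! j)"
  using assms by auto

lemma has_weight_lower:
  assumes "has_weight \<nu> w" "w' \<in> set (lower_weights w)"
  shows "has_weight \<nu> w'"
proof -
  obtain i where "i \<in> set [1..<7]" "w ! i > 0" and w': "w' = map2 (-) w (e6_roots ! i)"
    using assms(2) unfolding lower_weights_def by auto
  then have i: "i \<in> {1..6}" "w ! i > 0" by auto
  obtain v where w: "length w = 7 \<and> w ! 0 = 0" and v: "v \<noteq> 0"
    "\<And>i. i \<in> {1..6} \<Longrightarrow> H i *v v = of_int (int (\<nu> i) + w ! i) *s v"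
    using assms(1) by (auto simp: has_weight_def)
  have "F i *v v \<noteq> 0"
    by (rule lower_nonzero[OF v(1) v(2)]) (use i in auto)
  moreover have "H j *v (F i *v v) = of_int (int (\<nu> j) + w' ! j) *s (F i *v v)" if j: "j \<in> {1..6}" for j
  proof -
    have "int (\<nu> j) + w' ! j = int (\<nu> j) + w ! j - e6_cartan j i"
      using nth_map2_7(2)[OF w e6_roots_form[OF i(1)], of "(-)" j] e6_roots_nth[OF i(1) j] j
      by (simp add: w')
    then show ?thesis
      using lower_weight[OF v(2) i(1) j] by (simp only: of_int_diff)
  qed
  ultimately show ?thesis
    using nth_map2_7(1)[OF w e6_roots_form[OF i(1)], of "(-)"] unfolding has_weight_def w' by auto
qed

lemma has_weight_levels:
  assumes "\<And>w. w \<in> set L \<Longrightarrow> has_weight \<nu> w" "w \<in> set (weight_levels n L)"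
  shows "has_weight \<nu> w"
  using assms
proof (induction n arbitrary: L)
  case (Suc n)
  then show ?case
    using Suc.IH[of "remdups (concat (map lower_weights L))"] by (auto intro: has_weight_lower)
qed simp

lemma card_has_weight:
  assumes "finite K" "\<And>w. w \<in> K \<Longrightarrow> has_weight \<nu> w"
  shows "card K \<le> 27"
proof -
  have "\<forall>w\<in>K. \<exists>v. v \<noteq> 0 \<and> (\<forall>i\<in>{1..6}. H i *v v = of_int (int (\<nu> i) + w ! i) *s v)"
    using assms(2) by (auto simp: has_weight_def)
  then obtain v where v: "\<And>w. w \<in> K \<Longrightarrow> v w \<noteq> 0"
    "\<And>w i. w \<in> K \<Longrightarrow> i \<in> {1..6} \<Longrightarrow> H i *v v w = of_int (int (\<nu> i) + w ! i) *s v w"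
    by metis
  have "\<exists>i\<in>{1..6}. (of_int (int (\<nu> i) + w ! i) :: complex) \<noteq> of_int (int (\<nu> i) + w' ! i)"
    if "w \<in> K" "w' \<in> K" "w \<noteq> w'" for w w'
    using weight_lists_differ[of w w'] that assms(2) unfolding has_weight_def of_int_eq_iff by auto
  then have "card K \<le> CARD(27)"
    using assms(1) v
    by (intro card_joint_eigenvectors[of K v "{1..6}" H "\<lambda>w i. of_int (int (\<nu> i) + w ! i)"]) auto
  then show ?thesis by simp
qed

lemma not_many_weights:
  assumes "has_weight \<nu> w"
  shows "\<not> many_weights w"
proof
  assume "many_weights w"
  then have "27 < card (set (weight_levels 10 [w]))"
    by (simp add: many_weights_def Let_def distinct_card)
  moreover have "card (set (weight_levels 10 [w])) \<le> 27"
    using assms has_weight_levels[of "[w]" \<nu> _ 10] by (intro card_has_weight) auto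
  ultimately show False by simp
qed

text \<open>A weight that dominates one of the \<open>minimal_weights\<close> coordinatewise is
  excluded by the number of weights; 0, omega_1 and omega_6 remain. For weight 0, a nonzero F_i v
  would be killed by E_i with eigenvalue -2, so all F_i v vanish and v would be invariant.\<close>

lemma minuscule_highest_weight:
  assumes v: "v \<noteq> 0" and E: "\<And>i. i \<in> {1..6} \<Longrightarrow> E i *v v = 0"
    and H: "\<And>i. i \<in> {1..6} \<Longrightarrow> H i *v v = of_nat (l i) *s v"
  shows "(\<forall>i\<in>{1..6}. l i = (if i = 1 then 1 else 0)) \<or> (\<forall>i\<in>{1..6}. l i = (if i = 6 then 1 else 0))"
proof -
  have no: "\<exists>i\<in>{1..6}. int (l i) < m ! i" if m: "m \<in> set minimal_weights" for m
  proof (rule ccontr)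
    assume "\<not> ?thesis"
    then have le: "m ! i \<le> int (l i)" if "i \<in> {1..6}" for i using that by force
    have "has_weight (\<lambda>i. l i - nat (m ! i)) m"
    proof -
      have form: "length m = 7 \<and> m ! 0 = 0 \<and> (\<forall>i\<in>{1..6}. m ! i \<ge> 0)"
        using m unfolding atLeastAtMost_1_6 by (auto simp: minimal_weights_def)
      then have "int (l i - nat (m ! i)) + m ! i = int (l i)" if "i \<in> {1..6}" for i
        using le[OF that] that by (auto simp: of_nat_diff nat_le_iff)
      then show ?thesis
        using v H form unfolding has_weight_def by (intro conjI exI[of _ v]) auto
    qed
    then show False
      using not_many_weights many_weights_minimal m by (auto simp: list_all_iff)
  qed
  have "\<exists>i\<in>{1..6}. l i \<noteq> 0"
  proof (rule ccontr)
    assume "\<not> ?thesis"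
    then have H0: "H i *v v = 0" if "i \<in> {1..6}" for i using H that by simp
    have "F i *v v = 0" if i: "i \<in> {1..6}" for i
    proof (rule ccontr)
      assume "F i *v v \<noteq> 0"
      moreover have "E i *v (F i *v v) = 0" using EF[OF i i] E H0 i by simp
      moreover have "H i *v (F i *v v) = (- 2) *s (F i *v v)"
        using HF[OF i i, of v] H0[OF i] by (simp add: cartan_diag vector_smult_lneg)
      ultimately obtain k where "(- 2 :: complex) = of_nat k"
        using highest_weight_natural i by blast
      then have "of_int (- 2) = (of_int (int k) :: complex)" by simp
      then have "- 2 = int k" unfolding of_int_eq_iff .
      then show False by simp
    qed
    then show False using no_invariants[of v] v E by blast
  qed
  moreover have "l 2 = 0 \<and> l 3 = 0 \<and> l 4 = 0 \<and> l 5 = 0 \<and> l 1 < 2 \<and> l 6 < 2 \<and> (l 1 = 0 \<or> l 6 = 0)"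
  proof -
    have "\<forall>m\<in>set minimal_weights. \<exists>i\<in>{1..6}. int (l i) < m ! i" using no by blast
    then show ?thesis unfolding atLeastAtMost_1_6 minimal_weights_def by simp
  qed
  ultimately show ?thesis
    unfolding atLeastAtMost_1_6 by (auto simp: less_2_cases_iff)
qed

text \<open>The vector is lowered along the path of the spanning tree from 0 to k. The guard
  \<open>k \<le> parent_node ! k\<close> never holds for 0 < k < 27; it ensures termination for
  arguments outside the table.\<close>

function weight_vec :: "complex^27 \<Rightarrow> nat \<Rightarrow> complex^27" where
  "weight_vec v k =
    (if k = 0 \<or> k \<le> parent_node ! k then v
     else F (parent_label ! k) *v weight_vec v (parent_node ! k))"
  by auto
termination
  by (relation "Wellfounded.measure snd") auto

declare weight_vec.simps [simp del]

lemma weight_vec_0 [simp]: "weight_vec v 0 = v"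
  by (simp add: weight_vec.simps)

lemma weight_vec_step:
  assumes "0 < k" "k < 27"
  shows "weight_vec v k = F (parent_label ! k) *v weight_vec v (parent_node ! k)"
  using parent_props(2)[OF assms] assms(1) by (subst weight_vec.simps) auto

section \<open>The 27 weight vectors generated by a vector of weight omega_1\<close>

context
  fixes v :: "complex^27"
  assumes v0: "v \<noteq> 0"
    and vH: "\<And>i. i \<in> {1..6} \<Longrightarrow> H i *v v = of_int (weights27 ! 0 ! i) *s v"
begin

lemma weight_vec_weight:
  assumes "k < 27"
  shows "weight_vec v k \<noteq> 0 \<and> (\<forall>j\<in>{1..6}. H j *v weight_vec v k = of_int (weights27 ! k ! j) *s weight_vec v k)"
  using assms
proof (induction k rule: less_induct)
  case (less k)
  show ?case
  proof (cases "k = 0")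
    case True
    then show ?thesis using v0 vH by simp
  next
    case False
    define i a where "i = parent_label ! k" and "a = parent_node ! k"
    have p: "i \<in> {1..6}" "a < k" "down i a = k" "weights27 ! k = map2 (-) (weights27 ! a) (e6_roots ! i)"
      using parent_props[of k] False less.prems by (auto simp: i_def a_def)
    have a: "a < 27" using p(2) less.prems by simp
    have IH: "weight_vec v a \<noteq> 0" "\<And>j. j \<in> {1..6} \<Longrightarrow> H j *v weight_vec v a = of_int (weights27 ! a ! j) *s weight_vec v a"
      using less.IH[OF p(2)] a by auto
    have k: "weight_vec v k = F i *v weight_vec v a"
      using weight_vec_step[of k v] False less.prems by (simp add: i_def a_def)
    have "weights27 ! a ! i = 1"
      using lower_table_some(3)[OF p(1) a p(3)] less.prems by simp
    then have "F i *v weight_vec v a \<noteq> 0"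
      using lower_nonzero[OF IH(1) IH(2)] p(1) by simp
    moreover have "H j *v (F i *v weight_vec v a) = of_int (weights27 ! k ! j) *s (F i *v weight_vec v a)"
      if j: "j \<in> {1..6}" for j
    proof -
      have "weights27 ! a \<in> set weights27" using a by (simp add: length_weights27)
      then have "weights27 ! k ! j = weights27 ! a ! j - e6_cartan j i"
        using nth_map2_7(2)[OF weights27_form e6_roots_form[OF p(1)], of "weights27 ! a" "(-)" j]
          e6_roots_nth[OF p(1) j] j p(4) by simp
      then show ?thesis
        using lower_weight[OF IH(2) p(1) j] by (simp only: of_int_diff)
    qed
    ultimately show ?thesis unfolding k by blast
  qed
qed

lemma weights27_differ: "k < 27 \<Longrightarrow> l < 27 \<Longrightarrow> k \<noteq> l \<Longrightarrow> \<exists>i\<in>{1..6}. weights27 ! k ! i \<noteq> weights27 ! l ! i"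
  by (intro weight_lists_differ weights27_form)
     (simp_all add: length_weights27 nth_eq_iff_index_eq[OF distinct_weights27])

text \<open>Together with the 27 vectors \<open>weight_vec v k\<close>, a nonzero \<open>u\<close>
  would give 28 vectors of pairwise distinct weights in a space of dimension 27.\<close>

lemma no_other_weights:
  assumes w: "length w = 7 \<and> w ! 0 = 0" "w \<notin> set weights27"
    and u: "\<And>j. j \<in> {1..6} \<Longrightarrow> H j *v u = of_int (w ! j) *s u"
  shows "u = 0"
proof (rule ccontr)
  assume u0: "u \<noteq> 0"
  define x where "x k = (if k < 27 then weight_vec v k else u)" for k :: nat
  define \<mu> where "\<mu> k = (if k < 27 then weights27 ! k else w)" for k :: nat
  have differ: "\<exists>i\<in>{1..6}. \<mu> k ! i \<noteq> \<mu> l ! i" if "k \<le> 27" "l \<le> 27" "k \<noteq> l" for k l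
  proof (rule weight_lists_differ)
    show "length (\<mu> k) = 7 \<and> \<mu> k ! 0 = 0" "length (\<mu> l) = 7 \<and> \<mu> l ! 0 = 0"
      using w(1) weights27_form by (simp_all add: \<mu>_def length_weights27)
    show "\<mu> k \<noteq> \<mu> l"
      using that w(2) nth_mem[of _ weights27]
      by (auto simp: \<mu>_def length_weights27 nth_eq_iff_index_eq[OF distinct_weights27])
  qed
  have "card {..27::nat} \<le> CARD(27)"
  proof (rule card_joint_eigenvectors[of _ x "{1..6}" H "\<lambda>k i. of_int (\<mu> k ! i)"])
    show "x k \<noteq> 0" for k
      using weight_vec_weight u0 by (simp add: x_def)
    show "H i *v x k = of_int (\<mu> k ! i) *s x k" if "i \<in> {1..6}" for k i
      using weight_vec_weight u that by (simp add: x_def \<mu>_def)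
    show "\<exists>i\<in>{1..6}. (of_int (\<mu> k ! i) :: complex) \<noteq> of_int (\<mu> l ! i)"
      if "k \<in> {..27}" "l \<in> {..27}" "k \<noteq> l" for k l
      using differ[of k l] that unfolding of_int_eq_iff by simp
  qed simp
  then show False by simp
qed

lemma lower_weight_vec_none:
  assumes "i \<in> {1..6}" "k < 27" "down i k = 27"
  shows "F i *v weight_vec v k = 0"
proof (rule no_other_weights)
  have k: "length (weights27 ! k) = 7 \<and> weights27 ! k ! 0 = 0"
    using assms(2) by (intro weights27_form) (simp add: length_weights27)
  show "length (map2 (-) (weights27 ! k) (e6_roots ! i)) = 7 \<and> map2 (-) (weights27 ! k) (e6_roots ! i) ! 0 = 0"
    by (rule nth_map2_7(1)[OF k e6_roots_form[OF assms(1)]]) simp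
  show "map2 (-) (weights27 ! k) (e6_roots ! i) \<notin> set weights27"
    by (rule lower_table_none[OF assms])
  fix j :: nat assume j: "j \<in> {1..6}"
  have "map2 (-) (weights27 ! k) (e6_roots ! i) ! j = weights27 ! k ! j - e6_cartan j i"
    using nth_map2_7(2)[OF k e6_roots_form[OF assms(1)], of "(-)" j] e6_roots_nth[OF assms(1) j] j by simp
  then show "H j *v (F i *v weight_vec v k) = of_int (map2 (-) (weights27 ! k) (e6_roots ! i) ! j) *s (F i *v weight_vec v k)"
    using lower_weight[of "weight_vec v k" "\<lambda>j. of_int (weights27 ! k ! j)" i j] weight_vec_weight[OF assms(2)] assms(1) j
    by (simp only: of_int_diff)
qed

lemma raise_weight_vec_none:
  assumes "i \<in> {1..6}" "k < 27" "up i k = 27"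
  shows "E i *v weight_vec v k = 0"
proof (rule no_other_weights)
  have k: "length (weights27 ! k) = 7 \<and> weights27 ! k ! 0 = 0"
    using assms(2) by (intro weights27_form) (simp add: length_weights27)
  show "length (map2 (+) (weights27 ! k) (e6_roots ! i)) = 7 \<and> map2 (+) (weights27 ! k) (e6_roots ! i) ! 0 = 0"
    by (rule nth_map2_7(1)[OF k e6_roots_form[OF assms(1)]]) simp
  show "map2 (+) (weights27 ! k) (e6_roots ! i) \<notin> set weights27"
    by (rule raise_table_none[OF assms])
  fix j :: nat assume j: "j \<in> {1..6}"
  have "map2 (+) (weights27 ! k) (e6_roots ! i) ! j = weights27 ! k ! j + e6_cartan j i"
    using nth_map2_7(2)[OF k e6_roots_form[OF assms(1)], of "(+)" j] e6_roots_nth[OF assms(1) j] j by simp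
  then show "H j *v (E i *v weight_vec v k) = of_int (map2 (+) (weights27 ! k) (e6_roots ! i) ! j) *s (E i *v weight_vec v k)"
    using raise_weight[of "weight_vec v k" "\<lambda>j. of_int (weights27 ! k ! j)" i j] weight_vec_weight[OF assms(2)] assms(1) j
    by (simp only: of_int_add)
qed

text \<open>Two different arrows of the weight diagram ending at the same node have orthogonal labels,
  so the corresponding lowering operators commute.\<close>

lemma lower_weight_vec_some:
  assumes "c < 27" "i \<in> {1..6}" "k < 27" "down i k = c"
  shows "F i *v weight_vec v k = weight_vec v c"
  using assms
proof (induction c arbitrary: i k rule: less_induct)
  case (less c)
  have kc: "k < c" using lower_table_some(5)[OF less.prems(2-4)] less.prems(1) by simp
  then have c0: "0 < c" by simp
  define j a where "j = parent_label ! c" and "a = parent_node ! c"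
  have p: "j \<in> {1..6}" "a < c" "down j a = c"
    using parent_props[OF c0 less.prems(1)] by (simp_all add: j_def a_def)
  have vc: "weight_vec v c = F j *v weight_vec v a"
    unfolding j_def a_def by (rule weight_vec_step[OF c0 less.prems(1)])
  show ?case
  proof (cases "i = j \<and> k = a")
    case True
    then show ?thesis using vc by simp
  next
    case False
    \<comment> \<open>The fourth corner of the square: lowering \<open>q\<close> by i leads to
      \<open>a\<close>, by j to \<open>k\<close>. Both nodes precede \<open>c\<close>, so the
      induction hypothesis covers these two arrows, and F_i and F_j commute.\<close>
    define q where "q = up i a"
    have "c \<noteq> 27" using less.prems(1) by simp
    then have q: "q < 27" "down j q = k" "down i q = a" "e6_roots ! j ! i = 0" "i \<noteq> j"
      using lower_table_parent[OF less.prems(2-4)] False by (simp_all add: j_def a_def q_def)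
    have "weight_vec v a = F i *v weight_vec v q"
      using less.IH[OF p(2), of i q] q less.prems p by simp
    then have "weight_vec v c = F i *v (F j *v weight_vec v q)"
      using vc FF[of j i] p(1) less.prems(2) q(4,5) e6_roots_nth[OF p(1) less.prems(2)]
        e6_roots_nth[OF less.prems(2) p(1)] by (simp add: e6_cartan_def insert_commute)
    also have "F j *v weight_vec v q = weight_vec v k"
      using less.IH[OF kc, of j q] q less.prems p by simp
    finally show ?thesis by simp
  qed
qed

text \<open>The source of an arrow is killed by E_i and has coordinate 1, so E_i F_i acts on it as
  H_i, that is, as the identity. This is why the raising matrices have entries 0 and 1 and are the
  transposes of the lowering ones.\<close>

lemma raise_weight_vec_some:
  assumes "i \<in> {1..6}" "c < 27" "up i c = k" "k \<noteq> 27"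
  shows "E i *v weight_vec v c = weight_vec v k"
proof -
  have k: "k < 27" "down i k = c"
    using raise_table_some[OF assms] by auto
  then have "weights27 ! k ! i = 1" "up i k = 27"
    using lower_table_some[OF assms(1) k] assms(2) by auto
  moreover have "weight_vec v c = F i *v weight_vec v k"
    using lower_weight_vec_some[OF assms(2,1) k] by simp
  ultimately show ?thesis
    using EF[OF assms(1,1), of "weight_vec v k"] raise_weight_vec_none[OF assms(1) k(1)]
      weight_vec_weight[OF k(1)] assms(1) by simp
qed

lemma weight_vec_independent:
  assumes "(\<Sum>k<27. c k *s weight_vec v k) = 0"
  shows "\<forall>k<27. c k = 0"
proof -
  have "\<forall>k\<in>{..<27}. c k = 0"
  proof (rule joint_eigenvectors_independent[of _ "weight_vec v" "{1..6}" H "\<lambda>k i. of_int (weights27 ! k ! i)"])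
    show "\<exists>i\<in>{1..6}. (of_int (weights27 ! k ! i) :: complex) \<noteq> of_int (weights27 ! l ! i)"
      if "k \<in> {..<27}" "l \<in> {..<27}" "k \<noteq> l" for k l
      using weights27_differ[of k l] that unfolding of_int_eq_iff by simp
  qed (use weight_vec_weight assms in auto)
  then show ?thesis by blast
qed

end

end

definition minuscule_basis ::
    "(nat \<Rightarrow> complex^27^27) \<Rightarrow> (nat \<Rightarrow> complex^27^27) \<Rightarrow> (nat \<Rightarrow> complex^27^27) \<Rightarrow> (nat \<Rightarrow> complex^27) \<Rightarrow> bool" where
  "minuscule_basis E F H x \<longleftrightarrow>
     (\<forall>c. (\<Sum>k<27. c k *s x k) = 0 \<longrightarrow> (\<forall>k<27. c k = 0)) \<and>
     (\<forall>i\<in>{1..6}. \<forall>k<27.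
        H i *v x k = of_int (weights27 ! k ! i) *s x k \<and>
        F i *v x k = (if down i k = 27 then 0 else x (down i k)) \<and>
        E i *v x k = (if up i k = 27 then 0 else x (up i k)))"

section \<open>The diagram automorphism and the two minuscule cases\<close>

definition diagram_flip :: "nat \<Rightarrow> nat" where
  "diagram_flip = (!) [0, 6, 2, 5, 4, 3, 1]"

lemma diagram_flip_involution:
  assumes "i \<in> {1..6}"
  shows "diagram_flip i \<in> {1..6}" "diagram_flip (diagram_flip i) = i"
  using assms unfolding atLeastAtMost_1_6
  by (elim insertE emptyE; simp add: diagram_flip_def)+

lemma diagram_flip:
  assumes "i \<in> {1..6}" "j \<in> {1..6}"
  shows "e6_cartan (diagram_flip i) (diagram_flip j) = e6_cartan i j"
    "diagram_flip i = diagram_flip j \<longleftrightarrow> i = j" 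
  using assms unfolding atLeastAtMost_1_6
  by (elim insertE emptyE; simp add: diagram_flip_def e6_cartan_def doubleton_eq_iff)+

lemma (in e6_module) diagram_flip_module:
  "e6_module (\<lambda>i. E (diagram_flip i)) (\<lambda>i. F (diagram_flip i)) (\<lambda>i. H (diagram_flip i))"
proof
  fix w assume *: "E (diagram_flip i) *v w = 0 \<and> F (diagram_flip i) *v w = 0" if "i \<in> {1..6}" for i
  show "w = 0"
  proof (rule no_invariants)
    fix i :: nat assume "i \<in> {1..6}"
    then show "E i *v w = 0 \<and> F i *v w = 0"
      using *[of "diagram_flip i"] diagram_flip_involution[of i] by simp
  qed
next
  fix i j w assume "i \<in> {1..6}" "j \<in> {1..6}" "i \<noteq> j" "e6_cartan i j = 0"
  then show "F (diagram_flip i) *v (F (diagram_flip j) *v w) = F (diagram_flip j) *v (F (diagram_flip i) *v w)"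
    by (intro FF) (simp_all add: diagram_flip_involution diagram_flip del: atLeastAtMost_iff One_nat_def)
qed (simp_all add: diagram_flip_involution diagram_flip HH EF HE HF del: atLeastAtMost_iff One_nat_def)

lemma (in e6_module) minuscule_basis_first:
  assumes v: "v \<noteq> 0" and H: "\<And>i. i \<in> {1..6} \<Longrightarrow> H i *v v = of_nat (if i = 1 then 1 else 0) *s v"
  shows "minuscule_basis E F H (weight_vec v)"
proof -
  have vH: "H i *v v = of_int (weights27 ! 0 ! i) *s v" if "i \<in> {1..6}" for i
    using H[OF that] that unfolding atLeastAtMost_1_6 by (auto simp: weights27_def)
  show ?thesis
    unfolding minuscule_basis_def
    using weight_vec_independent[OF v vH] weight_vec_weight[OF v vH] lower_weight_vec_none[OF v vH]
      lower_weight_vec_some[OF v vH] lower_table_some(1) raise_weight_vec_none[OF v vH]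
      raise_weight_vec_some[OF v vH]
    by auto
qed

text \<open>Highest weight omega_6 becomes omega_1 when the generators are relabelled. The
  relabelling \<tau> can stay unspecified, because a commutant depends only on the set of matrices
  and not on their labels.\<close>

theorem e6_module_minuscule_basis:
  assumes "e6_module E F H"
  obtains \<tau> x where
    "minuscule_basis (\<lambda>i. E (\<tau> i)) (\<lambda>i. F (\<tau> i)) (\<lambda>i. H (\<tau> i)) x"
proof -
  interpret e6_module E F H by fact
  interpret flip: e6_module "\<lambda>i. E (diagram_flip i)" "\<lambda>i. F (diagram_flip i)" "\<lambda>i. H (diagram_flip i)"
    by (rule diagram_flip_module)
  obtain v l where v: "v \<noteq> 0" "\<And>i. i \<in> {1..6} \<Longrightarrow> E i *v v = 0"
    "\<And>i. i \<in> {1..6} \<Longrightarrow> H i *v v = of_nat (l i) *s v"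
    using exists_highest_weight_vector by blast
  from minuscule_highest_weight[OF v] show thesis
  proof
    assume l: "\<forall>i\<in>{1..6}. l i = (if i = 1 then 1 else 0)"
    have "minuscule_basis E F H (weight_vec v)"
      by (rule minuscule_basis_first[OF v(1)]) (use v(3) l in simp)
    then show thesis using that[of "\<lambda>i. i"] by simp
  next
    assume l: "\<forall>i\<in>{1..6}. l i = (if i = 6 then 1 else 0)"
    have "H (diagram_flip i) *v v = of_nat (if i = 1 then 1 else 0) *s v" if "i \<in> {1..6}" for i
    proof -
      have "l (diagram_flip i) = (if i = 1 then 1 else 0)"
        using l that unfolding atLeastAtMost_1_6 by (auto simp: diagram_flip_def)
      then show ?thesis using v(3)[of "diagram_flip i"] diagram_flip_involution(1)[OF that] by simp
    qed
    then show thesis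
      using that[of diagram_flip] flip.minuscule_basis_first[OF v(1)] by blast
  qed
qed

section \<open>Vectors killed by the raising operators\<close>

text \<open>The pairs are the second and third index, the first index being 0. Under D_5 (labels 2
  to 6) V splits as 1 + 16 + 10 with highest nodes 0, 1 and 12, the only second indices that occur.
  All ten total weights are dominant.\<close>

definition top_positions :: "(nat \<times> nat) list" where
  "top_positions =
    [(0, 0), (0, 1), (0, 12), (1, 0), (1, 2), (1, 10), (1, 22), (12, 0), (12, 7), (12, 26)]"

text \<open>The alternatives for a pair whose second index is 0, 1 or 12: it is listed, or a single
  raising operator of D_5 forces its component to vanish, or the square of the first raising
  operator does.\<close>

definition top_positions_ok :: bool where
  "top_positions_ok \<longleftrightarrow>
    list_all (\<lambda>b. list_all (\<lambda>c.
      (b, c) \<in> set top_positions \<or>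
      list_ex (\<lambda>i. down i b = 27 \<and> up i c \<noteq> 27) [2..<7] \<or>
      up 1 b \<noteq> 27 \<and> up 1 c \<noteq> 27) [0..<27]) [0, 1, 12] \<and>
    list_all (\<lambda>b. b \<in> {0, 1, 12} \<or> list_ex (\<lambda>i. up i b < b) [2..<7]) [0..<27] \<and>
    list_all (\<lambda>i. down i 0 = 27) [2..<7] \<and>
    down 1 0 = 1 \<and> down 1 1 = 27"

lemma top_positions_ok: top_positions_ok
  by code_simp

text \<open>Components of a tensor in the weight basis. The table entry 27 stands for a missing arrow,
  so a component with an index 27 counts as zero.\<close>

definition raise_killed :: "(nat \<Rightarrow> nat \<Rightarrow> nat \<Rightarrow> complex) \<Rightarrow> bool" where
  "raise_killed z \<longleftrightarrow>
    (\<forall>a b c. a = 27 \<or> b = 27 \<or> c = 27 \<longrightarrow> z a b c = 0) \<and>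
    (\<forall>i\<in>{1..6}. \<forall>a<27. \<forall>b<27. \<forall>c<27.
      z (down i a) b c + z a (down i b) c + z a b (down i c) = 0)"

lemma lower_table_le: "i \<in> {1..6} \<Longrightarrow> k < 27 \<Longrightarrow> down i k \<le> 27"
  using lower_table_some(1)[of i k "down i k"] by (cases "down i k = 27") auto

lemma lower_lower_table:
  assumes "i \<in> {1..6}" "k < 27" "down i k = c" "c < 27"
  shows "down i c = 27"
proof (rule ccontr)
  assume "down i c \<noteq> 27"
  then have "up i c = 27"
    using lower_table_some(4)[OF assms(1,4) refl] by simp
  then show False using lower_table_some(2)[OF assms(1-3)] assms by simp
qed

text \<open>A vector killed by the raising operators is determined by its components with highest first
  index; these are in turn killed by the raising operators of type \<open>D\<^sub>5\<close> (labels 2 to 6) and by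
  the square of the first one.\<close>

lemma raise_killed_eq_0:
  assumes z: "raise_killed z" and top: "\<And>b c. (b, c) \<in> set top_positions \<Longrightarrow> z 0 b c = 0"
    and "a < 27" "b < 27" "c < 27"
  shows "z a b c = 0"
proof -
  have z27: "z a b c = 0" if "a = 27 \<or> b = 27 \<or> c = 27" for a b c
    using z that unfolding raise_killed_def by blast
  have eq: "z (down i a) b c + z a (down i b) c + z a b (down i c) = 0"
    if "i \<in> {1..6}" "a < 27" "b < 27" "c < 27" for i a b c
    using z that unfolding raise_killed_def by blast
  note ok = top_positions_ok[unfolded top_positions_ok_def list_all_iff list_ex_iff]
  have l0: "down i 0 = 27" if "i \<in> set [2..<7]" for i
    by (rule bspec[OF ok[THEN conjunct2, THEN conjunct2, THEN conjunct1] that])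
  have l1: "down 1 0 = 1" "down 1 1 = 27"
    using ok[THEN conjunct2, THEN conjunct2, THEN conjunct2] by simp_all
  have mem: "i \<in> {1..6}" if "i \<in> set [2..<7]" for i :: nat
    using that by auto
  have A: "z 0 b c = 0" if b: "b \<in> {0, 1, 12}" and c: "c < 27" for b c
  proof -
    have b27: "b < 27" using b by auto
    have "(b, c) \<in> set top_positions \<or>
      (\<exists>i\<in>set [2..<7]. down i b = 27 \<and> up i c \<noteq> 27) \<or>
      up 1 b \<noteq> 27 \<and> up 1 c \<noteq> 27"
    proof -
      have "b \<in> set [0, 1, 12]" "c \<in> set [0..<27]" using b c by auto
      then show ?thesis by (rule bspec[OF bspec[OF ok[THEN conjunct1]]])
    qed
    then consider "(b, c) \<in> set top_positions"
      | i where "i \<in> set [2..<7]" "down i b = 27" "up i c \<noteq> 27"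
      | "up 1 b \<noteq> 27" "up 1 c \<noteq> 27" by blast
    then show ?thesis
    proof cases
      case 1
      then show ?thesis by (rule top)
    next
      case (2 i)
      define c' where "c' = up i c"
      have "c' < 27" "down i c' = c"
        using raise_table_some[OF mem[OF 2(1)] c refl 2(3)] by (simp_all add: c'_def)
      then show ?thesis
        using eq[OF mem[OF 2(1)], of 0 b c'] b27 2(2) l0[OF 2(1)] z27 by simp
    next
      case 3
      define b' c' where "b' = up 1 b" and "c' = up 1 c"
      have one: "(1::nat) \<in> {1..6}" by simp
      have bc': "b' < 27" "down 1 b' = b" "c' < 27" "down 1 c' = c"
        using raise_table_some[OF one b27 refl 3(1)] raise_table_some[OF one c refl 3(2)]
        by (simp_all add: b'_def c'_def)
      have ll: "down 1 b = 27" "down 1 c = 27"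
        using lower_lower_table[OF one bc'(1,2) b27] lower_lower_table[OF one bc'(3,4) c] by auto
      \<comment> \<open>The equations for label 1 at (0, b, c'), (0, b', c) and (1, b', c'): the sum
        of the first two minus the third is 2 \<open>z 0 b c\<close>.\<close>
      have "z 1 b c' + z 0 b c = 0"
        using eq[OF one, of 0 b c'] b27 bc' ll l1 z27[of 0 27 c'] by simp
      moreover have "z 1 b' c + z 0 b c = 0"
        using eq[OF one, of 0 b' c] c bc' ll l1 z27[of 0 b' 27] by simp
      moreover have "z 1 b c' + z 1 b' c = 0"
        using eq[OF one, of 1 b' c'] bc' l1 z27[of 27 b' c'] by simp
      ultimately have "2 * z 0 b c = 0"
        by (simp add: eq_neg_iff_add_eq_0 [symmetric])
      then show ?thesis by simp
    qed
  qed
  have B: "z 0 b c = 0" if "b < 27" "c \<le> 27" for b c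
    using that
  proof (induction b arbitrary: c rule: less_induct)
    case (less b)
    show ?case
    proof (cases "c = 27")
      case True
      then show ?thesis using z27 by simp
    next
      case False
      then have c: "c < 27" using less.prems by simp
      show ?thesis
      proof (cases "b \<in> {0, 1, 12}")
        case True
        then show ?thesis using A c by blast
      next
        case False
        have "b \<in> set [0..<27]" using less.prems by simp
        then obtain i where i: "i \<in> set [2..<7]" "up i b < b"
          using bspec[OF ok[THEN conjunct2, THEN conjunct1]] False by blast
        define b' where "b' = up i b"
        have b': "b' < b" "b' < 27" "down i b' = b"
          using raise_table_some[OF mem[OF i(1)] less.prems(1) refl] i(2) less.prems by (auto simp: b'_def)
        have "z 0 b' (down i c) = 0"
          by (rule less.IH[OF b'(1,2) lower_table_le[OF mem[OF i(1)] c]])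
        then show ?thesis
          using eq[OF mem[OF i(1)], of 0 b' c] b' c l0[OF i(1)] z27[of 27 b' c] by simp
      qed
    qed
  qed
  have "z a b c = 0" if "a < 27" "b \<le> 27" "c \<le> 27" for a b c
    using that
  proof (induction a arbitrary: b c rule: less_induct)
    case (less a)
    show ?case
    proof (cases "b = 27 \<or> c = 27")
      case True
      then show ?thesis using z27 by blast
    next
      case False
      then have bc: "b < 27" "c < 27" using less.prems by auto
      show ?thesis
      proof (cases "a = 0")
        case True
        then show ?thesis using B bc by simp
      next
        case False
        define i a' where "i = parent_label ! a" and "a' = parent_node ! a"
        have p: "i \<in> {1..6}" "a' < a" "down i a' = a"
          using parent_props[of a] False less.prems by (auto simp: i_def a'_def)
        have "z a' (down i b) c = 0" "z a' b (down i c) = 0"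
          using less.IH[OF p(2)] lower_table_le[OF p(1)] bc p(2) less.prems(1) by simp_all
        then show ?thesis
          using eq[OF p(1), of a' b c] p bc less.prems(1) by simp
      qed
    qed
  qed
  then show ?thesis using assms by simp
qed


section \<open>The invariant cubic tensor\<close>

text \<open>The entry \<open>\<plusminus>(c + 1)\<close> in row \<open>a\<close> and column \<open>b\<close> says that \<open>a\<close>, \<open>b\<close>, \<open>c\<close> have weights
  adding up to zero, and gives the sign of the corresponding component of the tensor.\<close>

definition triad_table :: "int list list" where
  "triad_table =
   [[0,0,0,0,0,0,0,0,0,0,0,0,27,0,0,-26,0,25,0,-24,0,23,22,-20,18,-16,13],
   [0,0,0,0,0,0,0,0,0,0,-27,0,0,26,0,0,-25,0,24,0,-23,0,-21,19,-17,14,-11],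
   [0,0,0,0,0,0,0,0,27,0,0,-26,0,0,25,0,0,0,-22,21,20,-19,0,0,15,-12,9],
   [0,0,0,0,0,0,-27,0,0,26,0,0,0,0,-24,0,22,-21,0,0,-18,17,0,-15,0,10,-7],
   [0,0,0,0,0,27,0,-26,0,0,0,0,0,0,23,0,-20,19,18,-17,0,0,15,0,0,-8,6],
   [0,0,0,0,27,0,0,0,0,-25,0,24,0,-22,0,21,0,0,0,0,16,-14,0,12,-10,0,5],
   [0,0,0,-27,0,0,0,25,0,0,0,-23,0,20,0,-19,0,0,-16,14,0,0,-12,0,8,0,-4],
   [0,0,0,0,-26,0,25,0,-24,0,22,0,-21,0,0,0,0,0,0,0,-13,11,0,-9,7,-5,0],
   [0,0,27,0,0,0,0,-24,0,23,0,0,0,-18,0,17,16,-14,0,0,0,0,10,-8,0,0,3],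
   [0,0,0,26,0,-25,0,0,23,0,-20,0,19,0,0,0,0,0,13,-11,0,0,9,0,-6,4,0],
   [0,-27,0,0,0,0,0,22,0,-20,0,18,0,0,-16,-15,0,12,0,-10,0,8,0,0,0,0,-2],
   [0,0,-26,0,0,24,-23,0,0,0,18,0,-17,0,0,0,-13,11,0,0,0,0,-7,6,0,-3,0],
   [27,0,0,0,0,0,0,-21,0,19,0,-17,0,15,14,0,-12,0,10,0,-8,0,0,0,0,0,1],
   [0,26,0,0,0,-22,20,0,-18,0,0,0,15,0,13,0,0,-9,0,7,0,-6,0,0,0,2,0],
   [0,0,25,-24,23,0,0,0,0,0,-16,0,14,13,0,-11,0,0,0,0,0,0,5,-4,3,0,0],
   [-26,0,0,0,0,21,-19,0,17,0,-15,0,0,0,-11,0,9,0,-7,0,6,0,0,0,0,-1,0],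
   [0,-25,0,22,-20,0,0,0,16,0,0,-13,-12,0,0,9,0,0,0,-5,0,4,0,0,-2,0,0],
   [25,0,0,-21,19,0,0,0,-14,0,12,11,0,-9,0,0,0,0,5,0,-4,0,0,0,1,0,0],
   [0,24,-22,0,18,0,-16,0,0,13,0,0,10,0,0,-7,0,5,0,0,0,-3,0,2,0,0,0],
   [-24,0,21,0,-17,0,14,0,0,-11,-10,0,0,7,0,0,-5,0,0,0,3,0,0,-1,0,0,0],
   [0,-23,20,-18,0,16,0,-13,0,0,0,0,-8,0,0,6,0,-4,0,3,0,0,-2,0,0,0,0],
   [23,0,-19,17,0,-14,0,11,0,0,8,0,0,-6,0,0,4,0,-3,0,0,0,1,0,0,0,0],
   [22,-21,0,0,15,0,-12,0,10,9,0,-7,0,0,5,0,0,0,0,0,-2,1,0,0,0,0,0],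
   [-20,19,0,-15,0,12,0,-9,-8,0,0,6,0,0,-4,0,0,0,2,-1,0,0,0,0,0,0,0],
   [18,-17,15,0,0,-10,8,7,0,-6,0,0,0,0,3,0,-2,1,0,0,0,0,0,0,0,0,0],
   [-16,14,-12,10,-8,0,0,-5,0,4,0,-3,0,2,0,-1,0,0,0,0,0,0,0,0,0,0,0],
   [13,-11,9,-7,6,5,-4,0,3,0,-2,0,1,0,0,0,0,0,0,0,0,0,0,0,0,0,0]]"

definition triad_sign :: "nat \<Rightarrow> nat \<Rightarrow> nat \<Rightarrow> int" where
  "triad_sign a b c =
    (if a < 27 \<and> b < 27 \<and> \<bar>triad_table ! a ! b\<bar> = int c + 1 then sgn (triad_table ! a ! b) else 0)"

text \<open>A zero entry means that no weight completes the pair to sum zero. In row 0 an arrow of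
  D_5 ties each sign to a smaller column, down to the positive seed (0, 12, 26); in any other row
  the raising equation ties it to the parent row.\<close>

definition triad_table_ok :: bool where
  "triad_table_ok \<longleftrightarrow> list_all (\<lambda>a. list_all (\<lambda>b.
    (let t = triad_table ! a ! b; w = map uminus (map2 (+) (weights27 ! a) (weights27 ! b)) in
      if t = 0 then w \<notin> set weights27
      else (let c = nat (\<bar>t\<bar> - 1) in
        c < 27 \<and> weights27 ! c = w \<and>
        (if a = 0 then
           b = 12 \<and> c = 26 \<and> t > 0 \<or>
           list_ex (\<lambda>i. up i b < b \<and>
             triad_sign 0 b c = - triad_sign 0 (up i b) (down i c)) [2..<7]
         else (let i = parent_label ! a; a' = parent_node ! a in
           triad_sign a b c = - triad_sign a' (down i b) c - triad_sign a' b (down i c)))))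
    ) [0..<27]) [0..<27]"

lemma triad_table_ok: triad_table_ok
  by code_simp

lemma triad_table_entry:
  assumes "a < 27" "b < 27"
  shows "let t = triad_table ! a ! b; w = map uminus (map2 (+) (weights27 ! a) (weights27 ! b)) in
      if t = 0 then w \<notin> set weights27
      else (let c = nat (\<bar>t\<bar> - 1) in
        c < 27 \<and> weights27 ! c = w \<and>
        (if a = 0 then
           b = 12 \<and> c = 26 \<and> t > 0 \<or>
           list_ex (\<lambda>i. up i b < b \<and>
             triad_sign 0 b c = - triad_sign 0 (up i b) (down i c)) [2..<7]
         else (let i = parent_label ! a; a' = parent_node ! a in
           triad_sign a b c = - triad_sign a' (down i b) c - triad_sign a' b (down i c))))"
proof -
  have "a \<in> set [0..<27]" "b \<in> set [0..<27]" using assms by auto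
  then show ?thesis
    by (rule bspec[OF bspec[OF triad_table_ok[unfolded triad_table_ok_def list_all_iff]]])
qed

lemma triad_sign_27 [simp]: "triad_sign 27 b c = 0" "triad_sign a 27 c = 0" "triad_sign a b 27 = 0"
proof -
  show "triad_sign a b 27 = 0"
    using triad_table_entry[of a b] by (auto simp: triad_sign_def Let_def split: if_splits)
qed (simp_all add: triad_sign_def)

lemma weights27_form_nth: "k < 27 \<Longrightarrow> length (weights27 ! k) = 7 \<and> weights27 ! k ! 0 = 0"
  by (intro weights27_form) (simp add: length_weights27)

text \<open>Weight zero leaves at most one \<open>c\<close> for each pair (a, b), and the raising
  equations reduce all these components to the one at (0, 12, 26). The signs of the table obey the
  same recursion.\<close>

lemma raise_killed_weight_zero:
  assumes z: "raise_killed z"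
    and wt: "\<And>a b c i. a < 27 \<Longrightarrow> b < 27 \<Longrightarrow> c < 27 \<Longrightarrow> i \<in> {1..6} \<Longrightarrow>
      of_int (weights27 ! a ! i + weights27 ! b ! i + weights27 ! c ! i) * z a b c = 0"
    and abc: "a < 27" "b < 27" "c < 27"
  shows "z a b c = z 0 12 26 * of_int (triad_sign a b c)"
proof -
  have z27: "z a b c = 0" if "a = 27 \<or> b = 27 \<or> c = 27" for a b c
    using z that unfolding raise_killed_def by blast
  have eq: "z (down i a) b c + z a (down i b) c + z a b (down i c) = 0"
    if "i \<in> {1..6}" "a < 27" "b < 27" "c < 27" for i a b c
    using z that unfolding raise_killed_def by blast
  have mem: "i \<in> {1..6}" if "i \<in> set [2..<7]" for i :: nat
    using that by auto
  have l0: "down i 0 = 27" if "i \<in> set [2..<7]" for i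
    by (rule bspec[OF top_positions_ok[unfolded top_positions_ok_def list_all_iff, THEN conjunct2, THEN conjunct2, THEN conjunct1] that])
  have neg: "x = - y - w" if "x + y + w = 0" for x y w :: complex
  proof -
    have "y + w + x = 0" using that by (simp add: ac_simps)
    then have "- (y + w) = x" by (rule minus_unique)
    then show ?thesis by (simp only: minus_add_distrib diff_conv_add_uminus)
  qed
  have wsum: "weights27 ! c = map uminus (map2 (+) (weights27 ! a) (weights27 ! b))"
    if "z a b c \<noteq> 0" "a < 27" "b < 27" "c < 27" for a b c
  proof (rule ccontr)
    assume ne: "weights27 ! c \<noteq> map uminus (map2 (+) (weights27 ! a) (weights27 ! b))"
    have "length (map uminus (map2 (+) (weights27 ! a) (weights27 ! b))) = 7 \<and>
        map uminus (map2 (+) (weights27 ! a) (weights27 ! b)) ! 0 = 0"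
      using weights27_form_nth[OF that(2)] weights27_form_nth[OF that(3)] by simp
    from weight_lists_differ[OF weights27_form_nth[OF that(4)] this ne]
    obtain i where i: "i \<in> {1..6}" "weights27 ! c ! i \<noteq> map uminus (map2 (+) (weights27 ! a) (weights27 ! b)) ! i"
      by blast
    then have "weights27 ! a ! i + weights27 ! b ! i + weights27 ! c ! i \<noteq> 0"
      using weights27_form_nth[of a] weights27_form_nth[of b] that by auto
    then show False
      using wt[OF that(2-4) i(1)] that(1) unfolding mult_eq_0_iff of_int_eq_0_iff by blast
  qed
  \<comment> \<open>Off the triples of weight zero both sides vanish, so the inductions only have to
    treat the one \<open>c\<close> named by the table.\<close>
  have reduce: "z a b c = z 0 12 26 * of_int (triad_sign a b c)"
    if ab: "a < 27" "b < 27" "c \<le> 27"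
      and main: "triad_table ! a ! b \<noteq> 0 \<Longrightarrow> c = nat (\<bar>triad_table ! a ! b\<bar> - 1) \<Longrightarrow> c < 27 \<Longrightarrow>
        z a b c = z 0 12 26 * of_int (triad_sign a b c)" for a b c
  proof (cases "c = 27")
    case True
    then show ?thesis using z27[of a b 27] by simp
  next
    case False
    then have c: "c < 27" using ab by simp
    show ?thesis
    proof (cases "triad_table ! a ! b \<noteq> 0 \<and> c = nat (\<bar>triad_table ! a ! b\<bar> - 1)")
      case True
      then show ?thesis using main c by blast
    next
      case no: False
      have "triad_sign a b c = 0"
        using no by (auto simp: triad_sign_def)
      moreover have "z a b c = 0"
      proof (rule ccontr)
        assume "z a b c \<noteq> 0"
        then have w: "weights27 ! c = map uminus (map2 (+) (weights27 ! a) (weights27 ! b))"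
          using wsum ab c by blast
        have cm: "weights27 ! c \<in> set weights27" using c by (simp add: length_weights27)
        show False
        proof (cases "triad_table ! a ! b = 0")
          case True
          then show False using triad_table_entry[OF ab(1,2)] cm w by (simp add: Let_def)
        next
          case False
          define e where "e = nat (\<bar>triad_table ! a ! b\<bar> - 1)"
          have "e < 27 \<and> weights27 ! e = weights27 ! c"
            using triad_table_entry[OF ab(1,2)] False unfolding Let_def e_def w by (simp only: if_False)
          then have "e = c"
            using nth_eq_iff_index_eq[OF distinct_weights27] c by (auto simp: length_weights27)
          then show False using no False e_def by simp
        qed
      qed
      ultimately show ?thesis by simp
    qed
  qed
  have B: "z 0 b c = z 0 12 26 * of_int (triad_sign 0 b c)" if "b \<le> 27" "c \<le> 27" for b c
    using that
  proof (induction b arbitrary: c rule: less_induct)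
    case (less b)
    show ?case
    proof (cases "b = 27")
      case True
      then show ?thesis using z27[of 0 27 c] by simp
    next
      case False
      then have b: "b < 27" using less.prems by simp
      show ?thesis
      proof (rule reduce)
        assume c: "triad_table ! 0 ! b \<noteq> 0" "c = nat (\<bar>triad_table ! 0 ! b\<bar> - 1)" "c < 27"
        have "b = 12 \<and> c = 26 \<and> triad_table ! 0 ! b > 0 \<or>
           (\<exists>i\<in>set [2..<7]. up i b < b \<and>
             triad_sign 0 b c = - triad_sign 0 (up i b) (down i c))"
          using triad_table_entry[of 0 b] b c(1) unfolding Let_def c(2)[symmetric] list_ex_iff by simp
        then show "z 0 b c = z 0 12 26 * of_int (triad_sign 0 b c)"
        proof
          assume h: "b = 12 \<and> c = 26 \<and> triad_table ! 0 ! b > 0"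
          then have "triad_sign 0 b c = 1"
            using c by (auto simp: triad_sign_def)
          then show ?thesis using h by simp
        next
          assume "\<exists>i\<in>set [2..<7]. up i b < b \<and>
             triad_sign 0 b c = - triad_sign 0 (up i b) (down i c)"
          then obtain i where i: "i \<in> set [2..<7]" "up i b < b"
            "triad_sign 0 b c = - triad_sign 0 (up i b) (down i c)" by blast
          define b' where "b' = up i b"
          have b': "b' < b" "b' < 27" "down i b' = b"
            using raise_table_some[OF mem[OF i(1)] b refl] i(2) b by (auto simp: b'_def)
          have "z 0 b' (down i c) = z 0 12 26 * of_int (triad_sign 0 b' (down i c))"
            using b' lower_table_le[OF mem[OF i(1)] c(3)] by (intro less.IH) auto
          moreover have "z 0 b c + z 0 b' (down i c) = 0"
            using eq[OF mem[OF i(1)] _ b'(2) c(3), of 0] z27[of 27 b' c] unfolding b'(3) l0[OF i(1)] by simp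
          then have "z 0 b c = - z 0 b' (down i c)" by (rule eq_neg_iff_add_eq_0[THEN iffD2])
          ultimately show ?thesis using i(3) by (simp add: b'_def)
        qed
      qed (use b less.prems in simp_all)
    qed
  qed
  have "z a b c = z 0 12 26 * of_int (triad_sign a b c)" if "a < 27" "b \<le> 27" "c \<le> 27" for a b c
    using that
  proof (induction a arbitrary: b c rule: less_induct)
    case (less a)
    show ?case
    proof (cases "b = 27 \<or> a = 0")
      case True
      then show ?thesis
      proof
        assume "b = 27"
        then show ?thesis using z27[of a 27 c] by simp
      next
        assume "a = 0"
        then show ?thesis using B[OF less.prems(2,3)] by (simp only:)
      qed
    next
      case False
      then have b: "b < 27" and a0: "0 < a" using less.prems by auto
      show ?thesis
      proof (rule reduce)
        assume c: "triad_table ! a ! b \<noteq> 0" "c = nat (\<bar>triad_table ! a ! b\<bar> - 1)" "c < 27"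
        define i a' where "i = parent_label ! a" and "a' = parent_node ! a"
        have p: "i \<in> {1..6}" "a' < a" "down i a' = a"
          using parent_props[of a] a0 less.prems by (auto simp: i_def a'_def)
        have t: "triad_sign a b c = - triad_sign a' (down i b) c - triad_sign a' b (down i c)"
          using triad_table_entry[OF less.prems(1) b] c(1) a0
          unfolding Let_def c(2)[symmetric] i_def a'_def by simp
        have "z a b c + z a' (down i b) c + z a' b (down i c) = 0"
          using eq[OF p(1) order.strict_trans[OF p(2) less.prems(1)] b c(3)] unfolding p(3) .
        then have 1: "z a b c = - z a' (down i b) c - z a' b (down i c)"
          by (rule neg)
        have 2: "z a' (down i b) c = z 0 12 26 * of_int (triad_sign a' (down i b) c)"
          using lower_table_le[OF p(1) b] c(3) p(2) less.prems(1) by (intro less.IH[OF p(2)]) auto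
        have 3: "z a' b (down i c) = z 0 12 26 * of_int (triad_sign a' b (down i c))"
          using lower_table_le[OF p(1) c(3)] b p(2) less.prems(1) by (intro less.IH[OF p(2)]) auto
        show "z a b c = z 0 12 26 * of_int (triad_sign a b c)"
          unfolding 1 2 3 t by (simp only: of_int_diff of_int_minus right_diff_distrib mult_minus_right)
      qed (use b less.prems in simp_all)
    qed
  qed
  from this[OF abc(1) less_imp_le[OF abc(2)] less_imp_le[OF abc(3)]] show ?thesis .
qed


section \<open>Operators commuting with the minuscule representation\<close>

text \<open>\<open>ix\<close> numbers the index type by the nodes of the weight diagram. Requiring
  \<open>L\<close> merely to contain the matrices of the generators lets the results apply to the
  conjugated image of the whole Lie algebra.\<close>

locale minuscule_model =
  fixes ix :: "27 \<Rightarrow> nat" and L :: "(complex^27^27) set"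
  assumes ix: "bij_betw ix UNIV {..<27}"
    and F_in: "i \<in> {1..6} \<Longrightarrow> (\<chi> a b. if ix a = down i (ix b) then 1 else 0) \<in> L"
    and E_in: "i \<in> {1..6} \<Longrightarrow> (\<chi> a b. if ix a = up i (ix b) then 1 else 0) \<in> L"
    and H_in: "i \<in> {1..6} \<Longrightarrow> (\<chi> a b. if a = b then of_int (weights27 ! ix a ! i) else 0) \<in> L"
begin

definition xi :: "nat \<Rightarrow> 27" where "xi = inv_into UNIV ix"

lemma ix_less: "ix a < 27"
  using ix by (auto simp: bij_betw_def)

lemma ix_xi: "k < 27 \<Longrightarrow> ix (xi k) = k"
  unfolding xi_def using ix by (intro f_inv_into_f) (auto simp: bij_betw_def)

lemma xi_ix: "xi (ix a) = a"
  unfolding xi_def using ix by (intro inv_into_f_f) (auto simp: bij_betw_def)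

lemma ix_eq_iff: "ix a = ix b \<longleftrightarrow> a = b"
  by (metis xi_ix)

definition ME where "ME i = (\<chi> a b. if ix a = up i (ix b) then 1 else (0 :: complex))"
definition MF where "MF i = (\<chi> a b. if ix a = down i (ix b) then 1 else (0 :: complex))"
definition MH where "MH i = (\<chi> a b. if a = b then of_int (weights27 ! ix a ! i) else (0 :: complex))"

lemma M_in: "i \<in> {1..6} \<Longrightarrow> ME i \<in> L" "i \<in> {1..6} \<Longrightarrow> MF i \<in> L" "i \<in> {1..6} \<Longrightarrow> MH i \<in> L"
  unfolding ME_def MF_def MH_def by (rule E_in F_in H_in, assumption)+

lemma ME_entry:
  assumes "i \<in> {1..6}"
  shows "ix a = up i (ix b) \<longleftrightarrow> ix b = down i (ix a)"
  using lower_table_some(2)[OF assms ix_less[of a] refl] raise_table_some(2)[OF assms ix_less[of b] refl]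
    ix_less[of a] ix_less[of b] by (metis less_irrefl)

lemma transpose_M: "i \<in> {1..6} \<Longrightarrow> transpose (MF i) = ME i" "transpose (MH i) = MH i"
  by (auto simp: transpose_def MF_def ME_def MH_def vec_eq_iff ME_entry simp del: atLeastAtMost_iff)

definition comp :: "complex^(27 \<times> 27 \<times> 27) \<Rightarrow> nat \<Rightarrow> nat \<Rightarrow> nat \<Rightarrow> complex" where
  "comp w a b c = (if a < 27 \<and> b < 27 \<and> c < 27 then w $ (xi a, xi b, xi c) else 0)"

lemma comp_ix: "comp w (ix a) (ix b) (ix c) = w $ (a, b, c)"
  by (simp add: comp_def ix_less xi_ix)

lemma sum_ME:
  assumes "i \<in> {1..6}"
  shows "(\<Sum>e\<in>UNIV. ME i $ a $ e * g e) = (if down i (ix a) = 27 then 0 else g (xi (down i (ix a))))"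
proof (cases "down i (ix a) = 27")
  case True
  then have "ME i $ a $ e = 0" for e
    using ix_less[of e] by (auto simp: ME_def ME_entry[OF assms])
  then show ?thesis using True by simp
next
  case False
  then have l: "down i (ix a) < 27"
    using lower_table_le[OF assms ix_less[of a]] by simp
  have "ME i $ a $ e * g e = (if e = xi (down i (ix a)) then g e else 0)" for e
    using ix_xi[OF l] xi_ix[of e] by (auto simp: ME_def ME_entry[OF assms])
  then show ?thesis using False by simp
qed

lemma act3_ME:
  assumes i: "i \<in> {1..6}"
  shows "(act3 (ME i) *v w) $ (a, b, c) =
    comp w (down i (ix a)) (ix b) (ix c) + comp w (ix a) (down i (ix b)) (ix c)
      + comp w (ix a) (ix b) (down i (ix c))"
proof -
  have le: "down i (ix p) \<noteq> 27 \<Longrightarrow> down i (ix p) < 27" for p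
    using lower_table_le[OF i ix_less[of p]] by simp
  show ?thesis
    unfolding act3_vec sum.distrib sum_ME[OF i] by (auto simp: comp_def ix_less xi_ix dest: le)
qed

lemma raise_killed_comp:
  "(\<forall>i\<in>{1..6}. act3 (ME i) *v w = 0) \<longleftrightarrow> raise_killed (comp w)"
proof -
  have "act3 (ME i) *v w = 0 \<longleftrightarrow> (\<forall>a<27. \<forall>b<27. \<forall>c<27.
      comp w (down i a) b c + comp w a (down i b) c + comp w a b (down i c) = 0)"
    (is "_ \<longleftrightarrow> ?R") if i: "i \<in> {1..6}" for i
  proof
    assume h: "act3 (ME i) *v w = 0"
    show ?R
    proof (intro allI impI)
      fix a b c :: nat assume abc: "a < 27" "b < 27" "c < 27"
      have "(act3 (ME i) *v w) $ (xi a, xi b, xi c) = 0"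
        unfolding h by simp
      then show "comp w (down i a) b c + comp w a (down i b) c + comp w a b (down i c) = 0"
        unfolding act3_ME[OF i] ix_xi[OF abc(1)] ix_xi[OF abc(2)] ix_xi[OF abc(3)] .
    qed
  next
    assume R: ?R
    have "(act3 (ME i) *v w) $ (a, b, c) = 0" for a b c
      unfolding act3_ME[OF i] by (rule R[rule_format, OF ix_less ix_less ix_less])
    then show "act3 (ME i) *v w = 0" by (simp add: vec_eq_iff)
  qed
  note iff = this
  have "\<forall>a b c. a = 27 \<or> b = 27 \<or> c = 27 \<longrightarrow> comp w a b c = 0"
    by (auto simp: comp_def)
  moreover have "(\<forall>i\<in>{1..6}. act3 (ME i) *v w = 0) \<longleftrightarrow> (\<forall>i\<in>{1..6}. \<forall>a<27. \<forall>b<27. \<forall>c<27.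
      comp w (down i a) b c + comp w a (down i b) c + comp w a b (down i c) = 0)"
    by (rule ball_cong[OF refl iff])
  ultimately show ?thesis
    unfolding raise_killed_def by argo
qed

lemma act3_MH:
  "(act3 (MH i) *v w) $ (a, b, c) =
    of_int (weights27 ! ix a ! i + weights27 ! ix b ! i + weights27 ! ix c ! i) * w $ (a, b, c)"
  by (simp add: act3_vec MH_def sum.distrib if_distrib[of "\<lambda>x. x * _"] distrib_right cong: if_cong)

lemma invariant_vector:
  assumes E: "\<And>i. i \<in> {1..6} \<Longrightarrow> act3 (ME i) *v w = 0" and H: "\<And>i. i \<in> {1..6} \<Longrightarrow> act3 (MH i) *v w = 0"
  shows "w $ (a, b, c) = comp w 0 12 26 * of_int (triad_sign (ix a) (ix b) (ix c))"
proof -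
  have "raise_killed (comp w)" using E raise_killed_comp by blast
  moreover have "of_int (weights27 ! a ! i + weights27 ! b ! i + weights27 ! c ! i) * comp w a b c = 0"
    if "a < 27" "b < 27" "c < 27" "i \<in> {1..6}" for a b c i
  proof -
    have "(act3 (MH i) *v w) $ (xi a, xi b, xi c) = 0" using H[OF that(4)] by simp
    then show ?thesis unfolding act3_MH using that by (simp add: comp_def ix_xi)
  qed
  ultimately have "comp w (ix a) (ix b) (ix c) = comp w 0 12 26 * of_int (triad_sign (ix a) (ix b) (ix c))"
    by (rule raise_killed_weight_zero) (assumption | rule ix_less)+
  then show ?thesis by (simp only: comp_ix)
qed

lemma invariant_upper_vector:
  assumes "\<And>A. A \<in> L \<Longrightarrow> act3 A *v vec3 u = 0"
  shows "u a b c = comp (vec3 u) 0 12 26 * of_int (triad_sign (ix a) (ix b) (ix c))"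
  using invariant_vector[of "vec3 u" a b c] assms M_in by simp

text \<open>Lower invariance under \<open>A\<close> is upper invariance under its transpose.
  Transposition turns F_i into E_i and fixes H_i, so the same sign table describes both
  tensors.\<close>

lemma invariant_lower_vector:
  assumes "\<And>A. A \<in> L \<Longrightarrow> vec3 d v* act3 A = 0"
  shows "d a b c = comp (vec3 d) 0 12 26 * of_int (triad_sign (ix a) (ix b) (ix c))"
proof -
  have covec: "w v* act3 A = act3 (transpose A) *v w" for w and A :: "complex^27^27"
    by (simp flip: transpose_act3)
  have "act3 (ME i) *v vec3 d = 0" "act3 (MH i) *v vec3 d = 0" if "i \<in> {1..6}" for i
    using assms[OF M_in(2)[OF that]] assms[OF M_in(3)[OF that]] unfolding covec transpose_M(2) transpose_M(1)[OF that]
    by auto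
  then show ?thesis using invariant_vector[of "vec3 d" a b c] by simp
qed

end

section \<open>Weights of triples of nodes, and adjoint matrices\<close>

definition triple_weight :: "nat \<Rightarrow> nat \<Rightarrow> nat \<Rightarrow> int list" where
  "triple_weight a b c = map2 (+) (weights27 ! a) (map2 (+) (weights27 ! b) (weights27 ! c))"

lemma triple_weight_form:
  assumes "a < 27" "b < 27" "c < 27"
  shows "length (triple_weight a b c) = 7 \<and> triple_weight a b c ! 0 = 0"
    and "i < 7 \<Longrightarrow> triple_weight a b c ! i = weights27 ! a ! i + weights27 ! b ! i + weights27 ! c ! i"
  using weights27_form_nth[OF assms(1)] weights27_form_nth[OF assms(2)] weights27_form_nth[OF assms(3)]
  by (simp_all add: triple_weight_def)

lemma triple_weight_lower:
  assumes i: "i \<in> {1..6}" and abc: "a < 27" "b < 27" "c < 27"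
  shows "down i a \<noteq> 27 \<Longrightarrow> triple_weight (down i a) b c = map2 (-) (triple_weight a b c) (e6_roots ! i)"
    and "down i b \<noteq> 27 \<Longrightarrow> triple_weight a (down i b) c = map2 (-) (triple_weight a b c) (e6_roots ! i)"
    and "down i c \<noteq> 27 \<Longrightarrow> triple_weight a b (down i c) = map2 (-) (triple_weight a b c) (e6_roots ! i)"
proof -
  have l: "down i k < 27 \<and> (\<forall>j<7. weights27 ! (down i k) ! j = weights27 ! k ! j - e6_roots ! i ! j)"
    if "down i k \<noteq> 27" "k < 27" for k
    using lower_table_some(1,6)[OF i that(2) refl that(1)] weights27_form_nth[OF that(2)] e6_roots_form[OF i] by simp
  show "down i a \<noteq> 27 \<Longrightarrow> triple_weight (down i a) b c = map2 (-) (triple_weight a b c) (e6_roots ! i)"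
    using l[of a] abc triple_weight_form[of "down i a" b c] triple_weight_form[of a b c] e6_roots_form[OF i]
    by (intro nth_equalityI) simp_all
  show "down i b \<noteq> 27 \<Longrightarrow> triple_weight a (down i b) c = map2 (-) (triple_weight a b c) (e6_roots ! i)"
    using l[of b] abc triple_weight_form[of a "down i b" c] triple_weight_form[of a b c] e6_roots_form[OF i]
    by (intro nth_equalityI) simp_all
  show "down i c \<noteq> 27 \<Longrightarrow> triple_weight a b (down i c) = map2 (-) (triple_weight a b c) (e6_roots ! i)"
    using l[of c] abc triple_weight_form[of a b "down i c"] triple_weight_form[of a b c] e6_roots_form[OF i]
    by (intro nth_equalityI) simp_all
qed

definition position_weight :: "nat \<Rightarrow> int list" where
  "position_weight j = triple_weight 0 (fst (top_positions ! j)) (snd (top_positions ! j))"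

text \<open>Ordered pairs of positions of equal weight are counted, which amounts to summing the
  squares of the multiplicities.\<close>

lemma position_weight_pairs:
  "(\<Sum>j<10. card {k. k < 10 \<and> position_weight k = position_weight j}) = 20"
proof -
  have "sum_list (map (\<lambda>j. length (filter (\<lambda>k. position_weight k = position_weight j) [0..<10])) [0..<10]) = 20"
    by code_simp
  moreover have "length (filter (\<lambda>k. position_weight k = position_weight j) [0..<10]) =
      card {k. k < 10 \<and> position_weight k = position_weight j}" for j
    by (subst distinct_length_filter) (auto intro!: arg_cong[of _ _ card])
  ultimately show ?thesis
    by (simp add: interv_sum_list_conv_sum_set_nat atLeast0LessThan)
qed

lemma top_positions_less: "j < 10 \<Longrightarrow> fst (top_positions ! j) < 27 \<and> snd (top_positions ! j) < 27"
proof -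
  assume "j < 10"
  then have "top_positions ! j \<in> set top_positions" by (intro nth_mem) (simp add: top_positions_def)
  then show ?thesis by (auto simp: top_positions_def)
qed

definition dag :: "complex^'n^'m \<Rightarrow> complex^'m^'n" where
  "dag A = (\<chi> i j. cnj (A $ j $ i))"

lemma dag_mult: "dag (A ** B) = dag B ** dag A"
  by (simp add: dag_def matrix_matrix_mult_def vec_eq_iff mult.commute)

lemma dag_act3: "dag (act3 A) = act3 (dag A)"
  by (auto simp: dag_def vec_eq_iff act3_nth)

text \<open>The squared norm of w = \<open>dag X *v y\<close> is the Hermitian product of y and X w,
  which is zero.\<close>

lemma dag_kernel:
  assumes "X *v (dag X *v y) = 0"
  shows "dag X *v y = 0"
proof -
  define w where "w = dag X *v y"
  have "(\<Sum>p\<in>UNIV. cnj (w $ p) * w $ p) = (\<Sum>p\<in>UNIV. \<Sum>q\<in>UNIV. cnj (y $ q) * (X $ q $ p * w $ p))"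
    by (simp add: w_def matrix_vector_mult_def dag_def sum_distrib_right sum_distrib_left ac_simps)
  also have "\<dots> = (\<Sum>q\<in>UNIV. \<Sum>p\<in>UNIV. cnj (y $ q) * (X $ q $ p * w $ p))"
    by (rule sum.swap)
  also have "\<dots> = (\<Sum>q\<in>UNIV. cnj (y $ q) * (X *v w) $ q)"
    by (simp add: matrix_vector_mult_def sum_distrib_left)
  also have "\<dots> = 0" using assms by (simp add: w_def)
  finally have "(\<Sum>p\<in>UNIV. of_real ((norm (w $ p))\<^sup>2) :: complex) = 0"
    unfolding complex_norm_square by (simp only: mult.commute)
  then have "(\<Sum>p\<in>UNIV. (norm (w $ p))\<^sup>2) = 0"
    unfolding of_real_sum[symmetric] of_real_eq_0_iff .
  then have "\<forall>p. w $ p = 0"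
    by (subst (asm) sum_nonneg_eq_0_iff) auto
  then show ?thesis by (simp add: vec_eq_iff w_def)
qed

section \<open>Weight decomposition of the killed vectors and the bound 20\<close>

context minuscule_model
begin

definition wt3 :: "27 \<times> 27 \<times> 27 \<Rightarrow> int list" where
  "wt3 p = triple_weight (ix (fst p)) (ix (fst (snd p))) (ix (snd (snd p)))"

definition weight_part :: "(int list \<Rightarrow> bool) \<Rightarrow> complex^(27 \<times> 27 \<times> 27) \<Rightarrow> complex^(27 \<times> 27 \<times> 27)" where
  "weight_part P w = (\<chi> p. if P (wt3 p) then w $ p else 0)"

definition killed :: "complex^(27 \<times> 27 \<times> 27) \<Rightarrow> bool" where
  "killed w \<longleftrightarrow> (\<forall>i\<in>{1..6}. act3 (ME i) *v w = 0)"

lemma comp_weight_part: "comp (weight_part P w) a b c = (if P (triple_weight a b c) then comp w a b c else 0)"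
  by (simp add: comp_def weight_part_def wt3_def ix_xi)

text \<open>The terms of the raising equation at (a, b, c) are components of one common weight, that
  of (a, b, c) minus the simple root, so the equations hold in each weight separately.\<close>

lemma killed_weight_part:
  assumes "killed w"
  shows "killed (weight_part P w)"
proof -
  have w: "raise_killed (comp w)"
    using assms by (simp only: killed_def raise_killed_comp)
  have z27: "comp w a b c = 0" if "a = 27 \<or> b = 27 \<or> c = 27" for a b c
    using w that unfolding raise_killed_def by blast
  have "comp (weight_part P w) (down i a) b c + comp (weight_part P w) a (down i b) c
      + comp (weight_part P w) a b (down i c) = 0"
    if i: "i \<in> {1..6}" and abc: "a < 27" "b < 27" "c < 27" for i a b c
  proof -
    let ?P = "P (map2 (-) (triple_weight a b c) (e6_roots ! i))"
    have 1: "comp (weight_part P w) (down i a) b c = (if ?P then comp w (down i a) b c else 0)"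
      using triple_weight_lower(1)[OF i abc] z27[of 27 b c]
      by (cases "down i a = 27") (simp_all only: comp_weight_part simp_thms if_cancel)
    have 2: "comp (weight_part P w) a (down i b) c = (if ?P then comp w a (down i b) c else 0)"
      using triple_weight_lower(2)[OF i abc] z27[of a 27 c]
      by (cases "down i b = 27") (simp_all only: comp_weight_part simp_thms if_cancel)
    have 3: "comp (weight_part P w) a b (down i c) = (if ?P then comp w a b (down i c) else 0)"
      using triple_weight_lower(3)[OF i abc] z27[of a b 27]
      by (cases "down i c = 27") (simp_all only: comp_weight_part simp_thms if_cancel)
    have "comp w (down i a) b c + comp w a (down i b) c + comp w a b (down i c) = 0"
      using w i abc unfolding raise_killed_def by blast
    then show ?thesis unfolding 1 2 3 by (cases ?P) simp_all
  qed
  moreover have "comp (weight_part P w) a b c = 0" if "a = 27 \<or> b = 27 \<or> c = 27" for a b c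
    unfolding comp_weight_part using z27[OF that] by simp
  ultimately have "raise_killed (comp (weight_part P w))"
    unfolding raise_killed_def by blast
  then show ?thesis by (simp only: killed_def raise_killed_comp)
qed

definition pos :: "nat \<Rightarrow> 27 \<times> 27 \<times> 27" where
  "pos j = (xi 0, xi (fst (top_positions ! j)), xi (snd (top_positions ! j)))"

lemma wt3_pos: "j < 10 \<Longrightarrow> wt3 (pos j) = position_weight j"
  using top_positions_less[of j] by (simp add: wt3_def pos_def position_weight_def ix_xi)

lemma killed_eq_0:
  assumes "killed w" "\<And>j. j < 10 \<Longrightarrow> w $ pos j = 0"
  shows "w = 0"
proof -
  have "raise_killed (comp w)"
    using assms(1) by (simp only: killed_def raise_killed_comp)
  moreover have "comp w 0 b c = 0" if bc: "(b, c) \<in> set top_positions" for b c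
  proof -
    obtain j where "j < 10" "top_positions ! j = (b, c)"
    proof -
      have "length top_positions = 10" by (simp add: top_positions_def)
      then show ?thesis using bc that unfolding in_set_conv_nth by auto
    qed
    then show ?thesis using assms(2)[of j] by (simp add: comp_def pos_def)
  qed
  ultimately have "comp w (ix a) (ix b) (ix c) = 0" for a b c
    by (rule raise_killed_eq_0) (assumption | rule ix_less)+
  then show ?thesis by (simp add: vec_eq_iff comp_ix)
qed

text \<open>The raising operators strictly decrease the sum of the three indices, so a vector of an
  invariant subspace with support as low as possible is killed by them.\<close>

lemma killed_vector_exists:
  assumes U: "\<And>v i. v \<in> U \<Longrightarrow> i \<in> {1..6} \<Longrightarrow> act3 (ME i) *v v \<in> U" and v: "v \<in> U" "v \<noteq> 0"
  shows "\<exists>w\<in>U. w \<noteq> 0 \<and> killed w"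
proof -
  define h where "h p = ix (fst p) + ix (fst (snd p)) + ix (snd (snd p))" for p :: "27 \<times> 27 \<times> 27"
  define Q where "Q n \<longleftrightarrow> (\<exists>w\<in>U. w \<noteq> 0 \<and> (\<forall>p. w $ p \<noteq> 0 \<longrightarrow> h p < n))" for n
  have "h p < 81" for p
    using ix_less[of "fst p"] ix_less[of "fst (snd p)"] ix_less[of "snd (snd p)"] by (simp add: h_def)
  then have "Q 81" using v by (auto simp: Q_def)
  then have "Q (LEAST n. Q n)" by (rule LeastI)
  then obtain n where n: "Q n" "\<And>m. Q m \<Longrightarrow> n \<le> m"
    by (metis Least_le)
  then obtain w where w: "w \<in> U" "w \<noteq> 0" "\<And>p. w $ p \<noteq> 0 \<Longrightarrow> h p < n"
    unfolding Q_def by blast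
  have "act3 (ME i) *v w = 0" if i: "i \<in> {1..6}" for i
  proof (rule ccontr)
    assume ne: "act3 (ME i) *v w \<noteq> 0"
    have low: "comp w a b c = 0 \<or> a + b + c < n" for a b c
      using w(3)[of "(xi a, xi b, xi c)"]
      by (cases "w $ (xi a, xi b, xi c) = 0") (auto simp: comp_def h_def ix_xi)
    have less: "down i k = 27 \<or> k < down i k" if "k < 27" for k
      using lower_table_some(5)[OF i that refl] by blast
    have z27: "comp w a b c = 0" if "a = 27 \<or> b = 27 \<or> c = 27" for a b c
      using that by (auto simp: comp_def)
    have "h p < n - 1" if "(act3 (ME i) *v w) $ p \<noteq> 0" for p
    proof -
      obtain a b c where p: "p = (a, b, c)" by (cases p)
      have "comp w (down i (ix a)) (ix b) (ix c) \<noteq> 0 \<or> comp w (ix a) (down i (ix b)) (ix c) \<noteq> 0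
          \<or> comp w (ix a) (ix b) (down i (ix c)) \<noteq> 0"
        using that unfolding p act3_ME[OF i] by auto
      then have "ix a + ix b + ix c < n - 1"
        using low[of "down i (ix a)" "ix b" "ix c"] low[of "ix a" "down i (ix b)" "ix c"]
          low[of "ix a" "ix b" "down i (ix c)"] less[OF ix_less[of a]] less[OF ix_less[of b]]
          less[OF ix_less[of c]] z27[of 27 "ix b" "ix c"] z27[of "ix a" 27 "ix c"] z27[of "ix a" "ix b" 27]
        by (elim disjE) auto
      then show ?thesis by (simp add: p h_def)
    qed
    then have "Q (n - 1)"
      unfolding Q_def using ne U[OF w(1) i] by blast
    moreover have "n \<noteq> 0"
    proof
      assume "n = 0"
      then have "\<forall>p. w $ p = 0" using w(3) by auto
      then show False using w(2) by (simp add: vec_eq_iff)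
    qed
    ultimately show False using n(2)[of "n - 1"] by simp
  qed
  then show ?thesis using w by (auto simp: killed_def)
qed

lemma commutes: "X \<in> End3 L \<Longrightarrow> A \<in> L \<Longrightarrow> X *v (act3 A *v w) = act3 A *v (X *v w)"
  by (simp add: End3_def matrix_vector_mul_assoc)

text \<open>If X is nonzero, the range of its adjoint, being stable under the E_i, contains a
  nonzero killed vector w. Then X w = 0, and \<open>dag_kernel\<close> gives w = 0.\<close>

lemma End3_eq_0:
  assumes X: "X \<in> End3 L" and kill: "\<And>w. killed w \<Longrightarrow> X *v w = 0"
  shows "X = 0"
proof (rule ccontr)
  assume "X \<noteq> 0"
  then obtain p q where "X $ p $ q \<noteq> 0" by (auto simp: vec_eq_iff)
  then have "(dag X *v axis p 1) $ q \<noteq> 0"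
    by (simp add: matrix_vector_mult_def axis_def dag_def if_distrib[of "\<lambda>x. _ * x"] cong: if_cong)
  then have ne: "dag X *v axis p 1 \<noteq> 0" by (metis zero_index)
  \<comment> \<open>E_i is the adjoint of F_i, so taking adjoints turns commutation of X with F_i
    into commutation of \<open>dag X\<close> with E_i.\<close>
  have inv: "act3 (ME i) *v (dag X *v y) = dag X *v (act3 (ME i) *v y)" if i: "i \<in> {1..6}" for i y
  proof -
    have "dag (MF i) = ME i"
      using ME_entry[OF i] by (auto simp: dag_def MF_def ME_def vec_eq_iff)
    then have "act3 (ME i) ** dag X = dag (X ** act3 (MF i))"
      by (simp add: dag_mult dag_act3)
    also have "X ** act3 (MF i) = act3 (MF i) ** X"
      using X M_in(2)[OF i] by (simp add: End3_def)
    also have "dag \<dots> = dag X ** act3 (ME i)"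
      using \<open>dag (MF i) = ME i\<close> by (simp add: dag_mult dag_act3)
    finally show ?thesis by (simp add: matrix_vector_mul_assoc)
  qed
  obtain w where "w \<in> range ((*v) (dag X))" "w \<noteq> 0" "killed w"
    using killed_vector_exists[of "range ((*v) (dag X))" "dag X *v axis p 1"] inv ne by auto
  then show False using kill[of w] dag_kernel[of X] by auto
qed

definition killed_weight_space :: "int list \<Rightarrow> (complex^(27 \<times> 27 \<times> 27)) set" where
  "killed_weight_space \<mu> = {w. killed w \<and> (\<forall>p. wt3 p \<noteq> \<mu> \<longrightarrow> w $ p = 0)}"

lemma killed_weight_space_zero: "w \<in> killed_weight_space \<mu> \<Longrightarrow> wt3 p \<noteq> \<mu> \<Longrightarrow> w $ p = 0"
  unfolding killed_weight_space_def by blast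

lemma killed_weight_space_basis:
  "\<exists>B. B \<subseteq> killed_weight_space \<mu> \<and> finite B \<and> killed_weight_space \<mu> \<subseteq> vec.span B \<and>
    card B \<le> card {k. k < 10 \<and> position_weight k = \<mu>}"
proof -
  have sub: "vec.subspace (killed_weight_space \<mu>)"
    by (auto simp: vec.subspace_def killed_weight_space_def killed_def vec.add vec.scale)
  have "\<exists>B. B \<subseteq> killed_weight_space \<mu> \<and> finite B \<and> vec.independent B \<and> killed_weight_space \<mu> \<subseteq> vec.span B \<and>
    card B \<le> card {k. k < 10 \<and> position_weight k = \<mu>}"
  proof (rule vec.basis_of_separating_functionals[OF sub, where \<phi> = "\<lambda>k w. w $ pos k"])
    fix w assume w: "w \<in> killed_weight_space \<mu>"
      and z: "\<And>k. k \<in> {k. k < 10 \<and> position_weight k = \<mu>} \<Longrightarrow> w $ pos k = 0"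
    show "w = 0"
    proof (rule killed_eq_0)
      show "killed w" using w by (simp add: killed_weight_space_def)
      fix j :: nat assume "j < 10"
      then show "w $ pos j = 0"
        using killed_weight_space_zero[OF w, of "pos j"] z[of j] wt3_pos[of j]
        by (cases "position_weight j = \<mu>") simp_all
    qed
  qed simp_all
  then show ?thesis by blast
qed

lemma End3_killed_weight_space:
  assumes X: "X \<in> End3 L" and w: "w \<in> killed_weight_space \<mu>" and \<mu>: "length \<mu> = 7 \<and> \<mu> ! 0 = 0"
  shows "X *v w \<in> killed_weight_space \<mu>"
proof -
  have "killed (X *v w)"
    using w commutes[OF X M_in(1), symmetric] by (simp add: killed_weight_space_def killed_def del: atLeastAtMost_iff)
  moreover have "(X *v w) $ p = 0" if p: "wt3 p \<noteq> \<mu>" for p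
  proof -
    obtain a b c where abc: "p = (a, b, c)" by (cases p)
    have f: "length (wt3 q) = 7 \<and> wt3 q ! 0 = 0" for q
      unfolding wt3_def by (rule triple_weight_form(1)[OF ix_less ix_less ix_less])
    obtain i where i: "i \<in> {1..6}" "wt3 p ! i \<noteq> \<mu> ! i"
      using weight_lists_differ[OF f \<mu> p] by blast
    have H: "(act3 (MH i) *v v) $ q = of_int (wt3 q ! i) * v $ q" for v q
      using i(1) triple_weight_form(2)[OF ix_less ix_less ix_less]
      by (cases q) (simp add: act3_MH wt3_def)
    have "(act3 (MH i) *v w) $ q = (of_int (\<mu> ! i) *s w) $ q" for q
      using killed_weight_space_zero[OF w, of q] unfolding H by (cases "wt3 q = \<mu>") simp_all
    then have "act3 (MH i) *v w = of_int (\<mu> ! i) *s w"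
      unfolding vec_eq_iff by blast
    then have "act3 (MH i) *v (X *v w) = of_int (\<mu> ! i) *s (X *v w)"
      using commutes[OF X M_in(3)[OF i(1)], of w] by (simp add: vec.scale)
    then have "of_int (wt3 p ! i) * (X *v w) $ p = of_int (\<mu> ! i) * (X *v w) $ p"
      unfolding H[symmetric] by (simp only: vector_smult_component)
    then show ?thesis using i(2) by auto
  qed
  ultimately show ?thesis unfolding killed_weight_space_def by blast
qed

text \<open>An operator of the commutant preserves the killed vectors of each weight. It is thus
  determined by the components of X b at the positions of a given weight, b running through spanning
  vectors of the same weight: one square block per weight.\<close>

theorem End3_spanned_by_20:
  "\<exists>B. B \<subseteq> End3 L \<and> finite B \<and> End3 L \<subseteq> cmat.span B \<and> card B \<le> 20"
proof -
  \<comment> \<open>The spanning set is chosen per weight, not per position. Positions of equal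
    weight share it, which is what puts \<open>(k, b)\<close> into \<open>K\<close> below.\<close>
  define Bs where "Bs \<mu> = (SOME B. B \<subseteq> killed_weight_space \<mu> \<and> finite B \<and>
    killed_weight_space \<mu> \<subseteq> vec.span B \<and> card B \<le> card {k. k < 10 \<and> position_weight k = \<mu>})" for \<mu>
  have "Bs \<mu> \<subseteq> killed_weight_space \<mu> \<and> finite (Bs \<mu>) \<and> killed_weight_space \<mu> \<subseteq> vec.span (Bs \<mu>) \<and>
      card (Bs \<mu>) \<le> card {k. k < 10 \<and> position_weight k = \<mu>}" for \<mu>
    unfolding Bs_def by (rule someI_ex[OF killed_weight_space_basis])
  then have Bs: "Bs \<mu> \<subseteq> killed_weight_space \<mu>" "finite (Bs \<mu>)"
    "killed_weight_space \<mu> \<subseteq> vec.span (Bs \<mu>)"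
    "card (Bs \<mu>) \<le> card {k. k < 10 \<and> position_weight k = \<mu>}" for \<mu>
    by (simp_all only:)
  define K where "K = (SIGMA j:{..<10::nat}. Bs (position_weight j))"
  have "finite K" using Bs(2) by (auto simp: K_def)
  have "card K = (\<Sum>j<10. card (Bs (position_weight j)))"
    unfolding K_def using Bs(2) by (subst card_SigmaI) auto
  also have "\<dots> \<le> (\<Sum>j<10. card {k. k < 10 \<and> position_weight k = position_weight j})"
    by (intro sum_mono Bs(4))
  finally have cardK: "card K \<le> 20" unfolding position_weight_pairs .
  have pwf: "length (position_weight j) = 7 \<and> position_weight j ! 0 = 0" if "j < 10" for j
    unfolding position_weight_def using top_positions_less[OF that] by (intro triple_weight_form(1)) auto
  have sub: "cmat.subspace (End3 L)"
    using operator_algebra_End3 by (auto simp: operator_algebra_def)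
  have "\<exists>B. B \<subseteq> End3 L \<and> finite B \<and> cmat.independent B \<and> End3 L \<subseteq> cmat.span B \<and> card B \<le> card K"
  proof (rule cmat.basis_of_separating_functionals[OF sub \<open>finite K\<close>, where \<phi> = "\<lambda>(j, b) X. (X *v b) $ pos j"])
    show "(case k of (j, b) \<Rightarrow> \<lambda>X. (X *v b) $ pos j) (X + Y) =
        (case k of (j, b) \<Rightarrow> \<lambda>X. (X *v b) $ pos j) X + (case k of (j, b) \<Rightarrow> \<lambda>X. (X *v b) $ pos j) Y" for k X Y
      by (cases k) (simp add: matrix_vector_mult_add_rdistrib)
    show "(case k of (j, b) \<Rightarrow> \<lambda>X. (X *v b) $ pos j) (cmat_scale c X) =
        c * (case k of (j, b) \<Rightarrow> \<lambda>X. (X *v b) $ pos j) X" for k c X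
      by (cases k) (simp add: matrix_vector_mult_def cmat_scale_def sum_distrib_left mult.assoc)
    fix X assume X: "X \<in> End3 L"
      and z: "\<And>k. k \<in> K \<Longrightarrow> (case k of (j, b) \<Rightarrow> \<lambda>X. (X *v b) $ pos j) X = 0"
    have Bs0: "X *v b = 0" if j: "j < 10" and b: "b \<in> Bs (position_weight j)" for j b
    proof (rule killed_eq_0)
      have Xb: "X *v b \<in> killed_weight_space (position_weight j)"
        using End3_killed_weight_space[OF X _ pwf[OF j]] Bs(1) b by blast
      then show "killed (X *v b)" by (simp add: killed_weight_space_def)
      fix k :: nat assume k: "k < 10"
      show "(X *v b) $ pos k = 0"
      proof (cases "position_weight k = position_weight j")
        case True
        then have "(k, b) \<in> K" using k b by (simp add: K_def)
        then show ?thesis using z[of "(k, b)"] by simp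
      next
        case False
        then show ?thesis using Xb unfolding killed_weight_space_def wt3_pos[OF k, symmetric] by blast
      qed
    qed
    have kill_weight: "X *v w = 0" if j: "j < 10" and w: "w \<in> killed_weight_space (position_weight j)" for j w
    proof -
      have "w \<in> vec.span (Bs (position_weight j))" using Bs(3) w by blast
      then show ?thesis
        by (induction rule: vec.span_induct_alt) (simp_all add: vec.add vec.scale Bs0[OF j])
    qed
    have "X *v w = 0" if w: "killed w" for w
    proof -
      \<comment> \<open>Weights outside \<open>M\<close> contribute nothing: that part of
        \<open>w\<close> is killed and vanishes at all ten positions.\<close>
      define M where "M = position_weight ` {..<10}"
      have "w - weight_part (\<lambda>\<mu>. \<mu> \<in> M) w = weight_part (\<lambda>\<mu>. \<mu> \<notin> M) w"
        by (simp add: weight_part_def vec_eq_iff)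
      also have "\<dots> = 0"
      proof (rule killed_eq_0)
        show "killed (weight_part (\<lambda>\<mu>. \<mu> \<notin> M) w)" by (rule killed_weight_part[OF w])
        show "weight_part (\<lambda>\<mu>. \<mu> \<notin> M) w $ pos j = 0" if "j < 10" for j
          using that by (simp add: weight_part_def wt3_pos M_def)
      qed
      finally have "w = weight_part (\<lambda>\<mu>. \<mu> \<in> M) w" by simp
      also have "\<dots> = (\<Sum>\<nu>\<in>M. weight_part (\<lambda>\<mu>. \<mu> = \<nu>) w)"
        by (simp add: weight_part_def vec_eq_iff M_def)
      finally have "X *v w = (\<Sum>\<nu>\<in>M. X *v weight_part (\<lambda>\<mu>. \<mu> = \<nu>) w)"
        by (metis (no_types, lifting) sum.cong vec.sum)
      also have "\<dots> = 0"
      proof (rule sum.neutral, rule ballI)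
        fix \<nu> assume "\<nu> \<in> M"
        then obtain j where j: "j < 10" "\<nu> = position_weight j" by (auto simp: M_def)
        have "weight_part (\<lambda>\<mu>. \<mu> = \<nu>) w \<in> killed_weight_space \<nu>"
          using killed_weight_part[OF w] by (simp add: killed_weight_space_def weight_part_def)
        then show "X *v weight_part (\<lambda>\<mu>. \<mu> = \<nu>) w = 0"
          using kill_weight j by blast
      qed
      finally show ?thesis .
    qed
    then show "X = 0" using End3_eq_0[OF X] by blast
  qed
  then show ?thesis using cardK by (meson order.trans)
qed

end

section \<open>Twenty linearly independent operators\<close>

text \<open>Sorted by diagrammatic order (six, ten and four operators), to match the list of
  exponents in \<open>independent_operators_entries\<close>.\<close>

definition independent_operators ::
    "('n \<Rightarrow> 'n \<Rightarrow> 'n \<Rightarrow> complex) \<Rightarrow> ('n \<Rightarrow> 'n \<Rightarrow> 'n \<Rightarrow> complex) \<Rightarrow> 'n::finite op3 list" where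
  "independent_operators u d = (let S = S_op u d in
    [reindex_op p123, reindex_op p213, reindex_op p132, reindex_op p321, reindex_op p231, reindex_op p312,
     S 1 1, S 1 2, S 1 3, S 2 1, S 2 2, S 2 3, S 3 1, S 3 2, S 3 3, T_op u d,
     S 3 3 ** S 1 1, S 3 3 ** S 1 2, S 2 3 ** S 1 1, S 2 3 ** P23 ** S 3 2])"

lemma length_independent_operators: "length (independent_operators u d) = 20"
  by (simp add: independent_operators_def Let_def)

text \<open>A contraction over one index has at most one nonzero term, since two nodes determine the
  node completing them to weight zero.\<close>

definition pair_sign :: "nat \<Rightarrow> nat \<Rightarrow> nat \<Rightarrow> nat \<Rightarrow> int" where
  "pair_sign x y z w = (let t = triad_table ! x ! y in
     if t = 0 then 0 else sgn t * triad_sign (nat (\<bar>t\<bar> - 1)) z w)"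

lemma sum_triad_sign:
  assumes "x < 27" "y < 27"
  shows "(\<Sum>e<27. triad_sign x y e * triad_sign e z w) = pair_sign x y z w"
proof (cases "triad_table ! x ! y = 0")
  case True
  then show ?thesis by (simp add: pair_sign_def triad_sign_def)
next
  case False
  define t where "t = triad_table ! x ! y"
  define e0 where "e0 = nat (\<bar>t\<bar> - 1)"
  have t: "t \<noteq> 0" using False by (simp add: t_def)
  have "e0 < 27"
    using triad_table_entry[OF assms] t unfolding Let_def t_def[symmetric] e0_def by (simp only: if_False)
  have "triad_sign x y e = (if e = e0 then sgn t else 0)" for e
    using assms t unfolding triad_sign_def t_def[symmetric] e0_def by auto
  then have "(\<Sum>e<27. triad_sign x y e * triad_sign e z w) = (\<Sum>e<27. if e = e0 then sgn t * triad_sign e z w else 0)"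
    by (intro sum.cong) auto
  also have "\<dots> = sgn t * triad_sign e0 z w" using \<open>e0 < 27\<close> by (simp add: sum.delta)
  finally show ?thesis using t by (simp add: pair_sign_def t_def e0_def Let_def)
qed

definition S_sign :: "nat \<Rightarrow> nat \<Rightarrow> nat \<times> nat \<times> nat \<Rightarrow> nat \<times> nat \<times> nat \<Rightarrow> int" where
  "S_sign i j a b = (if slot i a = slot j b
     then pair_sign (slot (other1 i) a) (slot (other2 i) a) (slot (other1 j) b) (slot (other2 j) b) else 0)"

definition T_sign :: "nat \<times> nat \<times> nat \<Rightarrow> nat \<times> nat \<times> nat \<Rightarrow> int" where
  "T_sign a b = triad_sign (slot 1 a) (slot 2 a) (slot 3 a) * triad_sign (slot 1 b) (slot 2 b) (slot 3 b)"

definition line_sum :: "(nat \<Rightarrow> int) \<Rightarrow> int" where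
  "line_sum g = sum_list (map g [0..<27])"

text \<open>In each product, one Kronecker delta ties an index of the intermediate triple to the
  output and the other ties an index to the input, so the sum runs over a single \<open>m\<close>.
  Testing \<open>s = 0\<close> first spares the evaluation of the second factor.\<close>

definition operator_signs :: "nat \<times> nat \<times> nat \<Rightarrow> nat \<times> nat \<times> nat \<Rightarrow> int list" where
  "operator_signs a b =
    map (\<lambda>f. if b = f a then 1 else 0) [p123, p213, p132, p321, p231, p312] @
    [S_sign 1 1 a b, S_sign 1 2 a b, S_sign 1 3 a b, S_sign 2 1 a b, S_sign 2 2 a b, S_sign 2 3 a b,
     S_sign 3 1 a b, S_sign 3 2 a b, S_sign 3 3 a b, T_sign a b,
     line_sum (\<lambda>m. let c = (slot 1 b, m, slot 3 a); s = S_sign 3 3 a c in if s = 0 then 0 else s * S_sign 1 1 c b),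
     line_sum (\<lambda>m. let c = (slot 2 b, m, slot 3 a); s = S_sign 3 3 a c in if s = 0 then 0 else s * S_sign 1 2 c b),
     line_sum (\<lambda>m. let c = (slot 1 b, m, slot 2 a); s = S_sign 2 3 a c in if s = 0 then 0 else s * S_sign 1 1 c b),
     line_sum (\<lambda>m. let s = S_sign 2 3 a (m, slot 2 b, slot 2 a) in
       if s = 0 then 0 else s * S_sign 3 2 (m, slot 2 a, slot 2 b) b)]"

text \<open>Output triples at which the column of the input triple \<open>(0, 12, 26)\<close>, of weight zero, already
  separates the twenty operators.\<close>

definition test_rows :: "(nat \<times> nat \<times> nat) list" where
  "test_rows = [(7, 6, 24), (15, 5, 20), (7, 21, 10), (15, 16, 8), (1, 13, 25), (0, 17, 24), (12, 9, 18), (26, 2, 8), (17, 0, 24), (9, 12, 18),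
    (2, 26, 8), (17, 24, 0), (9, 18, 12), (2, 8, 26), (0, 12, 26), (12, 0, 26), (0, 26, 12), (26, 12, 0), (26, 0, 12), (12, 26, 0)]"

lemma operator_signs_test:
  "map (\<lambda>r. operator_signs r (0, 12, 26)) test_rows =
    [[0,0,0,0,0,0,0,0,0,0,0,0,0,0,0,1,1,0,0,0],
     [0,0,0,0,0,0,0,0,0,0,0,0,0,0,0,1,0,1,0,0],
     [0,0,0,0,0,0,0,0,0,0,0,0,0,0,0,1,0,0,1,0],
     [0,0,0,0,0,0,0,0,0,0,0,0,0,0,0,1,0,0,0,1],
     [0,0,0,0,0,0,0,0,0,0,0,0,0,0,0,1,1,0,0,1],
     [0,0,0,0,0,0,1,0,0,0,0,0,0,0,0,1,1,0,1,0],
     [0,0,0,0,0,0,0,1,0,0,0,0,0,0,0,1,0,1,0,1],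
     [0,0,0,0,0,0,0,0,1,0,0,0,0,0,0,1,0,0,0,0],
     [0,0,0,0,0,0,0,0,0,1,0,0,0,0,0,1,1,0,0,1],
     [0,0,0,0,0,0,0,0,0,0,1,0,0,0,0,1,0,1,1,0],
     [0,0,0,0,0,0,0,0,0,0,0,1,0,0,0,1,0,0,1,1],
     [0,0,0,0,0,0,0,0,0,0,0,0,1,0,0,1,0,1,1,0],
     [0,0,0,0,0,0,0,0,0,0,0,0,0,1,0,1,1,0,0,1],
     [0,0,0,0,0,0,0,0,0,0,0,0,0,0,1,1,1,1,0,0],
     [1,0,0,0,0,0,1,0,0,0,1,0,0,0,1,1,1,1,1,0],
     [0,1,0,0,0,0,0,1,0,1,0,0,0,0,1,1,1,1,0,1],
     [0,0,1,0,0,0,1,0,0,0,0,1,0,1,0,1,1,0,1,1],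
     [0,0,0,1,0,0,0,0,1,0,1,0,1,0,0,1,0,1,1,0],
     [0,0,0,0,1,0,0,0,1,1,0,0,0,1,0,1,1,0,0,1],
     [0,0,0,0,0,1,0,1,0,0,0,1,1,0,0,1,0,1,1,1]]"
  by code_simp

lemma sum_line:
  fixes f :: "'a::finite \<times> 'a \<times> 'a \<Rightarrow> complex"
  assumes "inj g" "\<And>c. f c \<noteq> 0 \<Longrightarrow> c \<in> range g"
  shows "sum f UNIV = (\<Sum>m\<in>UNIV. f (g m))"
proof -
  have "sum f UNIV = sum f (range g)"
    using assms(2) by (intro sum.mono_neutral_right) auto
  then show ?thesis using assms(1) by (simp add: sum.reindex)
qed

section \<open>Matrix entries in the weight basis and linear independence\<close>

context minuscule_model
begin

definition idx :: "27 \<times> 27 \<times> 27 \<Rightarrow> nat \<times> nat \<times> nat" where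
  "idx p = (ix (fst p), ix (fst (snd p)), ix (snd (snd p)))"

lemma slot_idx: "slot i (idx p) = ix (slot i p)"
  by (simp add: slot_def idx_def case_prod_unfold)

lemma sum_ix: "(\<Sum>e\<in>UNIV. g (ix e)) = (\<Sum>k<27. g k)"
  by (rule sum.reindex_bij_betw[OF ix])

context
  fixes u d :: "27 \<Rightarrow> 27 \<Rightarrow> 27 \<Rightarrow> complex" and ku kd :: complex
  assumes u: "\<And>a b c. u a b c = ku * of_int (triad_sign (ix a) (ix b) (ix c))"
    and d: "\<And>a b c. d a b c = kd * of_int (triad_sign (ix a) (ix b) (ix c))"
begin

lemma S_op_entry: "S_op u d i j $ a $ b = ku * kd * of_int (S_sign i j (idx a) (idx b))"
proof -
  have "(\<Sum>e\<in>UNIV. u x y e * d e z w) = ku * kd * of_int (pair_sign (ix x) (ix y) (ix z) (ix w))" for x y z w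
  proof -
    have "(\<Sum>e\<in>UNIV. u x y e * d e z w) =
        ku * kd * (\<Sum>e\<in>UNIV. of_int (triad_sign (ix x) (ix y) (ix e) * triad_sign (ix e) (ix z) (ix w)))"
      by (simp add: u d sum_distrib_left ac_simps)
    also have "(\<Sum>e\<in>UNIV. of_int (triad_sign (ix x) (ix y) (ix e) * triad_sign (ix e) (ix z) (ix w)) :: complex) =
        of_int (\<Sum>k<27. triad_sign (ix x) (ix y) k * triad_sign k (ix z) (ix w))"
      unfolding of_int_sum by (rule sum_ix[where g = "\<lambda>k. of_int (triad_sign (ix x) (ix y) k * triad_sign k (ix z) (ix w))"])
    finally show ?thesis by (simp only: sum_triad_sign ix_less)
  qed
  then show ?thesis
    by (simp add: S_op_def S_sign_def slot_idx ix_eq_iff)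
qed

lemma T_op_entry: "T_op u d $ a $ b = ku * kd * of_int (T_sign (idx a) (idx b))"
  by (simp add: T_op_def T_sign_def slot_idx u d)

text \<open>\<open>g\<close> parametrises the line of intermediate triples allowed by the two
  Kronecker deltas, and \<open>f\<close> is the rearrangement standing between the two
  factors.\<close>

lemma product_entry:
  assumes g: "inj g" and eq: "\<And>c. slot i a = slot j c \<Longrightarrow> slot k (f c) = slot l b \<Longrightarrow> c \<in> range g"
    and h: "\<And>m. idx (g m) = h (ix m)" and h': "\<And>m. idx (f (g m)) = h' (ix m)"
  shows "(S_op u d i j ** (reindex_op f ** S_op u d k l)) $ a $ b =
    (ku * kd)\<^sup>2 * of_int (line_sum (\<lambda>m. S_sign i j (idx a) (h m) * S_sign k l (h' m) (idx b)))"
proof -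
  have "(S_op u d i j ** (reindex_op f ** S_op u d k l)) $ a $ b =
      (\<Sum>c\<in>UNIV. S_op u d i j $ a $ c * S_op u d k l $ f c $ b)"
    by (simp add: matrix_matrix_mult_def[of "S_op u d i j"] reindex_op_mult)
  also have "\<dots> = (\<Sum>m\<in>UNIV. S_op u d i j $ a $ g m * S_op u d k l $ f (g m) $ b)"
  proof (rule sum_line[OF g])
    fix c assume "S_op u d i j $ a $ c * S_op u d k l $ f c $ b \<noteq> 0"
    then show "c \<in> range g" by (intro eq) (auto simp: S_op_def split: if_splits)
  qed
  also have "\<dots> = (\<Sum>m\<in>UNIV. (ku * kd)\<^sup>2 * of_int (S_sign i j (idx a) (h (ix m)) * S_sign k l (h' (ix m)) (idx b)))"
    by (simp add: S_op_entry h h' power2_eq_square ac_simps)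
  also have "\<dots> = (\<Sum>m<27. (ku * kd)\<^sup>2 * of_int (S_sign i j (idx a) (h m) * S_sign k l (h' m) (idx b)))"
    by (rule sum_ix[where g = "\<lambda>m. (ku * kd)\<^sup>2 * of_int (S_sign i j (idx a) (h m) * S_sign k l (h' m) (idx b))"])
  also have "\<dots> = (ku * kd)\<^sup>2 * of_int (line_sum (\<lambda>m. S_sign i j (idx a) (h m) * S_sign k l (h' m) (idx b)))"
    by (simp add: line_sum_def interv_sum_list_conv_sum_set_nat atLeast0LessThan sum_distrib_left of_int_sum)
  finally show ?thesis .
qed

lemma reindex_id_mult: "reindex_op (\<lambda>c. c) ** X = X"
  by (simp add: vec_eq_iff reindex_op_mult)

lemma reindex_op_entry:
  assumes "\<And>p. idx (f p) = f' (idx p)"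
  shows "reindex_op f $ a $ b = of_int (if idx b = f' (idx a) then 1 else 0)"
proof -
  have "idx p = idx q \<longleftrightarrow> p = q" for p q
    by (simp add: idx_def ix_eq_iff prod_eq_iff)
  then show ?thesis by (simp add: reindex_op_def assms[symmetric])
qed

text \<open>Each pair of an upper and a lower tensor contributes one factor \<open>ku * kd\<close>,
  so the exponent is half the diagrammatic order.\<close>

lemma independent_operators_entries:
  "map (\<lambda>X. X $ a $ b) (independent_operators u d) =
    map2 (\<lambda>n s. (ku * kd) ^ n * of_int s) (replicate 6 0 @ replicate 10 1 @ replicate 4 2)
      (operator_signs (idx a) (idx b))"
proof -
  have p: "(S_op u d 3 3 ** S_op u d 1 1) $ a $ b = (ku * kd)\<^sup>2 *
      of_int (line_sum (\<lambda>m. S_sign 3 3 (idx a) (slot 1 (idx b), m, slot 3 (idx a)) * S_sign 1 1 (slot 1 (idx b), m, slot 3 (idx a)) (idx b)))"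
    using product_entry[of "\<lambda>m. (slot 1 b, m, slot 3 a)" 3 a 3 1 "\<lambda>c. c" 1 b
        "\<lambda>m. (slot 1 (idx b), m, slot 3 (idx a))" "\<lambda>m. (slot 1 (idx b), m, slot 3 (idx a))"]
    by (auto simp: reindex_id_mult inj_def slot_idx idx_def[of "(_, _, _)"] Let_def) (auto simp: slot_def image_iff split: prod.splits)
  have q: "(S_op u d 3 3 ** S_op u d 1 2) $ a $ b = (ku * kd)\<^sup>2 *
      of_int (line_sum (\<lambda>m. S_sign 3 3 (idx a) (slot 2 (idx b), m, slot 3 (idx a)) * S_sign 1 2 (slot 2 (idx b), m, slot 3 (idx a)) (idx b)))"
    using product_entry[of "\<lambda>m. (slot 2 b, m, slot 3 a)" 3 a 3 1 "\<lambda>c. c" 2 b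
        "\<lambda>m. (slot 2 (idx b), m, slot 3 (idx a))" "\<lambda>m. (slot 2 (idx b), m, slot 3 (idx a))"]
    by (auto simp: reindex_id_mult inj_def slot_idx idx_def[of "(_, _, _)"] Let_def) (auto simp: slot_def image_iff split: prod.splits)
  have r: "(S_op u d 2 3 ** S_op u d 1 1) $ a $ b = (ku * kd)\<^sup>2 *
      of_int (line_sum (\<lambda>m. S_sign 2 3 (idx a) (slot 1 (idx b), m, slot 2 (idx a)) * S_sign 1 1 (slot 1 (idx b), m, slot 2 (idx a)) (idx b)))"
    using product_entry[of "\<lambda>m. (slot 1 b, m, slot 2 a)" 2 a 3 1 "\<lambda>c. c" 1 b
        "\<lambda>m. (slot 1 (idx b), m, slot 2 (idx a))" "\<lambda>m. (slot 1 (idx b), m, slot 2 (idx a))"]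
    by (auto simp: reindex_id_mult inj_def slot_idx idx_def[of "(_, _, _)"] Let_def) (auto simp: slot_def image_iff split: prod.splits)
  have s: "(S_op u d 2 3 ** P23 ** S_op u d 3 2) $ a $ b = (ku * kd)\<^sup>2 *
      of_int (line_sum (\<lambda>m. S_sign 2 3 (idx a) (m, slot 2 (idx b), slot 2 (idx a)) *
        S_sign 3 2 (m, slot 2 (idx a), slot 2 (idx b)) (idx b)))"
    using product_entry[of "\<lambda>m. (m, slot 2 b, slot 2 a)" 2 a 3 3 p132 2 b
        "\<lambda>m. (m, slot 2 (idx b), slot 2 (idx a))" "\<lambda>m. (m, slot 2 (idx a), slot 2 (idx b))"]
    by (auto simp: P23_eq matrix_mul_assoc[symmetric] inj_def slot_idx idx_def[of "(_, _, _)"] Let_def) (auto simp: slot_def image_iff split: prod.splits)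
  have p123_entry: "reindex_op p123 $ a $ b = of_int (if idx b = p123 (idx a) then 1 else 0)"
    by (rule reindex_op_entry[of p123 p123]) (simp add: idx_def case_prod_unfold)
  have p213_entry: "reindex_op p213 $ a $ b = of_int (if idx b = p213 (idx a) then 1 else 0)"
    by (rule reindex_op_entry[of p213 p213]) (simp add: idx_def case_prod_unfold)
  have p132_entry: "reindex_op p132 $ a $ b = of_int (if idx b = p132 (idx a) then 1 else 0)"
    by (rule reindex_op_entry[of p132 p132]) (simp add: idx_def case_prod_unfold)
  have p321_entry: "reindex_op p321 $ a $ b = of_int (if idx b = p321 (idx a) then 1 else 0)"
    by (rule reindex_op_entry[of p321 p321]) (simp add: idx_def case_prod_unfold)
  have p231_entry: "reindex_op p231 $ a $ b = of_int (if idx b = p231 (idx a) then 1 else 0)"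
    by (rule reindex_op_entry[of p231 p231]) (simp add: idx_def case_prod_unfold)
  have p312_entry: "reindex_op p312 $ a $ b = of_int (if idx b = p312 (idx a) then 1 else 0)"
    by (rule reindex_op_entry[of p312 p312]) (simp add: idx_def case_prod_unfold)
  note perms = p123_entry p213_entry p132_entry p321_entry p231_entry p312_entry
  have rep: "replicate 6 (0::nat) @ replicate 10 1 @ replicate 4 2 =
      [0,0,0,0,0,0,1,1,1,1,1,1,1,1,1,1,2,2,2,2]"
    by (simp add: numeral_eq_Suc)
  have lazy: "(if s = 0 then 0 else s * t) = s * t" for s t :: int
    by simp
  show ?thesis
    unfolding independent_operators_def operator_signs_def rep Let_def
    by (simp only: lazy list.map append_Cons append_Nil zip_Nil zip_Cons_Cons prod.case p q r s perms S_op_entry T_op_entry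
        power_0 power_one_right mult_1_left)
qed

lemma sum_lessThan_20: "(\<Sum>k<20. f k) = f 0 + f 1 + f 2 + f 3 + f 4 + f 5 + f 6 + f 7 + f 8 + f 9 + f 10
    + f 11 + f 12 + f 13 + f 14 + f 15 + f 16 + f 17 + f 18 + f (19 :: nat)" for f :: "nat \<Rightarrow> complex"
  by (simp add: eval_nat_numeral)

theorem independent_operators_independent:
  assumes k: "ku * kd \<noteq> 0" and sum0: "(\<Sum>k<20. cmat_scale (c k) (independent_operators u d ! k)) = 0" and "k < 20"
  shows "c k = 0"
proof -
  define e :: "nat list" where "e = replicate 6 0 @ replicate 10 1 @ replicate 4 2"
  have le: "length e = 20" by (simp add: e_def)
  \<comment> \<open>The nonzero powers of \<open>ku * kd\<close> are absorbed into the unknowns,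
    which leaves a system with integer coefficients.\<close>
  define x where "x k = c k * (ku * kd) ^ (e ! k)" for k
  have "(\<Sum>k<20. x k * of_int (operator_signs r (0, 12, 26) ! k)) = 0" if "r \<in> set test_rows" for r
  proof -
    define a b where "a = (xi (fst r), xi (fst (snd r)), xi (snd (snd r)))" and "b = (xi 0, xi 12, xi 26)"
    have "fst r < 27 \<and> fst (snd r) < 27 \<and> snd (snd r) < 27"
      using that by (auto simp: test_rows_def)
    then have r: "idx a = r" and b: "idx b = (0, 12, 26)"
      by (simp_all add: idx_def a_def b_def ix_xi)
    have "independent_operators u d ! k $ a $ b = (ku * kd) ^ (e ! k) * of_int (operator_signs r (0, 12, 26) ! k)"
      if "k < 20" for k
    proof -
      have "length (operator_signs r (0, 12, 26)) = 20" by (simp add: operator_signs_def)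
      then show ?thesis
        using arg_cong[OF independent_operators_entries[of a b], of "\<lambda>l. l ! k"] that
        unfolding r b e_def[symmetric] by (simp add: length_independent_operators le)
    qed
    then have "(\<Sum>k<20. x k * of_int (operator_signs r (0, 12, 26) ! k)) =
        (\<Sum>k<20. cmat_scale (c k) (independent_operators u d ! k)) $ a $ b"
      by (simp add: x_def cmat_scale_def mult.assoc)
    then show ?thesis unfolding sum0 by simp
  qed
  then have "\<forall>s \<in> set (map (\<lambda>r. operator_signs r (0, 12, 26)) test_rows). (\<Sum>k<20. x k * of_int (s ! k)) = 0"
    by simp
  note eqs = this[unfolded operator_signs_test sum_lessThan_20, simplified]
  \<comment> \<open>Five equations settle T (15) and the four products (16 to 19); of the others,
    nine then isolate one S_ij each, and the last six isolate the permutations.\<close>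
  have h: "x 15 + x 16 = 0"
    "x 15 + x 17 = 0"
    "x 15 + x 18 = 0"
    "x 15 + x 19 = 0"
    "x 15 + x 16 + x 19 = 0"
    "x 6 + x 15 + x 16 + x 18 = 0"
    "x 7 + x 15 + x 17 + x 19 = 0"
    "x 8 + x 15 = 0"
    "x 9 + x 15 + x 16 + x 19 = 0"
    "x 10 + x 15 + x 17 + x 18 = 0"
    "x 11 + x 15 + x 18 + x 19 = 0"
    "x 12 + x 15 + x 17 + x 18 = 0"
    "x 13 + x 15 + x 16 + x 19 = 0"
    "x 14 + x 15 + x 16 + x 17 = 0"
    "x 0 + x 6 + x 10 + x 14 + x 15 + x 16 + x 17 + x 18 = 0"
    "x 1 + x 7 + x 9 + x 14 + x 15 + x 16 + x 17 + x 19 = 0"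
    "x 2 + x 6 + x 11 + x 13 + x 15 + x 16 + x 18 + x 19 = 0"
    "x 3 + x 8 + x 10 + x 12 + x 15 + x 17 + x 18 = 0"
    "x 4 + x 8 + x 9 + x 13 + x 15 + x 16 + x 19 = 0"
    "x 5 + x 7 + x 11 + x 12 + x 15 + x 17 + x 18 + x 19 = 0"
    using eqs unfolding One_nat_def by blast+
  have x19: "x 19 = 0" using h(5) unfolding h(1) by simp
  then have x15: "x 15 = 0" using h(4) by simp
  then have x4: "x 15 = 0" "x 16 = 0" "x 17 = 0" "x 18 = 0" "x 19 = 0" using h(1,2,3) x19 by simp_all
  then have x9: "x 6 = 0" "x 7 = 0" "x 8 = 0" "x 9 = 0" "x 10 = 0" "x 11 = 0" "x 12 = 0" "x 13 = 0" "x 14 = 0"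
    using h(6-14) by simp_all
  have x6: "x 0 = 0" "x 1 = 0" "x 2 = 0" "x 3 = 0" "x 4 = 0" "x 5 = 0"
    using h(15-20) x4 x9 by simp_all
  have "k \<in> {0, 1, 2, 3, 4, 5, 6, 7, 8, 9, 10, 11, 12, 13, 14, 15, 16, 17, 18, 19}"
    using \<open>k < 20\<close> by (auto simp: numeral_eq_Suc less_Suc_eq)
  then have "x k = 0"
    using x4 x9 x6 by (elim insertE emptyE) (simp_all only:)
  then show ?thesis using k by (simp add: x_def)
qed

end

end

section \<open>The centralizer algebra\<close>

text \<open>An element of V outside the span would enlarge the list to an independent set with more
  elements than B. Independence is stated for the indexed list, which includes that its members are
  distinct.\<close>

lemma (in vector_space) independent_list_spans:
  assumes V: "set xs \<subseteq> V"
    and relations: "\<forall>c. (\<Sum>k<length xs. scale (c k) (xs ! k)) = 0 \<longrightarrow> (\<forall>k<length xs. c k = 0)"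
    and B: "finite B" "V \<subseteq> span B" "card B \<le> length xs"
  shows "V \<subseteq> span (set xs)" "dim V = length xs"
proof -
  have ind: "c k = 0" if "(\<Sum>k<length xs. scale (c k) (xs ! k)) = 0" "k < length xs" for c k
    using relations that by blast
  have dist: "distinct xs"
    unfolding distinct_conv_nth
  proof (intro allI impI notI)
    fix i j assume ij: "i < length xs" "j < length xs" "i \<noteq> j" "xs ! i = xs ! j"
    define c :: "nat \<Rightarrow> 'a" where "c k = (if k = i then 1 else 0) - (if k = j then 1 else 0)" for k
    have "(\<Sum>k<length xs. scale (c k) (xs ! k)) =
        (\<Sum>k<length xs. if k = i then xs ! k else 0) - (\<Sum>k<length xs. if k = j then xs ! k else 0)"
      unfolding sum_subtractf[symmetric] by (intro sum.cong) (auto simp: c_def)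
    then have "(\<Sum>k<length xs. scale (c k) (xs ! k)) = 0"
      using ij by simp
    then have "c i = 0" using ind ij by blast
    then show False using ij by (simp add: c_def)
  qed
  have indep: "independent (set xs)"
  proof
    assume "dependent (set xs)"
    then obtain a where a: "\<exists>v\<in>set xs. a v \<noteq> 0" "(\<Sum>v\<in>set xs. scale (a v) v) = 0"
      unfolding dependent_finite[OF finite_set] by blast
    have "(\<Sum>k<length xs. scale (a (xs ! k)) (xs ! k)) = (\<Sum>v\<in>set xs. scale (a v) v)"
      by (rule sum.reindex_bij_betw[OF bij_betw_nth[OF dist refl refl]])
    then have "\<forall>k<length xs. a (xs ! k) = 0"
      using ind[of "\<lambda>k. a (xs ! k)"] a(2) by simp
    then show False using a(1) by (auto simp: in_set_conv_nth)
  qed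
  show sub: "V \<subseteq> span (set xs)"
  proof (rule subsetI, rule ccontr)
    fix x assume x: "x \<in> V" "x \<notin> span (set xs)"
    have "independent (insert x (set xs))"
      by (rule independent_insertI[OF x(2) indep])
    moreover have "insert x (set xs) \<subseteq> span B" using x V B by blast
    ultimately have "card (insert x (set xs)) \<le> card B"
      using independent_span_bound[OF B(1)] by blast
    moreover have "x \<notin> set xs" using x(2) span_base by blast
    ultimately show False using B(3) distinct_card[OF dist] by simp
  qed
  show "dim V = length xs"
    by (rule dim_unique[OF V sub indep distinct_card[OF dist]])
qed

text \<open>The relations follow by letting brackets act on vectors. Irreducibility enters through
  the absence of invariant vectors: these form an invariant subspace, and if it were everything,
  each subspace would be invariant.\<close>

lemma e6_representation_module:
  fixes scale :: "complex \<Rightarrow> 'g::ab_group_add \<Rightarrow> 'g" and bracket :: "'g \<Rightarrow> 'g \<Rightarrow> 'g"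
    and \<rho> :: "'g \<Rightarrow> complex^27^27"
  assumes e6: "e6_lie_algebra scale bracket" and rep: "irreducible_lie_representation scale bracket \<rho>"
  obtains e f h where "e6_module (\<lambda>i. \<rho> (e i)) (\<lambda>i. \<rho> (f i)) (\<lambda>i. \<rho> (h i))"
proof -
  interpret G: e6_lie_algebra scale bracket by fact
  interpret V: irreducible_lie_representation scale bracket \<rho> by fact
  interpret lin: Vector_Spaces.linear scale cmat_scale \<rho> by (rule V.linear)
  have sc: "\<rho> (scale c x) *v w = c *s (\<rho> x *v w)" for c x w
    by (simp add: lin.scale cmat_scale_def matrix_vector_mult_def vec_eq_iff sum_distrib_left mult.assoc)
  have br: "\<rho> x *v (\<rho> y *v w) = \<rho> y *v (\<rho> x *v w) + \<rho> (bracket x y) *v w" for x y w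
    by (simp add: V.bracket matrix_vector_mult_diff_rdistrib matrix_vector_mul_assoc)
  obtain e f h where ch: "G.chevalley_serre {1..6} e6_cartan e f h"
    and gen: "G.lie_generated_by (e ` {1..6} \<union> f ` {1..6} \<union> h ` {1..6})"
    using G.chevalley_generators by blast
  have c: "bracket (h i) (h j) = 0" "bracket (e i) (f j) = (if i = j then h i else 0)"
    "bracket (h i) (e j) = scale (of_int (e6_cartan i j)) (e j)"
    "bracket (h i) (f j) = scale (- of_int (e6_cartan i j)) (f j)"
    "i \<noteq> j \<Longrightarrow> (bracket (f i) ^^ nat (1 - e6_cartan i j)) (f j) = 0"
    if "i \<in> {1..6}" "j \<in> {1..6}" for i j
    using ch that unfolding G.chevalley_serre_def by blast+
  have "e6_module (\<lambda>i. \<rho> (e i)) (\<lambda>i. \<rho> (f i)) (\<lambda>i. \<rho> (h i))"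
  proof
    fix i j :: nat and w :: "complex^27"
    assume ij: "i \<in> {1..6}" "j \<in> {1..6}"
    show "\<rho> (h i) *v (\<rho> (h j) *v w) = \<rho> (h j) *v (\<rho> (h i) *v w)"
      using br[of "h i" "h j" w] c(1)[OF ij] by (simp add: lin.zero)
    show "\<rho> (e i) *v (\<rho> (f j) *v w) = \<rho> (f j) *v (\<rho> (e i) *v w) + (if i = j then \<rho> (h i) *v w else 0)"
      using br[of "e i" "f j" w] c(2)[OF ij] by (simp add: lin.zero)
    show "\<rho> (h i) *v (\<rho> (e j) *v w) = \<rho> (e j) *v (\<rho> (h i) *v w) + of_int (e6_cartan i j) *s (\<rho> (e j) *v w)"
      using br[of "h i" "e j" w] c(3)[OF ij] by (simp add: sc)
    show "\<rho> (h i) *v (\<rho> (f j) *v w) = \<rho> (f j) *v (\<rho> (h i) *v w) - of_int (e6_cartan i j) *s (\<rho> (f j) *v w)"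
      using br[of "h i" "f j" w] unfolding c(4)[OF ij] sc by (simp add: vector_smult_lneg)
    assume "i \<noteq> j" "e6_cartan i j = 0"
    then have "bracket (f i) (f j) = 0"
      using c(5)[OF ij] by simp
    then show "\<rho> (f i) *v (\<rho> (f j) *v w) = \<rho> (f j) *v (\<rho> (f i) *v w)"
      using br[of "f i" "f j" w] by (simp add: lin.zero)
  next
    fix w assume w: "\<rho> (e i) *v w = 0 \<and> \<rho> (f i) *v w = 0" if "i \<in> {1..6}" for i
    \<comment> \<open>The annihilator of \<open>w\<close> in the Lie algebra is a subalgebra
      containing all generators, the h_i being brackets of e_i and f_i; hence it is
      everything.\<close>
    have "\<rho> (bracket x y) *v w = 0" if "\<rho> x *v w = 0" "\<rho> y *v w = 0" for x y
      using br[of x y w] that by simp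
    then have "G.lie_subalgebra {x. \<rho> x *v w = 0}"
      unfolding G.lie_subalgebra_def G.subspace_def
      by (simp add: lin.zero lin.add sc matrix_vector_mult_add_rdistrib)
    moreover have "\<rho> (h i) *v w = 0" if "i \<in> {1..6}" for i
      using br[of "e i" "f i" w] c(2)[OF that that] w[OF that] by simp
    then have "e ` {1..6} \<union> f ` {1..6} \<union> h ` {1..6} \<subseteq> {x. \<rho> x *v w = 0}"
      using w by blast
    ultimately have "{x. \<rho> x *v w = 0} = UNIV"
      using gen unfolding G.lie_generated_by_def by blast
    then have kill: "\<rho> x *v w = 0" for x by blast
    show "w = 0"
    proof (rule ccontr)
      assume "w \<noteq> 0"
      have "{v. \<forall>x. \<rho> x *v v = 0} = {0} \<or> {v. \<forall>x. \<rho> x *v v = 0} = UNIV"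
        by (rule V.irreducible) (auto simp: vec.subspace_def vec.add vec.scale)
      then have "\<forall>v x. \<rho> x *v v = 0"
        using kill \<open>w \<noteq> 0\<close> by blast
      \<comment> \<open>A coordinate hyperplane is invariant under the trivial action, but it is
        neither zero nor the whole space.\<close>
      then have "{v :: complex^27. v $ 0 = 0} = {0} \<or> {v :: complex^27. v $ 0 = 0} = UNIV"
        by (intro V.irreducible) (auto simp: vec.subspace_def)
      moreover have "axis 1 1 \<in> {v :: complex^27. v $ 0 = 0}" "axis 1 1 \<noteq> (0 :: complex^27)"
        "axis 0 1 \<notin> {v :: complex^27. v $ 0 = 0}"
        by (auto simp: axis_def vec_eq_iff)
      ultimately show False by blast
    qed
  qed
  then show thesis by (rule that)
qed

section \<open>Transport between the given basis and the weight basis\<close>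

lemma covec_mult_assoc: "(w v* A) v* B = w v* (A ** (B :: complex^'a^'b))"
  by (simp add: vec_eq_iff vector_matrix_mult_def matrix_matrix_mult_def sum_distrib_left sum_distrib_right ac_simps)
     (rule allI, rule sum.swap)

text \<open>The columns of \<open>Q\<close> are the weight vectors; their independence makes
  \<open>Q\<close> invertible, and \<open>R\<close> is its inverse.\<close>

lemma minuscule_basis_matrix:
  assumes x: "minuscule_basis E F H x" and ix: "bij_betw ix (UNIV :: 27 set) {..<27}"
  obtains R Q :: "complex^27^27" where "R ** Q = mat 1" "Q ** R = mat 1"
    "\<forall>i\<in>{1..6}. R ** F i ** Q = (\<chi> a b. if ix a = down i (ix b) then 1 else 0)"
    "\<forall>i\<in>{1..6}. R ** E i ** Q = (\<chi> a b. if ix a = up i (ix b) then 1 else 0)"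
    "\<forall>i\<in>{1..6}. R ** H i ** Q = (\<chi> a b. if a = b then of_int (weights27 ! ix a ! i) else 0)"
proof -
  define Q :: "complex^27^27" where "Q = (\<chi> p b. x (ix b) $ p)"
  have less: "ix a < 27" for a using ix by (auto simp: bij_betw_def)
  have inj: "ix a = ix b \<longleftrightarrow> a = b" for a b using ix by (auto simp: bij_betw_def inj_def)
  have ind: "\<forall>k<27. c k = 0" if "(\<Sum>k<27. c k *s x k) = 0" for c
    using x that unfolding minuscule_basis_def by blast
  have act: "H i *v x k = of_int (weights27 ! k ! i) *s x k"
    "F i *v x k = (if down i k = 27 then 0 else x (down i k))"
    "E i *v x k = (if up i k = 27 then 0 else x (up i k))"
    if "i \<in> {1..6}" "k < 27" for i k
    using x that unfolding minuscule_basis_def by blast+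
  have "\<exists>R. R ** Q = mat 1"
    unfolding matrix_left_invertible_independent_columns
  proof (intro allI impI)
    fix c i assume "(\<Sum>i\<in>UNIV. c i *s column i Q) = 0"
    moreover have "(\<Sum>i\<in>UNIV. c i *s column i Q) = (\<Sum>i\<in>UNIV. c (inv_into UNIV ix (ix i)) *s x (ix i))"
      using ix by (intro sum.cong) (auto simp: column_def Q_def vec_eq_iff bij_betw_def)
    moreover have "\<dots> = (\<Sum>k<27. c (inv_into UNIV ix k) *s x k)"
      by (rule sum.reindex_bij_betw[OF ix])
    ultimately have "c (inv_into UNIV ix (ix i)) = 0"
      using ind[of "\<lambda>k. c (inv_into UNIV ix k)"] less by simp
    then show "c i = 0" using ix by (simp add: bij_betw_def)
  qed
  then obtain R where R: "R ** Q = mat 1" by blast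
  then have QR: "Q ** R = mat 1" by (simp add: matrix_left_right_inverse)
  have move: "R ** A ** Q = M" if "A ** Q = Q ** M" for A M
    using that R by (simp add: matrix_mul_assoc[symmetric]) (simp add: matrix_mul_assoc)
  have column: "(A ** Q) $ p $ b = (A *v x (ix b)) $ p" for A p b
    by (simp add: matrix_matrix_mult_def matrix_vector_mult_def Q_def)
  have arrow: "A ** Q = Q ** (\<chi> a b. if ix a = t (ix b) then 1 else 0)"
    if A: "\<And>k. k < 27 \<Longrightarrow> A *v x k = (if t k = 27 then 0 else x (t k))" and t: "\<And>k. k < 27 \<Longrightarrow> t k \<le> 27" for A t
  proof -
    have "(A ** Q) $ p $ b = (Q ** (\<chi> a b. if ix a = t (ix b) then 1 else 0)) $ p $ b" for p b
    proof -
      have "(Q ** (\<chi> a b. if ix a = t (ix b) then 1 else 0)) $ p $ b =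
          (\<Sum>c\<in>UNIV. if ix c = t (ix b) then x (ix c) $ p else 0)"
        by (simp add: matrix_matrix_mult_def Q_def if_distrib[of "\<lambda>x. _ * x"] cong: if_cong)
      also have "\<dots> = (\<Sum>k<27. if k = t (ix b) then x k $ p else 0)"
        by (rule sum.reindex_bij_betw[OF ix, of "\<lambda>k. if k = t (ix b) then x k $ p else 0"])
      also have "\<dots> = (if t (ix b) = 27 then 0 else x (t (ix b))) $ p"
        using t[OF less[of b]] by auto
      finally show ?thesis unfolding column A[OF less] by simp
    qed
    then show ?thesis unfolding vec_eq_iff by blast
  qed
  show thesis
  proof (rule that[OF R QR]; intro ballI)
    fix i :: nat assume i: "i \<in> {1..6}"
    show "R ** F i ** Q = (\<chi> a b. if ix a = down i (ix b) then 1 else 0)"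
      by (intro move arrow act(2)[OF i] lower_table_le[OF i])
    have "up i k \<le> 27" if "k < 27" for k
      using raise_table_some(1)[OF i that refl] by (cases "up i k = 27") auto
    then show "R ** E i ** Q = (\<chi> a b. if ix a = up i (ix b) then 1 else 0)"
      by (intro move arrow act(3)[OF i])
    show "R ** H i ** Q = (\<chi> a b. if a = b then of_int (weights27 ! ix a ! i) else 0)"
    proof (rule move)
      have "(H i ** Q) $ p $ b = (Q ** (\<chi> a b. if a = b then of_int (weights27 ! ix a ! i) else 0)) $ p $ b" for p b
        unfolding column act(1)[OF i less]
        by (simp add: matrix_matrix_mult_def Q_def if_distrib[of "\<lambda>x. _ * x"] mult.commute cong: if_cong)
      then show "H i ** Q = Q ** (\<chi> a b. if a = b then of_int (weights27 ! ix a ! i) else 0)"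
        unfolding vec_eq_iff by blast
    qed
  qed
qed

lemma tens3_independent_operators:
  fixes Q :: "complex^'n::finite^'n"
  assumes u: "vec3 u = tens3 Q *v vec3 u'" and d: "vec3 d' = vec3 d v* tens3 Q"
  shows "map (\<lambda>X. tens3 Q ** X) (independent_operators u' d') = map (\<lambda>X. X ** tens3 Q) (independent_operators u d)"
proof -
  have S: "tens3 Q ** S_op u' d' i j = S_op u d i j ** tens3 Q" if "i \<in> {1, 2, 3}" "j \<in> {1, 2, 3}" for i j
    by (rule tens3_S_op[OF u d that])
  have S': "tens3 Q ** S_op u' d' 1 1 = S_op u d 1 1 ** tens3 Q" "tens3 Q ** S_op u' d' 1 2 = S_op u d 1 2 ** tens3 Q"
    "tens3 Q ** S_op u' d' 1 3 = S_op u d 1 3 ** tens3 Q" "tens3 Q ** S_op u' d' 2 1 = S_op u d 2 1 ** tens3 Q"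
    "tens3 Q ** S_op u' d' 2 2 = S_op u d 2 2 ** tens3 Q" "tens3 Q ** S_op u' d' 2 3 = S_op u d 2 3 ** tens3 Q"
    "tens3 Q ** S_op u' d' 3 1 = S_op u d 3 1 ** tens3 Q" "tens3 Q ** S_op u' d' 3 2 = S_op u d 3 2 ** tens3 Q"
    "tens3 Q ** S_op u' d' 3 3 = S_op u d 3 3 ** tens3 Q"
    by (rule S; simp)+
  have prod: "tens3 Q ** (X' ** Y') = (X ** Y) ** tens3 Q"
    if "tens3 Q ** X' = X ** tens3 Q" "tens3 Q ** Y' = Y ** tens3 Q" for X Y X' Y' :: "'n op3"
    using that by (metis matrix_mul_assoc)
  have P: "tens3 Q ** reindex_op p123 = reindex_op p123 ** tens3 Q" "tens3 Q ** reindex_op p213 = reindex_op p213 ** tens3 Q"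
    "tens3 Q ** reindex_op p132 = reindex_op p132 ** tens3 Q" "tens3 Q ** reindex_op p321 = reindex_op p321 ** tens3 Q"
    "tens3 Q ** reindex_op p231 = reindex_op p231 ** tens3 Q" "tens3 Q ** reindex_op p312 = reindex_op p312 ** tens3 Q"
    by (rule tens3_reindex_op, simp only: insert_iff simp_thms)+
  have P23: "tens3 Q ** P23 = P23 ** tens3 Q"
    unfolding P23_eq by (rule P)
  note prods = prod[OF S'(9) S'(1)] prod[OF S'(9) S'(2)] prod[OF S'(6) S'(1)] prod[OF prod[OF S'(6) P23] S'(8)]
  show ?thesis
    unfolding independent_operators_def Let_def
    by (simp only: list.map P S' tens3_T_op[OF u d] prods)
qed

lemma independent_operators_subset:
  "set (independent_operators u d) \<subseteq> order_zero \<union> order_two u d \<union> order_four u d"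
proof -
  have "reindex_op f \<in> order_zero" if "f \<in> {p123, p213, p132, p321, p231, p312}" for f :: "'a \<times> 'a \<times> 'a \<Rightarrow> _"
    using imageI[OF that, of reindex_op] unfolding order_zero_eq .
  then have "{reindex_op p123, reindex_op p213, reindex_op p132, reindex_op p321, reindex_op p231, reindex_op p312}
      \<subseteq> (order_zero :: 'a op3 set)"
    by (simp only: insert_subset empty_subsetI simp_thms insert_iff)
  moreover have "S_op u d i j \<in> order_two u d" if "i \<in> {1, 2, 3}" "j \<in> {1, 2, 3}" for i j
    using that unfolding order_two_def by blast
  moreover have "T_op u d \<in> order_two u d"
    unfolding order_two_def by blast
  moreover have "{S_op u d 3 3 ** S_op u d 1 1, S_op u d 3 3 ** S_op u d 1 2, S_op u d 2 3 ** S_op u d 1 1,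
      S_op u d 2 3 ** P23 ** S_op u d 3 2} \<subseteq> order_four u d"
    unfolding order_four_def Let_def by (simp only: insert_subset empty_subsetI simp_thms insert_iff)
  ultimately show ?thesis
    unfolding independent_operators_def Let_def by simp
qed

theorem theorem4p5:
  fixes scale :: "complex \<Rightarrow> 'g::ab_group_add \<Rightarrow> 'g"
    and bracket :: "'g \<Rightarrow> 'g \<Rightarrow> 'g"
    and \<rho> :: "'g \<Rightarrow> complex^27^27"
    and u d :: "27 \<Rightarrow> 27 \<Rightarrow> 27 \<Rightarrow> complex"
  assumes e6: "e6_lie_algebra scale bracket"
    and V: "irreducible_lie_representation scale bracket \<rho>"
    and u: "upper_invariant (range \<rho>) u"
    and d: "lower_invariant (range \<rho>) d"
    and normalized: "\<And>a b. (\<Sum>c\<in>UNIV. \<Sum>e\<in>UNIV. u a c e * d b c e) = (if a = b then 1 else 0)"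
  shows "cmat.dim (End3 (range \<rho>)) = 20 \<and>
    operator_algebra (End3 (range \<rho>)) \<and>
    operator_algebra (End3 (special_unitary_algebra :: (complex^27^27) set)) \<and>
    End3 (special_unitary_algebra :: (complex^27^27) set) \<subseteq> End3 (range \<rho>) \<and>
    End3 (special_unitary_algebra :: (complex^27^27) set) = cmat.span order_zero \<and>
    End3 (range \<rho>) = cmat.span (order_zero \<union> order_two u d \<union> order_four u d)"
proof -
  let ?L = "range \<rho>"
  obtain e f h where "e6_module (\<lambda>i. \<rho> (e i)) (\<lambda>i. \<rho> (f i)) (\<lambda>i. \<rho> (h i))"
    by (rule e6_representation_module[OF e6 V])
  then obtain \<tau> x where x: "minuscule_basis (\<lambda>i. \<rho> (e (\<tau> i))) (\<lambda>i. \<rho> (f (\<tau> i))) (\<lambda>i. \<rho> (h (\<tau> i))) x"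
    by (rule e6_module_minuscule_basis)
  have "card (UNIV :: 27 set) = card {..<27::nat}" by simp
  then obtain ix :: "27 \<Rightarrow> nat" where ix: "bij_betw ix UNIV {..<27}"
    using finite_same_card_bij[of "UNIV :: 27 set" "{..<27::nat}"] by auto
  obtain R Q :: "complex^27^27" where RQ: "R ** Q = mat 1" and QR: "Q ** R = mat 1"
    and F: "\<forall>i\<in>{1..6}. R ** \<rho> (f (\<tau> i)) ** Q = (\<chi> a b. if ix a = down i (ix b) then 1 else 0)"
    and E: "\<forall>i\<in>{1..6}. R ** \<rho> (e (\<tau> i)) ** Q = (\<chi> a b. if ix a = up i (ix b) then 1 else 0)"
    and H: "\<forall>i\<in>{1..6}. R ** \<rho> (h (\<tau> i)) ** Q = (\<chi> a b. if a = b then of_int (weights27 ! ix a ! i) else 0)"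
    by (rule minuscule_basis_matrix[OF x ix])
  define L' where "L' = (\<lambda>A. R ** A ** Q) ` ?L"
  interpret M: minuscule_model ix L'
  proof
    show "bij_betw ix UNIV {..<27}" by (rule ix)
    fix i :: nat assume i: "i \<in> {1..6}"
    show "(\<chi> a b. if ix a = down i (ix b) then 1 else 0) \<in> L'"
      unfolding F[rule_format, OF i, symmetric] L'_def by blast
    show "(\<chi> a b. if ix a = up i (ix b) then 1 else 0) \<in> L'"
      unfolding E[rule_format, OF i, symmetric] L'_def by blast
    show "(\<chi> a b. if a = b then of_int (weights27 ! ix a ! i) else 0) \<in> L'"
      unfolding H[rule_format, OF i, symmetric] L'_def by blast
  qed
  have tRQ: "tens3 R ** tens3 Q = mat 1" and tQR: "tens3 Q ** tens3 R = mat 1"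
    by (simp_all add: tens3_mult RQ QR tens3_mat_1)
  have moveQ: "tens3 Q ** act3 (R ** A ** Q) = act3 A ** tens3 Q" for A
    by (rule tens3_act3) (simp add: matrix_mul_assoc QR)
  have moveR: "tens3 R ** act3 A = act3 (R ** A ** Q) ** tens3 R" for A
    by (rule tens3_act3) (simp add: QR flip: matrix_mul_assoc)

  \<comment> \<open>Upper indices transform by \<open>R\<close> and lower ones by its inverse
    \<open>Q\<close>, so that contractions are preserved.\<close>
  define u' where "u' a b c = (tens3 R *v vec3 u) $ (a, b, c)" for a b c
  define d' where "d' a b c = (vec3 d v* tens3 Q) $ (a, b, c)" for a b c
  have u': "vec3 u' = tens3 R *v vec3 u"
    by (simp add: vec_eq_iff u'_def)
  have d': "vec3 d' = vec3 d v* tens3 Q"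
    by (simp add: vec_eq_iff d'_def)
  have Qu': "vec3 u = tens3 Q *v vec3 u'"
    by (simp add: u' matrix_vector_mul_assoc tQR)
  have inv_u: "act3 A *v vec3 u' = 0" if "A \<in> L'" for A
  proof -
    obtain B where B: "B \<in> ?L" "A = R ** B ** Q" using \<open>A \<in> L'\<close> by (auto simp: L'_def)
    have "act3 A *v vec3 u' = tens3 R *v (act3 B *v vec3 u)"
      by (simp add: B u' matrix_vector_mul_assoc moveR)
    then show ?thesis using upper_invariant_act3[OF u B(1)] by simp
  qed
  have covec_0: "0 v* A = 0" for A :: "27 op3"
    by (simp add: vector_matrix_mult_def vec_eq_iff)
  have inv_d: "vec3 d' v* act3 A = 0" if "A \<in> L'" for A
  proof -
    obtain B where B: "B \<in> ?L" "A = R ** B ** Q" using \<open>A \<in> L'\<close> by (auto simp: L'_def)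
    have "vec3 d' v* act3 A = (vec3 d v* act3 B) v* tens3 Q"
      by (simp only: B d' covec_mult_assoc moveQ)
    then show ?thesis using lower_invariant_act3[OF d B(1)] by (simp add: covec_0)
  qed
  define ku kd where "ku = M.comp (vec3 u') 0 12 26" and "kd = M.comp (vec3 d') 0 12 26"
  have ku: "u' a b c = ku * of_int (triad_sign (ix a) (ix b) (ix c))" for a b c
    unfolding ku_def by (rule M.invariant_upper_vector[OF inv_u])
  have kd: "d' a b c = kd * of_int (triad_sign (ix a) (ix b) (ix c))" for a b c
    unfolding kd_def by (rule M.invariant_lower_vector[OF inv_d])
  \<comment> \<open>The normalization forces both tensors to be nonzero, hence also the scalars
    describing them in the weight basis.\<close>
  have "ku \<noteq> 0"
  proof
    assume "ku = 0"
    then have "vec3 u' = 0" using ku by (simp add: vec_eq_iff)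
    then have "vec3 u = 0" using Qu' by simp
    then have "u a b c = 0" for a b c using vec3_nth[of u a b c] by simp
    then show False using normalized[of 0 0] by simp
  qed
  moreover have "kd \<noteq> 0"
  proof
    assume "kd = 0"
    then have "vec3 d' = 0" using kd by (simp add: vec_eq_iff)
    moreover have "vec3 d = vec3 d' v* tens3 R"
      by (simp add: d' covec_mult_assoc tQR)
    ultimately have "vec3 d = 0" by (simp add: covec_0)
    then have "d a b c = 0" for a b c using vec3_nth[of d a b c] by simp
    then show False using normalized[of 0 0] by simp
  qed
  ultimately have kk: "ku * kd \<noteq> 0" by simp

  let ?xs = "independent_operators u d" and ?ys = "independent_operators u' d'"
  have scale_mult: "X ** cmat_scale c Y = cmat_scale c (X ** Y)" "cmat_scale c Y ** X = cmat_scale c (Y ** X)"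
    for c and X Y :: "27 op3"
    by (simp_all add: cmat_scale_def matrix_matrix_mult_def vec_eq_iff sum_distrib_left ac_simps)
  have zero_mult: "0 ** X = 0" "X ** 0 = 0" for X :: "27 op3"
    by (simp_all add: matrix_matrix_mult_def vec_eq_iff)
  have sum_mult: "X ** (\<Sum>k<(20::nat). g k) = (\<Sum>k<20. X ** g k)" "(\<Sum>k<(20::nat). g k) ** X = (\<Sum>k<20. g k ** X)"
    for X :: "27 op3" and g :: "nat \<Rightarrow> 27 op3"
    by (simp_all add: matrix_matrix_mult_def vec_eq_iff sum_distrib_left sum_distrib_right sum.swap[of _ "{..<20}"])
  have entry: "tens3 Q ** ?ys ! k = ?xs ! k ** tens3 Q" if "k < 20" for k
    using arg_cong[OF tens3_independent_operators[OF Qu' d'], of "\<lambda>l. l ! k"] that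
    by (simp add: length_independent_operators)
  have independent: "c k = 0" if c: "(\<Sum>k<20. cmat_scale (c k) (?xs ! k)) = 0" and k: "k < 20" for c k
  proof -
    have "tens3 Q ** (\<Sum>k<20. cmat_scale (c k) (?ys ! k)) = (\<Sum>k<20. cmat_scale (c k) (?xs ! k)) ** tens3 Q"
      unfolding sum_mult scale_mult by (intro sum.cong refl) (simp add: entry)
    also have "\<dots> = 0" unfolding c by (rule zero_mult)
    finally have "tens3 R ** (tens3 Q ** (\<Sum>k<20. cmat_scale (c k) (?ys ! k))) = 0"
      by (simp only: zero_mult)
    then have "(\<Sum>k<20. cmat_scale (c k) (?ys ! k)) = 0"
      by (simp add: matrix_mul_assoc tRQ)
    then show ?thesis
      by (rule M.independent_operators_independent[OF ku kd kk _ k])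
  qed
  obtain B' where B': "finite B'" "End3 L' \<subseteq> cmat.span B'" "card B' \<le> 20"
    using M.End3_spanned_by_20 by blast
  \<comment> \<open>Conjugation back to the given basis carries a spanning set for the model to one
    whose span contains the original commutant.\<close>
  define g where "g Y = tens3 Q ** Y ** tens3 R" for Y :: "27 op3"
  have span_image: "End3 ?L \<subseteq> cmat.span (g ` B')"
  proof
    fix X assume X: "X \<in> End3 ?L"
    define Y where "Y = tens3 R ** X ** tens3 Q"
    have "Y ** act3 A = act3 A ** Y" if "A \<in> L'" for A
    proof -
      obtain B where B: "B \<in> ?L" "A = R ** B ** Q" using \<open>A \<in> L'\<close> by (auto simp: L'_def)
      have "Y ** act3 A = tens3 R ** X ** (tens3 Q ** act3 A)"
        by (simp only: Y_def matrix_mul_assoc)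
      also have "tens3 Q ** act3 A = act3 B ** tens3 Q"
        unfolding B(2) by (rule moveQ)
      also have "tens3 R ** X ** (act3 B ** tens3 Q) = tens3 R ** (X ** act3 B) ** tens3 Q"
        by (simp only: matrix_mul_assoc)
      also have "X ** act3 B = act3 B ** X"
        using X B(1) unfolding End3_def by blast
      also have "tens3 R ** (act3 B ** X) ** tens3 Q = (tens3 R ** act3 B) ** X ** tens3 Q"
        by (simp only: matrix_mul_assoc)
      also have "tens3 R ** act3 B = act3 A ** tens3 R"
        unfolding B(2) by (rule moveR)
      also have "act3 A ** tens3 R ** X ** tens3 Q = act3 A ** Y"
        by (simp only: Y_def matrix_mul_assoc)
      finally show ?thesis .
    qed
    then have "Y \<in> cmat.span B'" using B'(2) by (auto simp: End3_def)
    then have "g Y \<in> cmat.span (g ` B')"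
    proof (induction rule: cmat.span_induct_alt)
      case base
      have "g 0 = 0" by (simp only: g_def zero_mult)
      then show ?case by (simp add: cmat.span_zero)
    next
      case (step c Y1 Y2)
      have "g (cmat_scale c Y1 + Y2) = cmat_scale c (g Y1) + g Y2"
        by (simp add: g_def matrix_add_ldistrib matrix_mult_add_left scale_mult)
      then show ?case
        using step by (simp add: cmat.span_add cmat.span_scale cmat.span_base)
    qed
    moreover have "g Y = (tens3 Q ** tens3 R) ** X ** (tens3 Q ** tens3 R)"
      by (simp only: g_def Y_def matrix_mul_assoc)
    then have "g Y = X" by (simp add: tQR)
    ultimately show "X \<in> cmat.span (g ` B')" by simp
  qed
  have card_image: "card (g ` B') \<le> length ?xs"
    using card_image_le[OF B'(1), of g] B'(3) by (simp add: length_independent_operators)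
  have gens: "order_zero \<union> order_two u d \<union> order_four u d \<subseteq> End3 ?L"
    by (rule generators_subset_End3[OF u d])
  have "\<forall>c. (\<Sum>k<length ?xs. cmat_scale (c k) (?xs ! k)) = 0 \<longrightarrow> (\<forall>k<length ?xs. c k = 0)"
    unfolding length_independent_operators by (intro allI impI) (rule independent)
  \<comment> \<open>The bounds meet here: twenty independent members of the commutant against a
    spanning set of at most 20 elements.\<close>
  note spans = cmat.independent_list_spans[OF order_trans[OF independent_operators_subset gens] this
      finite_imageI[OF B'(1), of g] span_image card_image, unfolded length_independent_operators]
  have sub: "cmat.subspace (End3 ?L)"
    using operator_algebra_End3 by (auto simp: operator_algebra_def)
  have gen: "End3 ?L = cmat.span (order_zero \<union> order_two u d \<union> order_four u d)"
    by (rule equalityI[OF order_trans[OF spans(1) cmat.span_mono[OF independent_operators_subset]]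
          cmat.span_minimal[OF gens sub]])
  have sw: "End3 (special_unitary_algebra :: (complex^27^27) set) = cmat.span order_zero"
    by (rule schur_weyl_3) simp
  have "cmat.span order_zero \<subseteq> End3 ?L"
    by (rule cmat.span_minimal[OF order_zero_subset_End3 sub])
  then have "End3 (special_unitary_algebra :: (complex^27^27) set) \<subseteq> End3 ?L"
    unfolding sw .
  then show ?thesis
    by (intro conjI spans(2) operator_algebra_End3 sw gen)
qed

end
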